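(* Let $D\subset\mathbb{C}^n$ be a bounded domain and let $\varphi\in C^2(D)$ be a real-valued function. Suppose there exists a non-zero $f\in A^2(D,\varphi)$ which is $L^2$ divisible with respect to $\varphi$, i.e. such that for every integer $k\geq 1$, every $g=(g_1,\ldots,g_k)\in(\mathcal{O}(D))^{\oplus k}$ and every smooth plurisubharmonic function $\psi$ on $D$ satisfying (1) $g_1,\ldots,g_k$ have no common zeros in $D$; (2) $i\partial\bar\partial\psi\otimes\operatorname{Id}_{\underline{\mathbb{C}}^k}+i\beta^*\wedge\beta>0$ on $D$ in the sense of Nakano; (3) $I_{\varphi,\psi,g}(f)<\infty$, there exists $h=(h_1,\ldots,h_k)\in(\mathcal{O}(D))^{\oplus k}$ such that $f=g\cdot h$ and $$\|h\|^2_{\varphi+\psi}\leq I_{\varphi,\psi,g}(f).$$ Then $\varphi$ is plurisubharmonic on $D$.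
   Context: Notation. $\mathcal{O}(D)$ is the space of holomorphic functions on $D$; $dV$ is Lebesgue measure; $A^2(D,\varphi)$ is the set of $f\in\mathcal{O}(D)$ with $\int_D|f|^2e^{-\varphi}dV<\infty$ (the paper assumes throughout that $A^2(D,\varphi)\neq\{0\}$). For $h=(h_1,\ldots,h_k)$, $|h|^2=\sum_\lambda|h_\lambda|^2$, $g\cdot h=\sum_\lambda g_\lambda h_\lambda$, and $\|h\|^2_{\varphi}=\int_D|h|^2e^{-\varphi}dV$ for any weight $\varphi$. $\underline{\mathbb{C}}^k$ is the trivial bundle of rank $k$ over $D$ with standard metric and standard frame $e_1,\ldots,e_k$. On $\mathbb{C}^n$ use the standard Euclidean metric $\omega=i\sum_j dz_j\wedge d\bar z_j$, normalized so that $dz_1,\ldots,dz_n$ are orthonormal; $dz=dz_1\wedge\cdots\wedge dz_n$; $\Lambda$ is the pointwise adjoint of $L=\omega\wedge\cdot$. Second fundamental form. If $g_1,\ldots,g_k$ have no common zeros, $g$ defines a surjective morphism $\underline{\mathbb{C}}^k\to\underline{\mathbb{C}}$, $h\mapsto g\cdot h$, with kernel $S=\operatorname{Ker} g$. The quotient $\underline{\mathbb{C}}$ carries the quotient metric $|q|^2/|g|^2$. The second fundamental form of $S$ is $$\beta=|g|^2\Big(-\partial\big(\tfrac{g_1}{|g|^2}\big),\ldots,-\partial\big(\tfrac{g_k}{|g|^2}\big)\Big),$$ a $(1,0)$-form with values in $\operatorname{Hom}(\underline{\mathbb{C}}^k,\underline{\mathbb{C}})$ (vanishing on $S^\perp$).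 Its adjoint with respect to these metrics is the $S$-valued $(0,1)$-form $\beta^*=-\bar\partial g^*$, where $g^*=(\bar g_1/|g|^2,\ldots,\bar g_k/|g|^2)$. Positivity. Writing $\beta=\sum_j dz_j\otimes\beta_j$, one has $\beta^*\wedge\beta=-\sum_{j,l}dz_j\wedge d\bar z_l\otimes\beta_l^*\beta_j$. The condition $i\partial\bar\partial\psi\otimes\operatorname{Id}_{\underline{\mathbb{C}}^k}+i\beta^*\wedge\beta>0$ in the sense of Nakano means that at each point of $D$, for every non-zero $(u_{j\lambda})_{1\leq j\leq n,\,1\leq\lambda\leq k}$, with $u_j=(u_{j1},\ldots,u_{jk})\in\mathbb{C}^k$, $$\sum_{j,l}\frac{\partial^2\psi}{\partial z_j\partial\bar z_l}\langle u_j,u_l\rangle-\frac{1}{|g|^2}\Big|\sum_j\beta_j(u_j)\Big|^2>0.$$ The operator $[i\partial\bar\partial\psi\otimes\operatorname{Id}_{\underline{\mathbb{C}}^k}+i\beta^*\wedge\beta,\Lambda]$ acting on $\underline{\mathbb{C}}^k$-valued $(n,1)$-forms $u=\sum_{j,\lambda}u_{j\lambda}\,dz\wedge d\bar z_j\otimes e_\lambda$ is the self-adjoint operator whose quadratic form $\langle[\cdot,\Lambda]u,u\rangle$ is the left-hand side above. The functional. With $(\cdot,\cdot)$ the pointwise inner product on $(n,1)$-forms, $$I_{\varphi,\psi,g}(f)=\int_D\Big\{\frac{1}{|g|^2}+\Big(\big[i\partial\bar\partial\psi\otimes\operatorname{Id}_{\underline{\mathbb{C}}^k}+i\beta^*\wedge\beta,\Lambda\big]^{-1}\beta^*\wedge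 dz,\ \beta^*\wedge dz\Big)\Big\}|f|^2e^{-\varphi-\psi}dV.$$ *)

theory Defs
  imports "HOL-Analysis.Analysis"
begin

section \<open>Function classes\<close>

text \<open>Complex differentiability at every point: the (real) Frechet derivative is complex linear.
  Only used for open \<open>D\<close>.\<close>

definition holomorphic_on_cvec :: "((complex^'n::finite) \<Rightarrow> complex) \<Rightarrow> (complex^'n) set \<Rightarrow> bool" where
  "holomorphic_on_cvec f D \<longleftrightarrow>
     (\<forall>z\<in>D. \<exists>L. (f has_derivative L) (at z) \<and> (\<forall>c v. L (c *s v) = c * L v))"

text \<open>\<open>Ck_on m f D\<close>: on the open set \<open>D\<close>, \<open>f\<close> is \<open>m\<close> times continuously real differentiable,
  by recursion on the directional derivatives.\<close>

primrec Ck_on :: "nat \<Rightarrow> ('a::real_normed_vector \<Rightarrow> 'b::real_normed_vector) \<Rightarrow> 'a set \<Rightarrow> bool" where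
  "Ck_on 0 f D \<longleftrightarrow> continuous_on D f"
| "Ck_on (Suc m) f D \<longleftrightarrow>
     (\<forall>x\<in>D. f differentiable (at x)) \<and> (\<forall>v. Ck_on m (\<lambda>x. frechet_derivative f (at x) v) D)"

definition smooth_on :: "('a::real_normed_vector \<Rightarrow> 'b::real_normed_vector) \<Rightarrow> 'a set \<Rightarrow> bool" where
  "smooth_on f D \<longleftrightarrow> (\<forall>m. Ck_on m f D)"

definition upper_semicontinuous_on :: "'a::topological_space set \<Rightarrow> ('a \<Rightarrow> real) \<Rightarrow> bool" where
  "upper_semicontinuous_on D u \<longleftrightarrow> (\<forall>x\<in>D. \<forall>c>u x. \<forall>\<^sub>F y in at x within D. u y < c)"

text \<open>Only real-valued functions occur as weights, so the value \<open>- \<infinity>\<close> is excluded here. A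
  semicontinuous function is bounded above on circles; integrability excludes the mean value
  \<open>- \<infinity>\<close>, for which the sub-mean value inequality fails.\<close>

definition subharmonic_on :: "complex set \<Rightarrow> (complex \<Rightarrow> real) \<Rightarrow> bool" where
  "subharmonic_on U u \<longleftrightarrow> upper_semicontinuous_on U u \<and>
     (\<forall>a r. 0 < r \<and> cball a r \<subseteq> U \<longrightarrow>
        set_integrable lborel {0..2*pi} (\<lambda>t. u (a + complex_of_real r * cis t)) \<and>
        u a \<le> (LBINT t:{0..2*pi}. u (a + complex_of_real r * cis t)) / (2*pi))"

definition plurisubharmonic_on :: "(complex^'n::finite) set \<Rightarrow> (complex^'n \<Rightarrow> real) \<Rightarrow> bool" where
  "plurisubharmonic_on D u \<longleftrightarrow> upper_semicontinuous_on D u \<and>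
     (\<forall>a b. subharmonic_on {t. a + t *s b \<in> D} (\<lambda>t. u (a + t *s b)))"

definition A2 :: "(complex^'n::finite) set \<Rightarrow> (complex^'n \<Rightarrow> real) \<Rightarrow> (complex^'n \<Rightarrow> complex) set" where
  "A2 D \<phi> = {f. holomorphic_on_cvec f D \<and>
     (\<integral>\<^sup>+z\<in>D. ennreal ((cmod (f z))\<^sup>2 * exp (- \<phi> z)) \<partial>lborel) < \<infinity>}"


section \<open>Tuples of functions and Wirtinger derivatives\<close>

text \<open>Tuples \<open>(g\<^sub>1, \<dots>, g\<^sub>k)\<close> are families \<open>g p\<close> with \<open>p < k\<close>; components with
  \<open>k \<le> p\<close> are ignored throughout.\<close>

definition norm2 :: "nat \<Rightarrow> (nat \<Rightarrow> 'a \<Rightarrow> complex) \<Rightarrow> 'a \<Rightarrow> real" where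
  "norm2 k g z = (\<Sum>p<k. (cmod (g p z))\<^sup>2)"

definition weighted_norm2 ::
  "(complex^'n::finite) set \<Rightarrow> (complex^'n \<Rightarrow> real) \<Rightarrow> nat \<Rightarrow> (nat \<Rightarrow> complex^'n \<Rightarrow> complex) \<Rightarrow> ennreal" where
  "weighted_norm2 D \<phi> k h = (\<integral>\<^sup>+z\<in>D. ennreal (norm2 k h z * exp (- \<phi> z)) \<partial>lborel)"

definition wirt :: "'n::finite \<Rightarrow> (complex^'n \<Rightarrow> complex) \<Rightarrow> complex^'n \<Rightarrow> complex" where
  "wirt j F z = (frechet_derivative F (at z) (axis j 1)
                 - \<i> * frechet_derivative F (at z) (axis j \<i>)) / 2"

definition wirt_bar :: "'n::finite \<Rightarrow> (complex^'n \<Rightarrow> complex) \<Rightarrow> complex^'n \<Rightarrow> complex" where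
  "wirt_bar j F z = (frechet_derivative F (at z) (axis j 1)
                     + \<i> * frechet_derivative F (at z) (axis j \<i>)) / 2"

text \<open>\<open>\<partial>\<^sup>2\<psi> / \<partial>z\<^sub>j \<partial>zbar\<^sub>l\<close>.\<close>

definition levi :: "'n::finite \<Rightarrow> 'n \<Rightarrow> (complex^'n \<Rightarrow> real) \<Rightarrow> complex^'n \<Rightarrow> complex" where
  "levi j l \<psi> z = wirt j (wirt_bar l (\<lambda>w. complex_of_real (\<psi> w))) z"


section \<open>Second fundamental form and Nakano positivity\<close>

text \<open>\<open>\<beta> = \<Sum>\<^sub>j dz\<^sub>j \<otimes> \<beta>\<^sub>j\<close>, where \<open>\<beta>\<^sub>j\<close> is the row vector with entries \<open>beta k g z j p\<close>, and
  \<open>\<beta>\<^sup>* = \<Sum>\<^sub>j dzbar\<^sub>j \<otimes> \<beta>\<^sub>j\<^sup>*\<close>, where \<open>\<beta>\<^sub>j\<^sup>*\<close> is the column vector with entries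
  \<open>beta_star k g z j p\<close>, i.e. \<open>\<beta>\<^sup>* = - dbar g\<^sup>*\<close>.\<close>

definition beta ::
  "nat \<Rightarrow> (nat \<Rightarrow> complex^'n::finite \<Rightarrow> complex) \<Rightarrow> complex^'n \<Rightarrow> 'n \<Rightarrow> nat \<Rightarrow> complex" where
  "beta k g z j p =
     complex_of_real (norm2 k g z) * (- wirt j (\<lambda>w. g p w / complex_of_real (norm2 k g w)) z)"

definition beta_star ::
  "nat \<Rightarrow> (nat \<Rightarrow> complex^'n::finite \<Rightarrow> complex) \<Rightarrow> complex^'n \<Rightarrow> 'n \<Rightarrow> nat \<Rightarrow> complex" where
  "beta_star k g z j p = - wirt_bar j (\<lambda>w. cnj (g p w) / complex_of_real (norm2 k g w)) z"

definition beta_app ::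
  "nat \<Rightarrow> (nat \<Rightarrow> complex^'n::finite \<Rightarrow> complex) \<Rightarrow> complex^'n \<Rightarrow> ('n \<Rightarrow> nat \<Rightarrow> complex) \<Rightarrow> complex" where
  "beta_app k g z u = (\<Sum>j\<in>UNIV. \<Sum>p<k. beta k g z j p * u j p)"

definition nakano_form ::
  "nat \<Rightarrow> (nat \<Rightarrow> complex^'n::finite \<Rightarrow> complex) \<Rightarrow> (complex^'n \<Rightarrow> real) \<Rightarrow> complex^'n
     \<Rightarrow> ('n \<Rightarrow> nat \<Rightarrow> complex) \<Rightarrow> real" where
  "nakano_form k g \<psi> z u =
     Re (\<Sum>j\<in>UNIV. \<Sum>l\<in>UNIV. levi j l \<psi> z * (\<Sum>p<k. u j p * cnj (u l p)))
     - (cmod (beta_app k g z u))\<^sup>2 / norm2 k g z"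

definition nakano_positive_on ::
  "(complex^'n::finite) set \<Rightarrow> nat \<Rightarrow> (nat \<Rightarrow> complex^'n \<Rightarrow> complex) \<Rightarrow> (complex^'n \<Rightarrow> real) \<Rightarrow> bool" where
  "nakano_positive_on D k g \<psi> \<longleftrightarrow>
     (\<forall>z\<in>D. \<forall>u. (\<exists>j. \<exists>p<k. u j p \<noteq> 0) \<longrightarrow> nakano_form k g \<psi> z u > 0)"


section \<open>The functional\<close>

text \<open>A \<open>\<complex>\<^sup>k\<close>-valued \<open>(n,1)\<close>-form \<open>\<Sum> u\<^sub>j\<^sub>p dz \<and> dzbar\<^sub>j \<otimes> e\<^sub>p\<close> at a point is its
  coefficient family \<open>u\<close>, which vanishes for \<open>k \<le> p\<close>; the basis
  \<open>dz \<and> dzbar\<^sub>j \<otimes> e\<^sub>p\<close> is orthonormal.\<close>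

definition n1_forms :: "nat \<Rightarrow> ('n::finite \<Rightarrow> nat \<Rightarrow> complex) set" where
  "n1_forms k = {u. \<forall>j p. k \<le> p \<longrightarrow> u j p = 0}"

definition n1_inner :: "nat \<Rightarrow> ('n::finite \<Rightarrow> nat \<Rightarrow> complex) \<Rightarrow> ('n \<Rightarrow> nat \<Rightarrow> complex) \<Rightarrow> complex" where
  "n1_inner k u v = (\<Sum>j\<in>UNIV. \<Sum>p<k. u j p * cnj (v j p))"

text \<open>The operator \<open>[i\<partial>dbar \<psi> \<otimes> Id + i \<beta>\<^sup>* \<and> \<beta>, \<Lambda>]\<close> in coordinates:
  \<open>(u\<^sub>j)\<^sub>j \<mapsto> (\<Sum>\<^sub>j \<psi>\<^sub>j\<^sub>l u\<^sub>j - \<beta>\<^sub>l\<^sup>* (\<Sum>\<^sub>j \<beta>\<^sub>j u\<^sub>j))\<^sub>l\<close>. That \<open>nakano_form\<close> is its quadratic form is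
  lemma \<open>n1_inner_curv_op\<close> below.\<close>

definition curv_op ::
  "nat \<Rightarrow> (nat \<Rightarrow> complex^'n::finite \<Rightarrow> complex) \<Rightarrow> (complex^'n \<Rightarrow> real) \<Rightarrow> complex^'n
     \<Rightarrow> ('n \<Rightarrow> nat \<Rightarrow> complex) \<Rightarrow> ('n \<Rightarrow> nat \<Rightarrow> complex)" where
  "curv_op k g \<psi> z u = (\<lambda>l p. if p < k
     then (\<Sum>j\<in>UNIV. levi j l \<psi> z * u j p) - beta_star k g z l p * beta_app k g z u
     else 0)"

text \<open>The sign comes from
  \<open>\<beta>\<^sup>* \<and> dz = \<Sum>\<^sub>j dzbar\<^sub>j \<and> dz \<otimes> \<beta>\<^sub>j\<^sup>* = (-1)\<^sup>n \<Sum>\<^sub>j dz \<and> dzbar\<^sub>j \<otimes> \<beta>\<^sub>j\<^sup>*\<close>.\<close>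

definition beta_star_dz ::
  "nat \<Rightarrow> (nat \<Rightarrow> complex^'n::finite \<Rightarrow> complex) \<Rightarrow> complex^'n \<Rightarrow> ('n \<Rightarrow> nat \<Rightarrow> complex)" where
  "beta_star_dz k g z = (\<lambda>j p. if p < k then (-1) ^ CARD('n) * beta_star k g z j p else 0)"

text \<open>The integrand is nonnegative where \<open>curv_op\<close> is positive definite, so that \<open>ennreal\<close>
  truncates nothing under Nakano positivity.\<close>

definition I_functional ::
  "(complex^'n::finite) set \<Rightarrow> (complex^'n \<Rightarrow> real) \<Rightarrow> (complex^'n \<Rightarrow> real) \<Rightarrow> nat
     \<Rightarrow> (nat \<Rightarrow> complex^'n \<Rightarrow> complex) \<Rightarrow> (complex^'n \<Rightarrow> complex) \<Rightarrow> ennreal" where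
  "I_functional D \<phi> \<psi> k g f =
     (\<integral>\<^sup>+z\<in>D. ennreal
        ((1 / norm2 k g z
          + Re (n1_inner k (the_inv_into (n1_forms k) (curv_op k g \<psi> z) (beta_star_dz k g z))
                           (beta_star_dz k g z)))
         * (cmod (f z))\<^sup>2 * exp (- \<phi> z - \<psi> z)) \<partial>lborel)"

definition L2_divisible ::
  "(complex^'n::finite) set \<Rightarrow> (complex^'n \<Rightarrow> real) \<Rightarrow> (complex^'n \<Rightarrow> complex) \<Rightarrow> bool" where
  "L2_divisible D \<phi> f \<longleftrightarrow>
     (\<forall>k\<ge>1. \<forall>g \<psi>.
        (\<forall>p<k. holomorphic_on_cvec (g p) D) \<and>
        smooth_on \<psi> D \<and> plurisubharmonic_on D \<psi> \<and>
        (\<forall>z\<in>D. \<exists>p<k. g p z \<noteq> 0) \<and>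
        nakano_positive_on D k g \<psi> \<and>
        I_functional D \<phi> \<psi> k g f < \<infinity>
        \<longrightarrow> (\<exists>h. (\<forall>p<k. holomorphic_on_cvec (h p) D) \<and>
                 (\<forall>z\<in>D. f z = (\<Sum>p<k. g p z * h p z)) \<and>
                 weighted_norm2 D (\<lambda>z. \<phi> z + \<psi> z) k h \<le> I_functional D \<phi> \<psi> k g f))"


section \<open>Consistency of the encoding\<close>

lemma norm2_pos:
  assumes "\<exists>p<k. g p z \<noteq> 0"
  shows "norm2 k g z > 0"
proof -
  obtain l where "l < k" "g l z \<noteq> 0" using assms by auto
  then show ?thesis
    unfolding norm2_def by (intro sum_pos2[of _ l]) auto
qed

lemma wirt_bar_cnj:
  assumes "F differentiable (at z)"
  shows "wirt_bar j (\<lambda>w. cnj (F w)) z = cnj (wirt j F z)"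
proof -
  have "(F has_derivative frechet_derivative F (at z)) (at z)"
    using assms frechet_derivative_works by blast
  then have "((\<lambda>w. cnj (F w)) has_derivative (\<lambda>v. cnj (frechet_derivative F (at z) v))) (at z)"
    by (rule bounded_linear.has_derivative[OF bounded_linear_cnj])
  then have "frechet_derivative (\<lambda>w. cnj (F w)) (at z) = (\<lambda>v. cnj (frechet_derivative F (at z) v))"
    by (metis frechet_derivative_at)
  then show ?thesis
    by (simp add: wirt_bar_def wirt_def)
qed

lemma norm2_differentiable:
  assumes "\<And>p. p < k \<Longrightarrow> g p differentiable (at z)"
  shows "(\<lambda>w. complex_of_real (norm2 k g w)) differentiable (at z)"
proof -
  have "(\<lambda>w. g p w * cnj (g p w)) differentiable (at z)" if "p < k" for p
  proof -
    have "(\<lambda>w. cnj (g p w)) differentiable (at z)"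
      using assms[OF that] bounded_linear.has_derivative[OF bounded_linear_cnj]
      unfolding differentiable_def by blast
    then show ?thesis
      using assms[OF that] by (intro differentiable_mult)
  qed
  then have "(\<lambda>w. \<Sum>p<k. g p w * cnj (g p w)) differentiable (at z)"
    by (intro differentiable_sum) auto
  moreover have "(\<lambda>w. \<Sum>p<k. g p w * cnj (g p w)) = (\<lambda>w. complex_of_real (norm2 k g w))"
    by (simp add: norm2_def complex_norm_square del: of_real_power)
  ultimately show ?thesis by simp
qed

text \<open>\<open>\<beta>\<^sub>j\<^sup>*\<close> is the adjoint of \<open>\<beta>\<^sub>j\<close> with respect to the quotient metric \<open>|q|\<^sup>2/|g|\<^sup>2\<close>.\<close>

lemma beta_star_eq:
  assumes hol: "\<forall>p<k. holomorphic_on_cvec (g p) D" and z: "z \<in> D"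
    and nz: "\<exists>p<k. g p z \<noteq> 0" and l: "p < k"
  shows "beta_star k g z j p = cnj (beta k g z j p) / complex_of_real (norm2 k g z)"
proof -
  have d: "g \<mu> differentiable (at z)" if "\<mu> < k" for \<mu>
    using hol z that unfolding holomorphic_on_cvec_def differentiable_def by blast
  have n: "norm2 k g z > 0" using nz by (rule norm2_pos)
  have "(\<lambda>w. g p w / complex_of_real (norm2 k g w)) differentiable (at z)"
    using d l n by (intro differentiable_divide norm2_differentiable) auto
  from wirt_bar_cnj[OF this, of j] n show ?thesis
    by (simp add: beta_star_def beta_def)
qed

lemma n1_inner_curv_op:
  assumes hol: "\<forall>p<k. holomorphic_on_cvec (g p) D" and z: "z \<in> D"
    and nz: "\<exists>p<k. g p z \<noteq> 0"
  shows "Re (n1_inner k (curv_op k g \<psi> z u) u) = nakano_form k g \<psi> z u"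
proof -
  let ?N = "complex_of_real (norm2 k g z)" and ?B = "beta_app k g z u"
  have "n1_inner k (curv_op k g \<psi> z u) u =
      (\<Sum>l\<in>UNIV. \<Sum>p<k. (\<Sum>j\<in>UNIV. levi j l \<psi> z * u j p) * cnj (u l p))
      - (\<Sum>l\<in>UNIV. \<Sum>p<k. beta_star k g z l p * ?B * cnj (u l p))"
    by (simp add: n1_inner_def curv_op_def left_diff_distrib sum_subtractf)
  also have "(\<Sum>l\<in>UNIV. \<Sum>p<k. (\<Sum>j\<in>UNIV. levi j l \<psi> z * u j p) * cnj (u l p))
      = (\<Sum>l\<in>UNIV. \<Sum>j\<in>UNIV. \<Sum>p<k. levi j l \<psi> z * u j p * cnj (u l p))"
    by (simp add: sum_distrib_right, intro sum.cong refl, rule sum.swap)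
  also have "\<dots> = (\<Sum>j\<in>UNIV. \<Sum>l\<in>UNIV. levi j l \<psi> z * (\<Sum>p<k. u j p * cnj (u l p)))"
    by (subst sum.swap) (simp add: sum_distrib_left mult.assoc)
  also have "(\<Sum>l\<in>UNIV. \<Sum>p<k. beta_star k g z l p * ?B * cnj (u l p))
      = (\<Sum>l\<in>UNIV. \<Sum>p<k. ?B / ?N * cnj (beta k g z l p * u l p))"
    by (intro sum.cong refl) (simp add: beta_star_eq[OF hol z nz])
  also have "\<dots> = ?B / ?N * cnj ?B"
    by (simp add: beta_app_def sum_distrib_left)
  also have "\<dots> = complex_of_real ((cmod ?B)\<^sup>2 / norm2 k g z)"
    by (simp add: complex_norm_square del: of_real_power)
  finally show ?thesis
    by (simp add: nakano_form_def)
qed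

text \<open>Hence under Nakano positivity \<open>curv_op\<close> is an injective endomorphism of the finite-dimensional
  space \<open>n1_forms k\<close>, and \<open>the_inv_into\<close> is its inverse.\<close>

lemma curv_op_inj_on:
  assumes hol: "\<forall>p<k. holomorphic_on_cvec (g p) D" and z: "z \<in> D"
    and nz: "\<exists>p<k. g p z \<noteq> 0" and pos: "nakano_positive_on D k g \<psi>"
  shows "inj_on (curv_op k g \<psi> z) (n1_forms k)"
    and "curv_op k g \<psi> z ` n1_forms k \<subseteq> n1_forms k"
proof -
  show "curv_op k g \<psi> z ` n1_forms k \<subseteq> n1_forms k"
    by (auto simp: n1_forms_def curv_op_def)
  show "inj_on (curv_op k g \<psi> z) (n1_forms k)"
  proof (rule inj_onI)
    fix u v assume uv: "u \<in> n1_forms k" "v \<in> n1_forms k"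
      and eq: "curv_op k g \<psi> z u = curv_op k g \<psi> z v"
    define w where "w = (\<lambda>j p. u j p - v j p)"
    have "curv_op k g \<psi> z w l p = curv_op k g \<psi> z u l p - curv_op k g \<psi> z v l p" for l p
      by (simp add: curv_op_def w_def beta_app_def right_diff_distrib sum_subtractf)
    then have "curv_op k g \<psi> z w = (\<lambda>_ _. 0)" by (simp add: eq fun_eq_iff)
    then have "nakano_form k g \<psi> z w = 0"
      using n1_inner_curv_op[OF hol z nz, of \<psi> w] by (simp add: n1_inner_def)
    then have "w j p = 0" if "p < k" for j p
      using pos z that unfolding nakano_positive_on_def by (metis less_irrefl)
    then have "u j p = v j p" for j p
      using uv by (cases "p < k") (auto simp: w_def n1_forms_def)
    then show "u = v" by blast
  qed
qed

end

theory Submission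
  imports Defs "HOL-Complex_Analysis.Complex_Analysis" "HOL-Real_Asymp.Real_Asymp"
begin

text \<open>Division with two well chosen generators amounts to approximating an antiholomorphic linear
  function by holomorphic ones in a weighted \<open>L\<^sup>2\<close> space, with the constant of Hoermander's theorem.
  That constant leaves no room for negative curvature of the weight: if the Levi form of \<open>\<phi>\<close> were
  negative somewhere, a dual test function concentrated there would violate the estimate.

  In detail, let \<open>b\<close> be a unit vector, let \<open>a\<close> be a point with \<open>f(a) \<noteq> 0\<close>, put
  \<open>w(z) = \<Sum> cnj b\<^sub>j (z\<^sub>j - a\<^sub>j)\<close>, and divide \<open>f\<close> by \<open>g = (1, \<epsilon> w)\<close> with \<open>\<psi>(z) = s |z - a|\<^sup>2\<close>. Then \<open>\<beta>\<^sup>*\<close> is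
  an eigenvector of the curvature operator, so the functional is explicit
  (\<open>skoda_gen_integrand\<close>). A solution \<open>h\<close> splits pointwise into the minimal solution \<open>f g\<^sup>*\<close> and a
  part in \<open>Ker g\<close>; the norm of the former cancels the term \<open>1/|g|\<^sup>2\<close>, and what remains says that
  \<open>H = h\<^sub>2/\<epsilon>\<close> is holomorphic with
  \<open>\<integral> |H - f cnj w/|g|\<^sup>2|\<^sup>2 e\<^sup>-\<^sup>\<phi>\<^sup>-\<^sup>\<psi> \<le> (s - \<epsilon>\<^sup>2)\<^sup>-\<^sup>1 \<integral> |f|\<^sup>2 e\<^sup>-\<^sup>\<phi>\<^sup>-\<^sup>\<psi>\<close> (\<open>divisible_imp_almost_holomorphic\<close>).

  For a cut-off function \<open>\<kappa>\<close> around \<open>a\<close> let \<open>T = - e\<^sup>\<phi>\<^sup>+\<^sup>\<psi> \<partial>\<^sub>b(\<kappa> f e\<^sup>-\<^sup>\<phi>\<^sup>-\<^sup>\<psi>)\<close>. This is orthogonal to all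
  holomorphic functions, its inner product with \<open>f cnj w\<close> is \<open>\<integral> \<kappa> |f|\<^sup>2 e\<^sup>-\<^sup>\<phi>\<^sup>-\<^sup>\<psi>\<close>, and a second integration by
  parts gives \<open>\<parallel>T\<parallel>\<^sup>2 = \<integral> \<kappa>\<^sup>2 |f|\<^sup>2 (s + \<phi>\<^sub>b\<^sub>b) e\<^sup>-\<^sup>\<phi>\<^sup>-\<^sup>\<psi>\<close> up to terms supported where \<open>\<kappa>\<close> is not constant
  (\<open>dual_estimate\<close>). Let \<open>\<epsilon>\<close> tend to \<open>0\<close>. If \<open>\<phi>\<^sub>b\<^sub>b \<le> - c < 0\<close> near \<open>a\<close>, then, with
  \<open>J = \<integral> \<kappa> |f|\<^sup>2 e\<^sup>-\<^sup>\<phi>\<^sup>-\<^sup>\<psi>\<close>, the estimate reads \<open>2 J \<le> J + (s - c) J/s + error\<close>, where the error is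
  exponentially smaller than \<open>J\<close> as \<open>s\<close> tends to infinity, because \<open>e\<^sup>-\<^sup>\<psi>\<close> concentrates at \<open>a\<close>: a contradiction
  (\<open>line_laplacian_nonneg_at_nonzero\<close>).

  The points with \<open>f(a) \<noteq> 0\<close> are dense by the identity theorem, so the Levi form is nonnegative on
  \<open>D\<close> by continuity, and for a \<open>C\<^sup>2\<close> function this yields the sub-mean value inequality on every
  complex line.\<close>

section \<open>Integration by parts along a complex line\<close>

lemma set_integrable_compact:
  fixes f :: "'a::euclidean_space \<Rightarrow> 'b::euclidean_space"
  assumes "compact C" "continuous_on C f"
  shows "set_integrable lborel C f"
  using borel_integrable_compact[OF assms] unfolding set_integrable_def
  by (simp add: indicator_def if_distrib if_distribR cong: if_cong)

text \<open>Translation invariance makes the integral of every difference quotient vanish, and the bound on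
  the derivative dominates the difference quotients.\<close>

lemma integral_directional_derivative_eq_0:
  fixes F d :: "'a::euclidean_space \<Rightarrow> complex"
  assumes F: "integrable lborel F" and C: "bounded C" "\<And>x. x \<notin> C \<Longrightarrow> F x = 0"
    and der: "\<And>x. ((\<lambda>t. F (x + t *\<^sub>R v)) has_vector_derivative d x) (at 0)"
    and K: "\<And>x. norm (d x) \<le> K"
  shows "integral\<^sup>L lborel d = 0"
proof -
  have der': "((\<lambda>t. F (x + t *\<^sub>R v)) has_vector_derivative d (x + t *\<^sub>R v)) (at t)" for x t
  proof -
    have "((\<lambda>\<tau>. F ((x + t *\<^sub>R v) + \<tau> *\<^sub>R v)) \<circ> (\<lambda>\<tau>. \<tau> - t) has_vector_derivative 1 *\<^sub>R d (x + t *\<^sub>R v)) (at t)"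
      by (rule vector_diff_chain_at) (auto intro!: derivative_eq_intros der[of "x + t *\<^sub>R v", simplified])
    moreover have "(\<lambda>\<tau>. F ((x + t *\<^sub>R v) + \<tau> *\<^sub>R v)) \<circ> (\<lambda>\<tau>. \<tau> - t) = (\<lambda>t. F (x + t *\<^sub>R v))"
      by (auto simp: fun_eq_iff algebra_simps)
    ultimately show ?thesis by simp
  qed
  have lip: "norm (F (x + t *\<^sub>R v) - F x) \<le> K * t" if "0 \<le> t" for x t
  proof -
    have "norm ((\<lambda>t. F (x + t *\<^sub>R v)) t - (\<lambda>t. F (x + t *\<^sub>R v)) 0) \<le> K * norm (t - 0)"
    proof (rule differentiable_bound[of "{0..t}" _ "\<lambda>u h. h *\<^sub>R d (x + u *\<^sub>R v)"])
      show "((\<lambda>t. F (x + t *\<^sub>R v)) has_derivative (\<lambda>h. h *\<^sub>R d (x + u *\<^sub>R v))) (at u within {0..t})" for u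
        using der' has_vector_derivative_def has_derivative_at_withinI by metis
      show "onorm (\<lambda>h. h *\<^sub>R d (x + u *\<^sub>R v)) \<le> K" for u
      proof (rule onorm_bound)
        show "0 \<le> K" using K[of x] norm_ge_zero[of "d x"] by linarith
        show "norm (h *\<^sub>R d (x + u *\<^sub>R v)) \<le> K * norm h" for h
          using mult_left_mono[OF K, of "\<bar>h\<bar>"] by (simp add: mult.commute)
      qed
    qed (use that in auto)
    then show ?thesis using that by simp
  qed
  define Q where "Q n x = of_nat (Suc n) * (F (x + (1 / real (Suc n)) *\<^sub>R v) - F x)" for n x
  have trans: "has_bochner_integral lborel (\<lambda>x. F (x + u)) (integral\<^sup>L lborel F)" for u
  proof -
    have d: "distr lborel lborel ((+) u) = lborel"
      using lborel_distr_plus[of u] by (simp cong: distr_cong)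
    have "integrable lborel (\<lambda>x. F (u + x))"
      by (rule integrable_distr[of "(+) u" lborel lborel]) (use F d in auto)
    moreover have "integral\<^sup>L lborel (\<lambda>x. F (u + x)) = integral\<^sup>L lborel F"
      using integral_distr[of "(+) u" lborel lborel F] F d by simp
    ultimately show ?thesis by (simp add: has_bochner_integral_iff add.commute)
  qed
  have intQ: "integral\<^sup>L lborel (Q n) = 0" and measQ: "Q n \<in> borel_measurable lborel" for n
  proof -
    have "has_bochner_integral lborel (Q n) (of_nat (Suc n) * (integral\<^sup>L lborel F - integral\<^sup>L lborel F))"
      unfolding Q_def
      by (intro has_bochner_integral_mult_right has_bochner_integral_diff trans
          has_bochner_integral_integrable F)
    then show "integral\<^sup>L lborel (Q n) = 0" "Q n \<in> borel_measurable lborel"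
      by (auto simp: has_bochner_integral_iff)
  qed
  have lim: "(\<lambda>n. Q n x) \<longlonglongrightarrow> d x" for x
  proof -
    let ?\<epsilon> = "\<lambda>h. norm (F (x + h *\<^sub>R v) - F x - h *\<^sub>R d x) / norm h"
    have "(?\<epsilon> \<longlongrightarrow> 0) (at 0)"
      using der[of x] by (simp add: has_vector_derivative_def has_derivative_at)
    moreover have "filterlim (\<lambda>n. 1 / real (Suc n)) (at 0) sequentially"
      using LIMSEQ_inverse_real_of_nat by (intro filterlim_atI) (simp_all add: inverse_eq_divide)
    ultimately have "(\<lambda>n. ?\<epsilon> (1 / real (Suc n))) \<longlonglongrightarrow> 0"
      by (rule filterlim_compose)
    moreover have "?\<epsilon> (1 / real (Suc n)) = norm (Q n x - d x)" for n
    proof -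
      have "norm (Q n x - d x) = norm (of_nat (Suc n) * (F (x + (1 / real (Suc n)) *\<^sub>R v) - F x - (1 / real (Suc n)) *\<^sub>R d x))"
        by (simp add: Q_def right_diff_distrib scaleR_conv_of_real del: of_nat_Suc)
      then show ?thesis by (simp add: norm_mult del: of_nat_Suc)
    qed
    ultimately have "(\<lambda>n. norm (Q n x - d x)) \<longlonglongrightarrow> 0" by simp
    then show ?thesis by (rule LIM_zero_cancel[OF tendsto_norm_zero_cancel])
  qed
  obtain B where B: "\<And>x. x \<in> C \<Longrightarrow> norm x \<le> B" using C(1) bounded_iff by blast
  have bnd: "norm (Q n x) \<le> indicator (cball 0 (B + norm v)) x *\<^sub>R K" for n x
  proof (cases "x \<in> cball 0 (B + norm v)")
    case True
    have "norm (Q n x) = real (Suc n) * norm (F (x + (1 / real (Suc n)) *\<^sub>R v) - F x)"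
      by (simp add: Q_def norm_mult del: of_nat_Suc)
    also have "\<dots> \<le> real (Suc n) * (K * (1 / real (Suc n)))"
      by (intro mult_left_mono lip) auto
    finally show ?thesis using True by simp
  next
    case False
    then have 1: "norm x > B + norm v" by simp
    have "norm ((1 / real (Suc n)) *\<^sub>R v) \<le> norm v"
      using mult_left_mono[of 1 "real (Suc n)" "norm v"] by (simp add: divide_le_eq del: of_nat_Suc)
    then have 2: "norm (x + (1 / real (Suc n)) *\<^sub>R v) > B"
      using 1 norm_triangle_ineq4[of "x + (1 / real (Suc n)) *\<^sub>R v" "(1 / real (Suc n)) *\<^sub>R v"] by simp
    have "F x = 0" using B[of x] 1 C(2)[of x] norm_ge_zero[of v] by force
    moreover have "F (x + (1 / real (Suc n)) *\<^sub>R v) = 0" using B 2 C(2) by (meson not_le)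
    ultimately show ?thesis using False by (simp add: Q_def)
  qed
  have "(\<lambda>n. integral\<^sup>L lborel (Q n)) \<longlonglongrightarrow> integral\<^sup>L lborel d"
  proof (rule integral_dominated_convergence)
    show "d \<in> borel_measurable lborel"
      by (rule borel_measurable_LIMSEQ_metric[OF measQ lim])
    show "integrable lborel (\<lambda>x. indicator (cball 0 (B + norm v)) x *\<^sub>R K)"
      by (intro integrable_real_indicator integrable_scaleR_left) (use emeasure_lborel_cball_finite[of 0 "B + norm v"] in simp_all)
  qed (use lim bnd measQ in auto)
  then show ?thesis using intQ by (simp add: LIMSEQ_const_iff)
qed

text \<open>The Wirtinger derivatives \<open>p = \<partial>\<^sub>b F\<close> and \<open>q = \<partial>bar\<^sub>b F\<close> at \<open>x\<close> of the restriction of \<open>F\<close> to the complex line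
  through \<open>x\<close> in direction \<open>b\<close>. Restricting to a line makes the notion available for derivatives
  of holomorphic functions, whose slices are differentiable by one-variable theory.\<close>

definition has_wirt :: "complex^'n::finite \<Rightarrow> (complex^'n \<Rightarrow> complex) \<Rightarrow> complex \<Rightarrow> complex \<Rightarrow> complex^'n \<Rightarrow> bool" where
  "has_wirt b F p q x \<longleftrightarrow> ((\<lambda>t. F (x + t *s b)) has_derivative (\<lambda>t. p * t + q * cnj t)) (at 0)"

lemma has_wirt_mult:
  assumes "has_wirt b F p q x" "has_wirt b G p' q' x"
  shows "has_wirt b (\<lambda>x. F x * G x) (p * G x + F x * p') (q * G x + F x * q') x"
proof -
  have "((\<lambda>t. F (x + t *s b) * G (x + t *s b)) has_derivative
     (\<lambda>t. F (x + 0 *s b) * (p' * t + q' * cnj t) + (p * t + q * cnj t) * G (x + 0 *s b))) (at 0)"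
    by (intro has_derivative_mult) (use assms in \<open>auto simp: has_wirt_def\<close>)
  then show ?thesis unfolding has_wirt_def
    by (rule has_derivative_eq_rhs) (auto simp: fun_eq_iff algebra_simps)
qed

lemma has_wirt_add:
  assumes "has_wirt b F p q x" "has_wirt b G p' q' x"
  shows "has_wirt b (\<lambda>x. F x + G x) (p + p') (q + q') x"
  using has_derivative_add[OF assms[unfolded has_wirt_def]]
  unfolding has_wirt_def by (rule has_derivative_eq_rhs) (auto simp: fun_eq_iff algebra_simps)

lemma has_wirt_diff:
  assumes "has_wirt b F p q x" "has_wirt b G p' q' x"
  shows "has_wirt b (\<lambda>x. F x - G x) (p - p') (q - q') x"
  using has_derivative_diff[OF assms[unfolded has_wirt_def]]
  unfolding has_wirt_def by (rule has_derivative_eq_rhs) (auto simp: fun_eq_iff algebra_simps)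

lemma has_wirt_const: "has_wirt b (\<lambda>x. c) 0 0 x"
  unfolding has_wirt_def by simp

lemma has_wirt_cnj:
  assumes "has_wirt b F p q x"
  shows "has_wirt b (\<lambda>x. cnj (F x)) (cnj q) (cnj p) x"
  using has_derivative_cnj[OF assms[unfolded has_wirt_def]]
  unfolding has_wirt_def by (rule has_derivative_eq_rhs) (auto simp: fun_eq_iff algebra_simps)

lemma has_wirt_of_real_compose:
  assumes "has_wirt b (\<lambda>x. complex_of_real (u x)) p q x" "(g has_real_derivative g') (at (u x))"
  shows "has_wirt b (\<lambda>x. complex_of_real (g (u x))) (g' * p) (g' * q) x"
proof -
  have "((\<lambda>t. Re (complex_of_real (u (x + t *s b)))) has_derivative (\<lambda>t. Re (p * t + q * cnj t))) (at 0)"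
    by (rule has_derivative_Re) (use assms(1) in \<open>simp add: has_wirt_def\<close>)
  then have 1: "((\<lambda>t. u (x + t *s b)) has_derivative (\<lambda>t. Re (p * t + q * cnj t))) (at 0)" by simp
  have im: "((\<lambda>t. Im (complex_of_real (u (x + t *s b)))) has_derivative (\<lambda>t. Im (p * t + q * cnj t))) (at 0)"
    by (rule has_derivative_Im) (use assms(1) in \<open>simp add: has_wirt_def\<close>)
  have "(\<lambda>t. Im (p * t + q * cnj t)) = (\<lambda>t. 0)"
    by (rule has_derivative_unique[OF im]) simp
  then have i0: "Im (p * t + q * cnj t) = 0" for t by (rule fun_cong)
  have "((\<lambda>t. g (u (x + t *s b))) has_derivative (\<lambda>t. g' * Re (p * t + q * cnj t))) (at 0)"
    using has_derivative_compose[OF 1, of g "\<lambda>h. g' * h"] assms(2)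
    by (simp add: has_field_derivative_def)
  from has_derivative_of_real[OF this]
  have "((\<lambda>t. complex_of_real (g (u (x + t *s b)))) has_derivative (\<lambda>t. complex_of_real (g' * Re (p * t + q * cnj t)))) (at 0)" .
  moreover have "(\<lambda>t. complex_of_real (g' * Re (p * t + q * cnj t))) = (\<lambda>t. g' * p * t + g' * q * cnj t)"
    using i0 by (auto simp: fun_eq_iff complex_eq_iff algebra_simps) (metis distrib_left)+
  ultimately show ?thesis by (simp add: has_wirt_def)
qed

lemma has_wirt_directional:
  assumes "has_wirt b F p q x"
  shows "((\<lambda>t. F (x + t *\<^sub>R (c *s b))) has_vector_derivative (p * c + q * cnj c)) (at 0)"
proof -
  have "((\<lambda>t. complex_of_real t * c) has_derivative (\<lambda>t. complex_of_real t * c)) (at 0)"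
    by (auto intro!: derivative_eq_intros)
  then have "((\<lambda>t. F (x + (complex_of_real t * c) *s b)) has_derivative
     (\<lambda>t. p * (complex_of_real t * c) + q * cnj (complex_of_real t * c))) (at 0)"
    by (rule has_derivative_compose) (use assms in \<open>simp add: has_wirt_def\<close>)
  moreover have "(complex_of_real t * c) *s b = t *\<^sub>R (c *s b)" for t
    by (simp add: vec_eq_iff scaleR_conv_of_real[where 'a=complex] mult.assoc)
  ultimately show ?thesis
    by (simp add: has_vector_derivative_def scaleR_conv_of_real algebra_simps)
qed

text \<open>The derivative \<open>q\<close> is a combination of the derivatives of \<open>F\<close> in the real directions \<open>b\<close> and
  \<open>\<i> b\<close>, each of which has integral zero. Continuity on \<open>D\<close> bounds \<open>p\<close> and \<open>q\<close> on \<open>C\<close>, outside of which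
  \<open>F\<close> is extended by zero.\<close>

lemma integral_wirt_bar_eq_0:
  fixes D C :: "(complex^'n::finite) set"
  assumes D: "open D" and C: "compact C" "C \<subseteq> D"
    and der: "\<And>x. x \<in> D \<Longrightarrow> has_wirt b F (p x) (q x) x"
    and cont: "continuous_on D F" "continuous_on D p" "continuous_on D q"
    and F0: "\<And>x. x \<in> D - C \<Longrightarrow> F x = 0"
  shows "(LINT x:C|lborel. q x) = 0"
proof -
  define G where "G x = indicator C x *\<^sub>R F x" for x
  have G: "integrable lborel G"
    unfolding G_def
    using set_integrable_compact[OF C(1) continuous_on_subset[OF cont(1) C(2)]] by (simp add: set_integrable_def)
  have dG: "((\<lambda>t. G (x + t *\<^sub>R (c *s b))) has_vector_derivative indicator C x *\<^sub>R (p x * c + q x * cnj c)) (at 0)" for x c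
  proof -
    have tend: "((\<lambda>t. x + t *\<^sub>R (c *s b)) \<longlongrightarrow> x + 0 *\<^sub>R (c *s b)) (at 0)"
      by (intro tendsto_intros)
    show ?thesis
    proof (cases "x \<in> C")
      case True
      with C(2) have xD: "x \<in> D" by auto
      have ev: "\<forall>\<^sub>F t in at 0. x + t *\<^sub>R (c *s b) \<in> D"
        using topological_tendstoD[OF tend D] xD by simp
      have "((\<lambda>t. F (x + t *\<^sub>R (c *s b))) has_vector_derivative (p x * c + q x * cnj c)) (at 0)"
        by (rule has_wirt_directional[OF der[OF xD]])
      then have "((\<lambda>t. F (x + t *\<^sub>R (c *s b))) has_derivative (\<lambda>h. h *\<^sub>R (p x * c + q x * cnj c))) (at 0)"
        by (simp add: has_vector_derivative_def)
      then have "((\<lambda>t. G (x + t *\<^sub>R (c *s b))) has_derivative (\<lambda>h. h *\<^sub>R (p x * c + q x * cnj c))) (at 0)"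
        by (rule has_derivative_transform_eventually) (use ev True F0 in \<open>auto elim!: eventually_mono simp: G_def indicator_def\<close>)
      then show ?thesis using True by (simp add: has_vector_derivative_def)
    next
      case False
      have "open (- C)" using C(1) by (simp add: compact_imp_closed open_Compl)
      from topological_tendstoD[OF tend this] have ev: "\<forall>\<^sub>F t in at 0. x + t *\<^sub>R (c *s b) \<notin> C"
        using False by simp
      have "((\<lambda>t::real. 0::complex) has_derivative (\<lambda>h. h *\<^sub>R 0)) (at 0)" by simp
      then have "((\<lambda>t. G (x + t *\<^sub>R (c *s b))) has_derivative (\<lambda>h. h *\<^sub>R 0)) (at 0)"
        by (rule has_derivative_transform_eventually) (use ev False in \<open>auto elim!: eventually_mono simp: G_def indicator_def\<close>)
      then show ?thesis using False by (simp add: has_vector_derivative_def)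
    qed
  qed
  have cpq: "continuous_on C p" "continuous_on C q" using cont C(2) continuous_on_subset by blast+
  have I: "(LINT x:C|lborel. p x * c + q x * cnj c) = 0" for c
  proof -
    have "continuous_on C (\<lambda>x. p x * c + q x * cnj c)" by (intro continuous_intros cpq)
    then have "bounded ((\<lambda>x. p x * c + q x * cnj c) ` C)"
      by (intro compact_imp_bounded compact_continuous_image C)
    then obtain K where K: "\<And>x. x \<in> C \<Longrightarrow> norm (p x * c + q x * cnj c) \<le> K"
      by (auto simp: bounded_iff)
    show ?thesis unfolding set_lebesgue_integral_def
      by (rule integral_directional_derivative_eq_0[OF G compact_imp_bounded[OF C(1)] _ dG, where K = "max K 0"])
         (use K in \<open>auto simp: G_def indicator_def le_max_iff_disj\<close>)
  qed
  have int: "set_integrable lborel C p" "set_integrable lborel C q"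
    by (rule set_integrable_compact[OF C(1) cpq(1)] set_integrable_compact[OF C(1) cpq(2)])+
  have "(LINT x:C|lborel. p x + q x) = (LINT x:C|lborel. p x) + (LINT x:C|lborel. q x)"
    using int by (rule set_integral_add)
  moreover have "(LINT x:C|lborel. \<i> * (p x - q x)) = \<i> * ((LINT x:C|lborel. p x) - (LINT x:C|lborel. q x))"
    using int by simp
  ultimately show ?thesis using I[of 1] I[of \<i>] by (simp add: algebra_simps)
qed

section \<open>Holomorphic functions on complex lines\<close>

lemma norm_scalar_mult_cvec: "norm (c *s (b :: complex^'n::finite)) = norm c * norm b"
  by (simp add: norm_vec_def norm_mult L2_set_right_distrib)

lemma bounded_linear_scalar_mult_cvec: "bounded_linear (\<lambda>t. t *s (b :: complex^'n::finite))"
  by (rule bounded_linear_intro[where K = "norm b"])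
     (auto simp: norm_scalar_mult_cvec vector_sadd_rdistrib vec_eq_iff)

lemma has_derivative_slice: "((\<lambda>t. x + t *s (b :: complex^'n::finite)) has_derivative (\<lambda>t. t *s b)) (at u)"
  using has_derivative_add[OF has_derivative_const bounded_linear_imp_has_derivative[OF bounded_linear_scalar_mult_cvec]]
  by simp

lemma has_wirt_of_has_derivative:
  assumes "(F has_derivative L) (at x)" "\<And>c v. L (c *s v) = c * L v"
  shows "has_wirt b F (L b) 0 x"
proof -
  have "((\<lambda>t. x + t *s b) has_derivative (\<lambda>t. t *s b)) (at 0)"
    by (rule has_derivative_slice)
  then have "((\<lambda>t. F (x + t *s b)) has_derivative (\<lambda>t. L (t *s b))) (at 0)"
    by (rule has_derivative_compose) (use assms(1) in simp)
  then show ?thesis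
    unfolding has_wirt_def by (simp add: assms(2) mult.commute)
qed

definition slice_deriv :: "complex^'n::finite \<Rightarrow> nat \<Rightarrow> (complex^'n \<Rightarrow> complex) \<Rightarrow> complex^'n \<Rightarrow> complex" where
  "slice_deriv b n f x = (deriv ^^ n) (\<lambda>t. f (x + t *s b)) 0"

lemma slice_deriv_0 [simp]: "slice_deriv b 0 f x = f x"
  by (simp add: slice_deriv_def)

text \<open>Moving the base point along the line only translates the slice, so \<open>slice_deriv b n f\<close> is itself
  differentiable along \<open>b\<close>.\<close>

lemma slice_deriv_shift: "slice_deriv b n f (x + u *s b) = (deriv ^^ n) (\<lambda>t. f (x + t *s b)) u"
  by (subst higher_deriv_shift_0) (simp add: slice_deriv_def o_def vector_sadd_rdistrib add.assoc)

lemma open_slice: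
  fixes D :: "(complex^'n::finite) set"
  assumes "open D" shows "open {t. x + t *s b \<in> D}"
proof -
  have "continuous_on UNIV (\<lambda>t::complex. x + t *s b)"
    by (intro continuous_intros bounded_linear.continuous_on[OF bounded_linear_scalar_mult_cvec])
  from open_vimage[OF assms this] show ?thesis by (simp add: vimage_def)
qed

lemma holomorphic_slice:
  fixes D :: "(complex^'n::finite) set"
  assumes f: "holomorphic_on_cvec f D" and D: "open D"
  shows "(\<lambda>t. f (x + t *s b)) holomorphic_on {t. x + t *s b \<in> D}"
proof (rule holomorphic_onI)
  fix u assume "u \<in> {t. x + t *s b \<in> D}"
  then obtain L where L: "(f has_derivative L) (at (x + u *s b))" "\<And>c v. L (c *s v) = c * L v"
    using f unfolding holomorphic_on_cvec_def by blast
  have "((\<lambda>t. f (x + t *s b)) has_derivative (\<lambda>t. L (t *s b))) (at u)"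
    by (rule has_derivative_compose[OF has_derivative_slice L(1)])
  then have "((\<lambda>t. f (x + t *s b)) has_field_derivative L b) (at u)"
    by (simp add: L(2) has_field_derivative_def mult_commute_abs)
  then show "(\<lambda>t. f (x + t *s b)) field_differentiable at u within {t. x + t *s b \<in> D}"
    using field_differentiable_def field_differentiable_at_within by blast
qed

lemma has_wirt_slice_deriv:
  fixes D :: "(complex^'n::finite) set"
  assumes f: "holomorphic_on_cvec f D" and D: "open D" and x: "x \<in> D"
  shows "has_wirt b (slice_deriv b n f) (slice_deriv b (Suc n) f x) 0 x"
proof -
  have "(deriv ^^ n) (\<lambda>t. f (x + t *s b)) holomorphic_on {t. x + t *s b \<in> D}"
    by (intro holomorphic_higher_deriv holomorphic_slice f D open_slice)
  then have "((deriv ^^ n) (\<lambda>t. f (x + t *s b)) has_field_derivative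
        deriv ((deriv ^^ n) (\<lambda>t. f (x + t *s b))) 0) (at 0)"
    by (rule holomorphic_derivI[OF _ open_slice[OF D]]) (use x in simp)
  then show ?thesis
    unfolding has_wirt_def slice_deriv_shift by (simp add: has_field_derivative_def slice_deriv_def)
qed

text \<open>Cauchy's inequality bounds the derivative of the difference of two neighbouring slices by their
  uniform distance, which is small by uniform continuity of \<open>f\<close>.\<close>

lemma continuous_on_slice_deriv:
  fixes D :: "(complex^'n::finite) set"
  assumes f: "holomorphic_on_cvec f D" and D: "open D"
  shows "continuous_on D (slice_deriv b n f)"
proof (rule continuous_onI)
  fix x and \<epsilon> :: real assume x: "x \<in> D" and \<epsilon>: "\<epsilon> > 0"
  obtain e where e: "e > 0" "cball x e \<subseteq> D" using D x open_contains_cball by blast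
  define \<rho> where "\<rho> = e / 2 / (1 + norm b)"
  have \<rho>: "\<rho> > 0" using e by (auto simp: \<rho>_def intro!: divide_pos_pos add_pos_nonneg)
  have \<rho>b: "\<rho> * norm b \<le> e / 2"
  proof -
    have "\<rho> * norm b \<le> \<rho> * (1 + norm b)" using \<rho> by simp
    also have "\<dots> = e / 2" using add_pos_nonneg[of 1 "norm b"] by (metis \<rho>_def less_irrefl nonzero_eq_divide_eq norm_ge_zero zero_less_one)
    finally show ?thesis .
  qed
  have contf: "continuous_on D f"
    using f unfolding holomorphic_on_cvec_def
    by (meson continuous_at_imp_continuous_on has_derivative_continuous)
  have near: "y + t *s b \<in> cball x e" if "y \<in> cball x (e / 2)" "t \<in> cball 0 \<rho>" for y t
  proof -
    have "norm t * norm b \<le> e / 2"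
      using that(2) \<rho>b mult_right_mono[of "norm t" \<rho> "norm b"] by simp
    then have "dist (y + t *s b) y \<le> e / 2" by (simp add: dist_norm norm_scalar_mult_cvec)
    with that(1) show ?thesis using dist_triangle[of x "y + t *s b" y] by (simp add: dist_commute)
  qed
  define \<epsilon>' where "\<epsilon>' = \<epsilon> * \<rho> ^ n / (2 * fact n)"
  have \<epsilon>': "\<epsilon>' > 0" using \<epsilon> \<rho> by (simp add: \<epsilon>'_def)
  have "uniformly_continuous_on (cball x e) f"
    using contf e continuous_on_subset compact_uniformly_continuous compact_cball by blast
  then obtain \<eta> where \<eta>: "\<eta> > 0"
     "\<And>y z. y \<in> cball x e \<Longrightarrow> z \<in> cball x e \<Longrightarrow> dist z y < \<eta> \<Longrightarrow> dist (f z) (f y) < \<epsilon>'"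
    unfolding uniformly_continuous_on_def using \<epsilon>' by metis
  show "\<exists>d>0. \<forall>y\<in>D. dist y x < d \<longrightarrow> dist (slice_deriv b n f y) (slice_deriv b n f x) \<le> \<epsilon>"
  proof (intro exI conjI ballI impI)
    show "min \<eta> (e / 2) > 0" using \<eta> e by simp
    fix y assume y: "y \<in> D" "dist y x < min \<eta> (e / 2)"
    define S where "S = {t. y + t *s b \<in> D} \<inter> {t. x + t *s b \<in> D}"
    have S: "open S" "cball 0 \<rho> \<subseteq> S"
      using open_slice[OF D] near e y by (force simp: S_def dist_commute)+
    let ?h = "\<lambda>t. f (y + t *s b) - f (x + t *s b)"
    have hol: "(\<lambda>t. f (y + t *s b)) holomorphic_on S" "(\<lambda>t. f (x + t *s b)) holomorphic_on S"
      using holomorphic_slice[OF f D] holomorphic_on_subset by (fastforce simp: S_def)+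
    have holh: "?h holomorphic_on S" by (intro holomorphic_intros hol)
    have "norm ((deriv ^^ n) ?h 0) \<le> fact n * \<epsilon>' / \<rho> ^ n"
    proof (rule Cauchy_inequality)
      show "?h holomorphic_on ball 0 \<rho>" "continuous_on (cball 0 \<rho>) ?h"
        using holh S ball_subset_cball by (meson holomorphic_on_subset subset_trans holomorphic_on_imp_continuous_on)+
      show "norm (?h t) \<le> \<epsilon>'" if "norm (0 - t) = \<rho>" for t
        using \<eta>(2)[OF near[of x t] near[of y t]] y e that by (simp add: dist_norm norm_minus_commute less_imp_le)
    qed (rule \<rho>)
    also have "\<dots> = \<epsilon> / 2" using \<rho> by (simp add: \<epsilon>'_def)
    also have "(deriv ^^ n) ?h 0 = slice_deriv b n f y - slice_deriv b n f x"
      unfolding slice_deriv_def using S \<rho> by (intro higher_deriv_diff[OF hol]) auto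
    finally show "dist (slice_deriv b n f y) (slice_deriv b n f x) \<le> \<epsilon>" using \<epsilon> by (simp add: dist_norm)
  qed
qed

text \<open>The interior of the zero set is relatively closed: a boundary point has a ball around it that meets
  this interior in some point, and the one-variable identity theorem on the complex lines through
  that point makes \<open>f\<close> vanish on the whole ball.\<close>

lemma holomorphic_identity_cvec:
  fixes D :: "(complex^'n::finite) set"
  assumes f: "holomorphic_on_cvec f D" and D: "open D" "connected D"
    and z: "z \<in> D" "f z \<noteq> 0" and x: "x \<in> D" "0 < e"
  shows "\<exists>y\<in>D. dist x y < e \<and> f y \<noteq> 0"
proof (rule ccontr)
  assume contra: "\<not> ?thesis"
  define Z where "Z = interior {y\<in>D. f y = 0}"
  have "D \<inter> ball x e \<subseteq> Z" unfolding Z_def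
    using contra D by (intro interior_maximal) auto
  then have xZ: "x \<in> Z" using x by auto
  have cl: "y \<in> Z" if y: "y \<in> D" "y \<in> closure Z" for y
  proof -
    obtain r where r: "r > 0" "ball y r \<subseteq> D" using D y open_contains_ball by blast
    obtain a where a: "a \<in> Z" "dist a y < r" using y(2) r(1) closure_approachable by blast
    have "f v = 0" if v: "v \<in> ball y r" for v
    proof -
      define V where "V = {t. a + t *s (v - a) \<in> ball y r}"
      have V: "open V" unfolding V_def by (rule open_slice) simp
      have "convex V"
      proof (rule convexI)
        fix s t and p q :: real assume st: "s \<in> V" "t \<in> V" "0 \<le> p" "0 \<le> q" "p + q = 1"
        then have q: "q = 1 - p" by simp
        have "a + (p *\<^sub>R s + q *\<^sub>R t) *s (v - a) = p *\<^sub>R (a + s *s (v - a)) + q *\<^sub>R (a + t *s (v - a))"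
          unfolding q by (simp add: vec_eq_iff scaleR_conv_of_real[where 'a=complex] algebra_simps)
        then show "p *\<^sub>R s + q *\<^sub>R t \<in> V"
          using st convexD[OF convex_ball, of "a + s *s (v - a)" y r "a + t *s (v - a)" p q] by (simp add: V_def)
      qed
      then have conn: "connected V" by (rule convex_connected)
      have hol: "(\<lambda>t. f (a + t *s (v - a))) holomorphic_on V"
        by (rule holomorphic_on_subset[OF holomorphic_slice[OF f D(1)]]) (use r in \<open>auto simp: V_def\<close>)
      define U where "U = V \<inter> {t. a + t *s (v - a) \<in> Z}"
      have U: "open U" unfolding U_def by (intro open_Int V open_slice) (simp add: Z_def)
      have "0 \<in> U" using a by (simp add: U_def V_def dist_commute)
      have "f (a + 1 *s (v - a)) = 0"
      proof (rule analytic_continuation[OF hol V conn, of U 0])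
        show "0 islimpt U" using U \<open>0 \<in> U\<close> by (rule open_imp_islimpt)
        show "f (a + t *s (v - a)) = 0" if "t \<in> U" for t
          using that interior_subset by (fastforce simp: U_def Z_def)
      qed (use \<open>0 \<in> U\<close> v in \<open>auto simp: U_def V_def\<close>)
      then show ?thesis by simp
    qed
    then have "ball y r \<subseteq> Z" unfolding Z_def using r by (intro interior_maximal) auto
    then show ?thesis using r by auto
  qed
  have "Z \<inter> D = {} \<or> (- closure Z) \<inter> D = {}"
    by (rule connectedD[OF D(2)]) (use cl closure_subset in \<open>auto simp: Z_def\<close>)
  then show False
  proof
    assume "Z \<inter> D = {}" then show False using xZ x by auto
  next
    assume "(- closure Z) \<inter> D = {}"
    then have "z \<in> Z" using z cl by auto
    then show False using z interior_subset by (fastforce simp: Z_def)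
  qed
qed

section \<open>Functions of class C2 and the mean value inequality\<close>

text \<open>In polar coordinates \<open>\<rho>\<^sup>2 \<Delta>u = \<rho> \<partial>\<^sub>\<rho>(\<rho> \<partial>\<^sub>\<rho> u) + \<partial>\<^sub>\<theta>\<^sup>2 u\<close>, and the last term has mean zero over a
  circle. Hence \<open>\<rho> M'(\<rho>)\<close> is nondecreasing for the circular integral \<open>M\<close>, it vanishes at \<open>0\<close>, and so \<open>M\<close> is nondecreasing.\<close>

lemma mean_value_le_of_laplacian_nonneg:
  fixes u u1 u2 u11 u12 u21 u22 :: "complex \<Rightarrow> real"
  assumes r: "0 < r" and U: "open U" "cball 0 r \<subseteq> U"
    and d0: "\<And>z. z \<in> U \<Longrightarrow> (u has_derivative (\<lambda>h. u1 z * Re h + u2 z * Im h)) (at z)"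
    and d1: "\<And>z. z \<in> U \<Longrightarrow> (u1 has_derivative (\<lambda>h. u11 z * Re h + u12 z * Im h)) (at z)"
    and d2: "\<And>z. z \<in> U \<Longrightarrow> (u2 has_derivative (\<lambda>h. u21 z * Re h + u22 z * Im h)) (at z)"
    and cont: "continuous_on U u11" "continuous_on U u12" "continuous_on U u21" "continuous_on U u22"
    and lap: "\<And>z. z \<in> U \<Longrightarrow> 0 \<le> u11 z + u22 z"
  shows "2 * pi * u 0 \<le> integral {0..2*pi} (\<lambda>\<theta>. u (complex_of_real r * cis \<theta>))"
proof -
  define Z where "Z \<rho> \<theta> = complex_of_real \<rho> * cis \<theta>" for \<rho> \<theta>
  have ZU: "Z \<rho> \<theta> \<in> U" if "\<rho> \<in> {0..r}" for \<rho> \<theta>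
    using that U(2) by (auto simp: Z_def norm_mult)
  have chain: "((\<lambda>s. v (\<gamma> s)) has_real_derivative (a * Re g' + b * Im g')) (at s within S)"
    if "(\<gamma> has_vector_derivative g') (at s within S)" "(v has_derivative (\<lambda>h. a * Re h + b * Im h)) (at (\<gamma> s))"
    for v :: "complex \<Rightarrow> real" and \<gamma> :: "real \<Rightarrow> complex" and g' a b s S
  proof -
    have "((\<lambda>s. v (\<gamma> s)) has_derivative (\<lambda>h. a * Re (h *\<^sub>R g') + b * Im (h *\<^sub>R g'))) (at s within S)"
      using has_derivative_compose[OF that(1)[unfolded has_vector_derivative_def] that(2)] .
    then show ?thesis unfolding has_field_derivative_def
      by (rule has_derivative_eq_rhs) (auto simp: fun_eq_iff algebra_simps)
  qed
  have Z\<rho>: "((\<lambda>\<rho>. Z \<rho> \<theta>) has_vector_derivative cis \<theta>) (at \<rho> within S)" for \<rho> \<theta> S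
    unfolding Z_def by (auto intro!: derivative_eq_intros simp: has_vector_derivative_def scaleR_conv_of_real)
  have Z\<theta>: "((\<lambda>\<theta>. Z \<rho> \<theta>) has_vector_derivative \<rho> *\<^sub>R (\<i> * cis \<theta>)) (at \<theta> within S)" for \<rho> \<theta> S
    unfolding Z_def by (auto intro!: derivative_eq_intros simp: has_vector_derivative_def scaleR_conv_of_real)
  have cu: "continuous_on U u" "continuous_on U u1" "continuous_on U u2"
    using d0 d1 d2 by (meson continuous_at_imp_continuous_on has_derivative_continuous)+
  have contZ: "continuous_on ({0..r} \<times> S) (\<lambda>(\<rho>, \<theta>). v (Z \<rho> \<theta>))"
    if "continuous_on U v" for v :: "complex \<Rightarrow> real" and S
  proof -
    have "continuous_on ({0..r} \<times> S) (\<lambda>(\<rho>, \<theta>). Z \<rho> \<theta>)"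
      unfolding Z_def case_prod_unfold by (intro continuous_intros)
    then have "continuous_on ({0..r} \<times> S) (\<lambda>x. v ((\<lambda>(\<rho>, \<theta>). Z \<rho> \<theta>) x))"
      by (rule continuous_on_compose2[OF that]) (use ZU in auto)
    then show ?thesis by (simp add: case_prod_unfold)
  qed
  note cZ = contZ[OF cu(1)] contZ[OF cu(2)] contZ[OF cu(3)] contZ[OF cont(1)] contZ[OF cont(2)]
    contZ[OF cont(3)] contZ[OF cont(4)]
  \<comment> \<open>The functions \<open>gr\<close>, \<open>grr\<close>, \<open>gt\<close>, \<open>gtt\<close> are the radial and angular derivatives
    of \<open>u (Z \<rho> \<theta>)\<close> of order one and two.\<close>
  define gr where "gr \<rho> \<theta> = u1 (Z \<rho> \<theta>) * cos \<theta> + u2 (Z \<rho> \<theta>) * sin \<theta>" for \<rho> \<theta>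
  define grr where "grr \<rho> \<theta> = (u11 (Z \<rho> \<theta>) * cos \<theta> + u12 (Z \<rho> \<theta>) * sin \<theta>) * cos \<theta>
      + (u21 (Z \<rho> \<theta>) * cos \<theta> + u22 (Z \<rho> \<theta>) * sin \<theta>) * sin \<theta>" for \<rho> \<theta>
  define gt where "gt \<rho> \<theta> = \<rho> * (u2 (Z \<rho> \<theta>) * cos \<theta> - u1 (Z \<rho> \<theta>) * sin \<theta>)" for \<rho> \<theta>
  define gtt where "gtt \<rho> \<theta> = \<rho> * (- u2 (Z \<rho> \<theta>) * sin \<theta> - u1 (Z \<rho> \<theta>) * cos \<theta>)
      + \<rho>\<^sup>2 * ((u22 (Z \<rho> \<theta>) * cos \<theta> - u21 (Z \<rho> \<theta>) * sin \<theta>) * cos \<theta>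
             - (u12 (Z \<rho> \<theta>) * cos \<theta> - u11 (Z \<rho> \<theta>) * sin \<theta>) * sin \<theta>)" for \<rho> \<theta>
  have dr: "((\<lambda>\<rho>. u (Z \<rho> \<theta>)) has_real_derivative gr \<rho> \<theta>) (at \<rho> within {0..r})" if "\<rho> \<in> {0..r}" for \<rho> \<theta>
    using chain[OF Z\<rho> d0[OF ZU[OF that]]] by (simp add: gr_def)
  have drr: "((\<lambda>\<rho>. \<rho> * gr \<rho> \<theta>) has_real_derivative gr \<rho> \<theta> + \<rho> * grr \<rho> \<theta>) (at \<rho> within {0..r})"
    if "\<rho> \<in> {0..r}" for \<rho> \<theta>
    using chain[OF Z\<rho>[where S = "{0..r}" and \<theta> = \<theta>] d1[OF ZU[OF that]]]
      chain[OF Z\<rho>[where S = "{0..r}" and \<theta> = \<theta>] d2[OF ZU[OF that]]]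
    unfolding gr_def grr_def
    by (auto intro!: derivative_eq_intros)
  have dtt: "((\<lambda>\<theta>. gt \<rho> \<theta>) has_real_derivative gtt \<rho> \<theta>) (at \<theta> within S)" if "\<rho> \<in> {0..r}" for \<rho> \<theta> S
    using chain[OF Z\<theta>[where S = S and \<theta> = \<theta>] d1[OF ZU[OF that]]]
      chain[OF Z\<theta>[where S = S and \<theta> = \<theta>] d2[OF ZU[OF that]]]
    unfolding gt_def gtt_def
    by (auto intro!: derivative_eq_intros simp: power2_eq_square algebra_simps)
  have cgr: "continuous_on ({0..r} \<times> S) (\<lambda>(\<rho>, \<theta>). gr \<rho> \<theta>)"
    and cgrr: "continuous_on ({0..r} \<times> S) (\<lambda>(\<rho>, \<theta>). gr \<rho> \<theta> + \<rho> * grr \<rho> \<theta>)" for S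
    using cZ[of S] unfolding gr_def grr_def case_prod_unfold by (intro continuous_intros; simp)+
  have slice: "v \<rho> integrable_on cbox 0 (2*pi)"
    if "continuous_on ({0..r} \<times> UNIV) (\<lambda>(\<rho>, \<theta>). v \<rho> \<theta>)" "\<rho> \<in> {0..r}" for v :: "real \<Rightarrow> real \<Rightarrow> real" and \<rho>
  proof -
    have "continuous_on (cbox 0 (2*pi)) (\<lambda>\<theta>. (\<lambda>(\<rho>, \<theta>). v \<rho> \<theta>) (\<rho>, \<theta>))"
      by (rule continuous_on_compose2[OF that(1)]) (use that(2) in \<open>auto intro!: continuous_intros\<close>)
    then have "continuous_on (cbox 0 (2*pi)) (v \<rho>)" by simp
    then show ?thesis by (rule integrable_continuous)
  qed
  define I where "I \<rho> = integral (cbox 0 (2*pi)) (\<lambda>\<theta>. u (Z \<rho> \<theta>))" for \<rho>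
  define J where "J \<rho> = integral (cbox 0 (2*pi)) (\<lambda>\<theta>. \<rho> * gr \<rho> \<theta>)" for \<rho>
  have dI: "(I has_real_derivative integral (cbox 0 (2*pi)) (gr \<rho>)) (at \<rho> within {0..r})" if "\<rho> \<in> {0..r}" for \<rho>
    unfolding I_def
    by (rule leibniz_rule_field_derivative[of "{0..r}" 0 "2*pi" "\<lambda>\<rho> \<theta>. u (Z \<rho> \<theta>)" gr])
       (use dr slice[of "\<lambda>\<rho> \<theta>. u (Z \<rho> \<theta>)"] cZ(1) cgr that in auto)
  have cgr': "continuous_on ({0..r} \<times> UNIV) (\<lambda>(\<rho>, \<theta>). \<rho> * gr \<rho> \<theta>)"
    using cgr[of UNIV] unfolding case_prod_unfold by (intro continuous_intros; simp)
  have dJ: "(J has_real_derivative integral (cbox 0 (2*pi)) (\<lambda>\<theta>. gr \<rho> \<theta> + \<rho> * grr \<rho> \<theta>)) (at \<rho> within {0..r})"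
    if "\<rho> \<in> {0..r}" for \<rho>
    unfolding J_def
    by (rule leibniz_rule_field_derivative[of "{0..r}" 0 "2*pi" "\<lambda>\<rho> \<theta>. \<rho> * gr \<rho> \<theta>" "\<lambda>\<rho> \<theta>. gr \<rho> \<theta> + \<rho> * grr \<rho> \<theta>"])
       (use drr slice[OF cgr'] cgrr that in auto)
  have J'pos: "0 \<le> integral (cbox 0 (2*pi)) (\<lambda>\<theta>. gr \<rho> \<theta> + \<rho> * grr \<rho> \<theta>)" if "0 < \<rho>" "\<rho> \<le> r" for \<rho>
  proof -
    have \<rho>: "\<rho> \<in> {0..r}" using that by simp
    have "(gtt \<rho> has_integral gt \<rho> (2*pi) - gt \<rho> 0) {0..2*pi}"
      by (rule fundamental_theorem_of_calculus) (use dtt[OF \<rho>] in \<open>auto simp: has_real_derivative_iff_has_vector_derivative\<close>)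
    moreover have "gt \<rho> (2*pi) = gt \<rho> 0" by (simp add: gt_def Z_def)
    ultimately have t: "(gtt \<rho> has_integral 0) (cbox 0 (2*pi))" by simp
    have hi: "((\<lambda>\<theta>. (gr \<rho> \<theta> + \<rho> * grr \<rho> \<theta>) + gtt \<rho> \<theta> / \<rho>) has_integral
        (integral (cbox 0 (2*pi)) (\<lambda>\<theta>. gr \<rho> \<theta> + \<rho> * grr \<rho> \<theta>) + 0 / \<rho>)) (cbox 0 (2*pi))"
      by (intro has_integral_add integrable_integral slice[OF cgrr \<rho>] has_integral_divide t)
    have nn: "0 \<le> (gr \<rho> \<theta> + \<rho> * grr \<rho> \<theta>) + gtt \<rho> \<theta> / \<rho>" for \<theta>
    proof -
      have "gtt \<rho> \<theta> / \<rho> = (- u2 (Z \<rho> \<theta>) * sin \<theta> - u1 (Z \<rho> \<theta>) * cos \<theta>)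
      + \<rho> * ((u22 (Z \<rho> \<theta>) * cos \<theta> - u21 (Z \<rho> \<theta>) * sin \<theta>) * cos \<theta>
             - (u12 (Z \<rho> \<theta>) * cos \<theta> - u11 (Z \<rho> \<theta>) * sin \<theta>) * sin \<theta>)"
        using that by (simp add: gtt_def add_divide_distrib power2_eq_square)
      then have "(gr \<rho> \<theta> + \<rho> * grr \<rho> \<theta>) + gtt \<rho> \<theta> / \<rho>
          = \<rho> * ((u11 (Z \<rho> \<theta>) + u22 (Z \<rho> \<theta>)) * ((cos \<theta>)\<^sup>2 + (sin \<theta>)\<^sup>2))"
        unfolding gr_def grr_def by (simp only: power2_eq_square) (simp only: algebra_simps)
      also have "\<dots> = \<rho> * (u11 (Z \<rho> \<theta>) + u22 (Z \<rho> \<theta>))" by simp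
      also have "\<dots> \<ge> 0" using that lap[OF ZU[OF \<rho>]] by simp
      finally show ?thesis .
    qed
    show ?thesis using has_integral_nonneg[OF hi nn] by simp
  qed
  have at_in: "at \<rho> within {0..r} = at \<rho>" if "0 < \<rho>" "\<rho> < r" for \<rho> :: real
    using that by (intro at_within_interior) (simp add: interior_atLeastAtMost_real)
  have cJ: "continuous_on {0..r} J" by (rule DERIV_continuous_on, rule dJ)
  have Jpos: "0 \<le> J \<rho>" if "0 < \<rho>" "\<rho> < r" for \<rho>
  proof -
    have "J 0 \<le> J \<rho>"
    proof (rule DERIV_nonneg_imp_increasing_open[of 0 \<rho> J])
      show "continuous_on {0..\<rho>} J"
        by (rule continuous_on_subset[OF cJ]) (use that in auto)
      show "\<exists>y. (J has_real_derivative y) (at x) \<and> 0 \<le> y" if "0 < x" "x < \<rho>" for x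
        using dJ[of x] J'pos[of x] at_in[of x] that \<open>\<rho> < r\<close> by auto
    qed (use that in simp)
    then show ?thesis by (simp add: J_def)
  qed
  have "I 0 \<le> I r"
  proof (rule DERIV_nonneg_imp_increasing_open[of 0 r I])
    show "continuous_on {0..r} I" using dI by (intro DERIV_continuous_on) auto
    show "\<exists>y. (I has_real_derivative y) (at \<rho>) \<and> 0 \<le> y" if "0 < \<rho>" "\<rho> < r" for \<rho>
    proof -
      have "J \<rho> = \<rho> * integral (cbox 0 (2*pi)) (gr \<rho>)" by (simp add: J_def)
      then have "0 \<le> integral (cbox 0 (2*pi)) (gr \<rho>)" using Jpos[OF that] that by (simp add: zero_le_mult_iff)
      then show ?thesis using dI[of \<rho>] at_in[OF that] that by auto
    qed
  qed (use r in simp)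
  moreover have "I 0 = 2 * pi * u 0" by (simp add: I_def Z_def)
  ultimately show ?thesis by (simp add: I_def Z_def)
qed

definition dir_deriv :: "'a::real_normed_vector \<Rightarrow> ('a \<Rightarrow> 'b::real_normed_vector) \<Rightarrow> 'a \<Rightarrow> 'b" where
  "dir_deriv v F x = frechet_derivative F (at x) v"

text \<open>Four times the Levi form in the direction \<open>b\<close>.\<close>

definition line_laplacian :: "complex^'n::finite \<Rightarrow> (complex^'n \<Rightarrow> real) \<Rightarrow> complex^'n \<Rightarrow> real" where
  "line_laplacian b F x = dir_deriv b (dir_deriv b F) x + dir_deriv (\<i> *s b) (dir_deriv (\<i> *s b) F) x"

lemma Ck_on_2D:
  assumes "Ck_on 2 F D"
  shows "\<And>x. x \<in> D \<Longrightarrow> F differentiable (at x)"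
    and "\<And>v x. x \<in> D \<Longrightarrow> dir_deriv v F differentiable (at x)"
    and "\<And>v w. continuous_on D (dir_deriv v (dir_deriv w F))"
    and "\<And>v. continuous_on D (dir_deriv v F)" "continuous_on D F"
proof -
  show "F differentiable (at x)" "dir_deriv v F differentiable (at x)" if "x \<in> D" for x v
    using assms that by (simp_all add: numeral_2_eq_2 dir_deriv_def[abs_def])
  then show "continuous_on D (dir_deriv v F)" "continuous_on D F" for v
    by (simp_all add: continuous_at_imp_continuous_on differentiable_imp_continuous_within)
  show "continuous_on D (dir_deriv v (dir_deriv w F))" for v w
    using assms by (simp add: numeral_2_eq_2 dir_deriv_def[abs_def])
qed

lemma has_derivative_line:
  fixes F :: "complex^'n::finite \<Rightarrow> real"
  assumes "F differentiable (at (x + u *s b))"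
  shows "((\<lambda>t. F (x + t *s b)) has_derivative
    (\<lambda>h. dir_deriv b F (x + u *s b) * Re h + dir_deriv (\<i> *s b) F (x + u *s b) * Im h)) (at u)"
proof -
  let ?L = "frechet_derivative F (at (x + u *s b))"
  have L: "(F has_derivative ?L) (at (x + u *s b))" using assms frechet_derivative_works by blast
  have lin: "linear ?L" using L has_derivative_linear by blast
  have tb: "t *s b = Re t *\<^sub>R b + Im t *\<^sub>R (\<i> *s b)" for t
    by (simp add: vec_eq_iff complex_eq_iff)
  have Lt: "?L (t *s b) = ?L b * Re t + ?L (\<i> *s b) * Im t" for t
    by (subst tb) (simp only: linear_add[OF lin] linear_cmul[OF lin] real_scaleR_def mult.commute)
  have "((\<lambda>t. F (x + t *s b)) has_derivative (\<lambda>t. ?L (t *s b))) (at u)"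
    by (rule has_derivative_compose[OF has_derivative_slice L])
  then show ?thesis
    unfolding dir_deriv_def by (rule has_derivative_eq_rhs) (rule ext, rule Lt)
qed

lemma has_wirt_of_real:
  fixes F :: "complex^'n::finite \<Rightarrow> real" and b :: "complex^'n"
  assumes "F differentiable (at x)"
  defines "p \<equiv> (complex_of_real (dir_deriv b F x) - \<i> * complex_of_real (dir_deriv (\<i> *s b) F x)) / 2"
  shows "has_wirt b (\<lambda>x. complex_of_real (F x)) p (cnj p) x"
  unfolding has_wirt_def p_def
  by (rule has_derivative_eq_rhs[OF has_derivative_of_real[OF has_derivative_line]])
     (use assms(1) in \<open>auto simp: fun_eq_iff complex_eq_iff algebra_simps add_divide_distrib diff_divide_distrib\<close>)

text \<open>Only the real part of \<open>\<partial>bar\<^sub>b \<partial>\<^sub>b \<phi>\<close> is identified: the imaginary part is a commutator of second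
  derivatives, and the real part is all that a norm computation sees.\<close>

lemma Ck_on_2_wirt:
  fixes \<phi> :: "complex^'n::finite \<Rightarrow> real"
  assumes "Ck_on 2 \<phi> D"
  obtains p p' q where "\<And>x. x \<in> D \<Longrightarrow> has_wirt b (\<lambda>x. complex_of_real (\<phi> x)) (p x) (cnj (p x)) x"
    "\<And>x. x \<in> D \<Longrightarrow> has_wirt b p (p' x) (q x) x"
    "\<And>x. Re (q x) = line_laplacian b \<phi> x / 4"
    "continuous_on D p" "continuous_on D p'" "continuous_on D q"
proof -
  note C = Ck_on_2D[OF assms]
  define W where "W F x = (complex_of_real (dir_deriv b F x) - \<i> * complex_of_real (dir_deriv (\<i> *s b) F x)) / 2"
    for F :: "complex^'n \<Rightarrow> real" and x
  let ?F1 = "dir_deriv b \<phi>" and ?F2 = "dir_deriv (\<i> *s b) \<phi>"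
  have W1: "has_wirt b (\<lambda>x. complex_of_real (F x)) (W F x) (cnj (W F x)) x" if "F differentiable (at x)" for F x
    unfolding W_def by (rule has_wirt_of_real[OF that])
  have "has_wirt b (\<lambda>x. (complex_of_real (?F1 x) - \<i> * complex_of_real (?F2 x)) * (1/2))
        ((W ?F1 x - (0 * complex_of_real (?F2 x) + \<i> * W ?F2 x)) * (1/2) + (complex_of_real (?F1 x) - \<i> * complex_of_real (?F2 x)) * 0)
        ((cnj (W ?F1 x) - (0 * complex_of_real (?F2 x) + \<i> * cnj (W ?F2 x))) * (1/2) + (complex_of_real (?F1 x) - \<i> * complex_of_real (?F2 x)) * 0) x"
    if "x \<in> D" for x
    by (intro has_wirt_mult has_wirt_diff has_wirt_const W1 C that)
  then have W2: "has_wirt b (W \<phi>) ((W ?F1 x - \<i> * W ?F2 x) / 2) ((cnj (W ?F1 x) - \<i> * cnj (W ?F2 x)) / 2) x"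
    if "x \<in> D" for x using that by (simp add: W_def[abs_def])
  have cW: "continuous_on D (W F)" if "\<And>v. continuous_on D (dir_deriv v F)" for F
    unfolding W_def[abs_def] by (intro continuous_intros that) auto
  show thesis
  proof (rule that[OF W1 W2])
    show "Re ((cnj (W ?F1 x) - \<i> * cnj (W ?F2 x)) / 2) = line_laplacian b \<phi> x / 4" for x
      by (simp add: W_def line_laplacian_def)
    show "continuous_on D (W \<phi>)" by (intro cW C)
    show "continuous_on D (\<lambda>x. (W ?F1 x - \<i> * W ?F2 x) / 2)"
      "continuous_on D (\<lambda>x. (cnj (W ?F1 x) - \<i> * cnj (W ?F2 x)) / 2)"
      by (intro continuous_intros cW C; simp)+
  qed (use C in auto)
qed

text \<open>A circle in direction \<open>b\<close> is a circle of radius \<open>r * norm b\<close> in the direction of the unit vector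
  of \<open>b\<close>, which reduces the sub-mean value inequality to unit vectors.\<close>

lemma plurisubharmonic_on_of_line_laplacian_nonneg:
  fixes \<phi> :: "complex^'n::finite \<Rightarrow> real"
  assumes D: "open D" and C2: "Ck_on 2 \<phi> D"
    and lap: "\<And>b x. norm b = 1 \<Longrightarrow> x \<in> D \<Longrightarrow> 0 \<le> line_laplacian b \<phi> x"
  shows "plurisubharmonic_on D \<phi>"
proof -
  note C = Ck_on_2D[OF C2]
  have usc: "upper_semicontinuous_on S v" if "continuous_on S v" for S :: "'z::topological_space set" and v
    unfolding upper_semicontinuous_on_def
    using that by (auto simp: continuous_on_def intro: order_tendstoD)
  have mean: "2 * pi * \<phi> c \<le> integral {0..2*pi} (\<lambda>\<theta>. \<phi> (c + (complex_of_real r * cis \<theta>) *s b))"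
    if b: "norm b = 1" and r: "0 < r" and sub: "\<And>t. t \<in> cball 0 r \<Longrightarrow> c + t *s b \<in> D" for c b r
  proof -
    let ?U = "{t. c + t *s b \<in> D}"
    have cc: "continuous_on ?U (\<lambda>t. dir_deriv v (dir_deriv w \<phi>) (c + t *s b))" for v w
      by (rule continuous_on_compose2[OF C(3)])
        (auto intro!: continuous_intros bounded_linear.continuous_on[OF bounded_linear_scalar_mult_cvec])
    have "2 * pi * (\<lambda>t. \<phi> (c + t *s b)) 0 \<le> integral {0..2*pi} (\<lambda>\<theta>. (\<lambda>t. \<phi> (c + t *s b)) (complex_of_real r * cis \<theta>))"
    proof (rule mean_value_le_of_laplacian_nonneg[OF r open_slice[OF D, of c b]])
      show "cball 0 r \<subseteq> ?U" using sub by auto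
      fix z assume z: "z \<in> ?U"
      show "((\<lambda>t. \<phi> (c + t *s b)) has_derivative
          (\<lambda>h. dir_deriv b \<phi> (c + z *s b) * Re h + dir_deriv (\<i> *s b) \<phi> (c + z *s b) * Im h)) (at z)"
        "((\<lambda>t. dir_deriv b \<phi> (c + t *s b)) has_derivative
          (\<lambda>h. dir_deriv b (dir_deriv b \<phi>) (c + z *s b) * Re h + dir_deriv (\<i> *s b) (dir_deriv b \<phi>) (c + z *s b) * Im h)) (at z)"
        "((\<lambda>t. dir_deriv (\<i> *s b) \<phi> (c + t *s b)) has_derivative
          (\<lambda>h. dir_deriv b (dir_deriv (\<i> *s b) \<phi>) (c + z *s b) * Re h + dir_deriv (\<i> *s b) (dir_deriv (\<i> *s b) \<phi>) (c + z *s b) * Im h)) (at z)"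
        using z by (auto intro!: has_derivative_line C)
      show "0 \<le> dir_deriv b (dir_deriv b \<phi>) (c + z *s b) + dir_deriv (\<i> *s b) (dir_deriv (\<i> *s b) \<phi>) (c + z *s b)"
        using lap[OF b] z by (simp add: line_laplacian_def)
    qed (rule cc)+
    then show ?thesis by simp
  qed
  have slice_cont: "continuous_on {t. a + t *s b \<in> D} (\<lambda>t. \<phi> (a + t *s b))" for a b
    by (rule continuous_on_compose2[OF C(5)])
      (auto intro!: continuous_intros bounded_linear.continuous_on[OF bounded_linear_scalar_mult_cvec])
  have "subharmonic_on {t. a + t *s b \<in> D} (\<lambda>t. \<phi> (a + t *s b))" for a b
    unfolding subharmonic_on_def
  proof (intro conjI allI impI usc slice_cont)
    fix t0 r assume "0 < r \<and> cball t0 r \<subseteq> {t. a + t *s b \<in> D}"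
    then have r: "0 < r" and sub: "\<And>t. t \<in> cball t0 r \<Longrightarrow> a + t *s b \<in> D" by auto
    let ?v = "\<lambda>\<theta>. \<phi> (a + (t0 + complex_of_real r * cis \<theta>) *s b)"
    have "a + (t0 + complex_of_real r * cis \<theta>) *s b \<in> D" for \<theta>
      using r by (intro sub) (simp add: dist_norm norm_mult)
    then have "continuous_on {0..2*pi} ?v"
      by (intro continuous_on_compose2[OF slice_cont[of a b]]) (auto intro!: continuous_intros simp del: vector_sadd_rdistrib)
    then show int: "set_integrable lborel {0..2*pi} ?v"
      unfolding set_integrable_def by (rule borel_integrable_atLeastAtMost'[unfolded set_integrable_def])
    have eq: "(LBINT \<theta>:{0..2*pi}. ?v \<theta>) = integral {0..2*pi} ?v"
      using int by (rule set_borel_integral_eq_integral)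
    have "2 * pi * \<phi> (a + t0 *s b) \<le> integral {0..2*pi} ?v"
    proof (cases "b = 0")
      case True then show ?thesis by simp
    next
      case False
      define b' where "b' = complex_of_real (1 / norm b) *s b"
      have nb': "norm b' = 1" using False by (simp add: b'_def norm_scalar_mult_cvec norm_divide)
      have bb': "(complex_of_real (r * norm b) * w) *s b' = (complex_of_real r * w) *s b" for w
        using False by (simp add: b'_def vec_eq_iff)
      have "2 * pi * \<phi> (a + t0 *s b) \<le> integral {0..2*pi} (\<lambda>\<theta>. \<phi> ((a + t0 *s b) + (complex_of_real (r * norm b) * cis \<theta>) *s b'))"
      proof (rule mean[OF nb'])
        show "0 < r * norm b" using r False by simp
        fix t :: complex assume t: "t \<in> cball 0 (r * norm b)"
        have "a + (t0 + t / complex_of_real (norm b)) *s b \<in> D"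
          using t False by (intro sub) (simp add: dist_norm norm_divide divide_le_eq)
        moreover have "t *s b' = (t / complex_of_real (norm b)) *s b" by (simp add: b'_def vec_eq_iff)
        ultimately show "a + t0 *s b + t *s b' \<in> D" by (simp add: vector_sadd_rdistrib add.assoc)
      qed
      then show ?thesis unfolding bb' by (simp add: vector_sadd_rdistrib add.assoc)
    qed
    then show "\<phi> (a + t0 *s b) \<le> (LBINT \<theta>:{0..2*pi}. ?v \<theta>) / (2*pi)"
      unfolding eq by (simp add: pos_le_divide_eq mult.commute)
  qed
  then show ?thesis unfolding plurisubharmonic_on_def by (simp add: usc C)
qed

section \<open>The division problem for the generators (1, eps w)\<close>

lemma Ck_on_const: "Ck_on m (\<lambda>x. c) D"
  by (induction m arbitrary: c) (auto simp: frechet_derivative_const)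

lemma Ck_on_affine:
  fixes a v :: "'a::real_inner" and c :: real
  shows "Ck_on m (\<lambda>x. c * inner (x - a) v) D"
proof (cases m)
  case 0 then show ?thesis by (auto intro!: continuous_intros)
next
  case (Suc n)
  have d: "((\<lambda>x. c * inner (x - a) v) has_derivative (\<lambda>h. c * inner h v)) (at x)" for x
    by (auto intro!: derivative_eq_intros)
  show ?thesis
    using frechet_derivative_at[OF d] d by (auto simp: Suc Ck_on_const differentiable_def)
qed

lemma has_derivative_norm_square:
  fixes a :: "'a::real_inner"
  shows "((\<lambda>x. s * (norm (x - a))\<^sup>2) has_derivative (\<lambda>h. 2 * s * inner (z - a) h)) (at z)"
  unfolding power2_norm_eq_inner
  by (auto intro!: derivative_eq_intros simp: inner_commute algebra_simps)

lemma frechet_norm_square: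
  fixes a :: "'a::real_inner"
  shows "frechet_derivative (\<lambda>x. s * (norm (x - a))\<^sup>2) (at z) = (\<lambda>h. 2 * s * inner (z - a) h)"
  using frechet_derivative_at[OF has_derivative_norm_square] by metis

lemma Ck_on_norm_square:
  fixes a :: "'a::real_inner"
  shows "Ck_on m (\<lambda>x. s * (norm (x - a))\<^sup>2) D"
proof (cases m)
  case 0 then show ?thesis by (auto intro!: continuous_intros)
next
  case (Suc n)
  then show ?thesis
    using has_derivative_norm_square[of s a] Ck_on_affine[of n "2 * s" a _ D]
    by (auto simp: frechet_norm_square differentiable_def)
qed

lemma line_laplacian_norm_square:
  "line_laplacian b (\<lambda>x. s * (norm (x - a))\<^sup>2) z = 4 * s * (norm (b :: complex^'n::finite))\<^sup>2"
proof -
  have d: "dir_deriv v (\<lambda>x. s * (norm (x - a))\<^sup>2) = (\<lambda>x. 2 * s * inner (x - a) v)" for v :: "complex^'n"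
    by (simp add: fun_eq_iff dir_deriv_def frechet_norm_square)
  have "((\<lambda>x. 2 * s * inner (x - a) v) has_derivative (\<lambda>h. 2 * s * inner h v)) (at z)" for v :: "complex^'n"
    by (auto intro!: derivative_eq_intros)
  from frechet_derivative_at[OF this]
  have d2: "dir_deriv v (\<lambda>x. 2 * s * inner (x - a) v) z = 2 * s * (norm v)\<^sup>2" for v :: "complex^'n"
    by (simp add: dir_deriv_def power2_norm_eq_inner) (metis)
  show ?thesis by (simp add: line_laplacian_def d d2 norm_scalar_mult_cvec)
qed

lemma plurisubharmonic_on_norm_square:
  assumes "open D" "0 \<le> s"
  shows "plurisubharmonic_on D (\<lambda>x :: complex^'n::finite. s * (norm (x - a))\<^sup>2)"
  using assms by (intro plurisubharmonic_on_of_line_laplacian_nonneg Ck_on_norm_square)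
    (auto simp: line_laplacian_norm_square)

lemma levi_norm_square:
  "levi j l (\<lambda>x :: complex^'n::finite. s * (norm (x - a))\<^sup>2) z = (if j = l then complex_of_real s else 0)"
proof -
  have "frechet_derivative (\<lambda>x :: complex^'n. complex_of_real (s * (norm (x - a))\<^sup>2)) (at z)
      = (\<lambda>h. complex_of_real (2 * s * inner (z - a) h))" for z
    by (rule frechet_derivative_at[symmetric]) (rule has_derivative_of_real[OF has_derivative_norm_square])
  then have w: "wirt_bar l (\<lambda>x :: complex^'n. complex_of_real (s * (norm (x - a))\<^sup>2)) = (\<lambda>z. complex_of_real s * (z $ l - a $ l))"
    by (simp add: fun_eq_iff wirt_bar_def inner_axis complex_eq_iff inner_complex_def)
  have "((\<lambda>z :: complex^'n. complex_of_real s * (z $ l - a $ l)) has_derivative (\<lambda>h. complex_of_real s * h $ l)) (at z)"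
    by (auto intro!: derivative_eq_intros bounded_linear_imp_has_derivative bounded_linear_vec_nth)
  then have "frechet_derivative (\<lambda>z :: complex^'n. complex_of_real s * (z $ l - a $ l)) (at z) = (\<lambda>h. complex_of_real s * h $ l)"
    by (rule frechet_derivative_at[symmetric])
  then show ?thesis
    unfolding levi_def w wirt_def by (auto simp: axis_def complex_eq_iff)
qed

text \<open>The linear function with \<open>\<partial>\<^sub>b = |b|\<^sup>2\<close>; its conjugate is the function to be approximated by
  holomorphic ones.\<close>

definition lin_form :: "complex^'n::finite \<Rightarrow> complex^'n \<Rightarrow> complex" where
  "lin_form b v = (\<Sum>j\<in>UNIV. cnj (b $ j) * v $ j)"

lemma bounded_linear_lin_form: "bounded_linear (lin_form b)"
  unfolding lin_form_def[abs_def]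
  by (intro bounded_linear_sum bounded_linear_mult_const bounded_linear_compose[OF bounded_linear_mult_right] bounded_linear_vec_nth)

lemma lin_form_scale: "lin_form b (c *s v) = c * lin_form b v"
  by (simp add: lin_form_def sum_distrib_left mult.left_commute)

lemma lin_form_axis: "lin_form b (axis j c) = cnj (b $ j) * c"
  by (simp add: lin_form_def axis_def if_distrib cong: if_cong)

lemma has_derivative_lin_form: "((\<lambda>x. lin_form b (x - a)) has_derivative lin_form b) (at z)"
  using has_derivative_compose[OF has_derivative_diff[OF has_derivative_ident has_derivative_const]
      bounded_linear_imp_has_derivative[OF bounded_linear_lin_form]] by simp

lemma norm_square_eq_sum: "(norm (b :: complex^'n::finite))\<^sup>2 = (\<Sum>j\<in>UNIV. (cmod (b $ j))\<^sup>2)"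
  by (simp add: norm_vec_def L2_set_def sum_nonneg)

lemma lin_form_self: "lin_form b b = complex_of_real ((norm b)\<^sup>2)"
  by (simp add: lin_form_def norm_square_eq_sum complex_norm_square mult.commute del: of_real_power)

lemma continuous_on_lin_form: "continuous_on D (\<lambda>z. lin_form b (z - a))"
  by (intro bounded_linear.continuous_on[OF bounded_linear_lin_form] continuous_intros)

lemma wirt_lin_form:
  assumes "(F has_derivative (\<lambda>h. p * lin_form b h + q * cnj (lin_form b h))) (at z)"
  shows "wirt j F z = p * cnj (b $ j)" "wirt_bar j F z = q * b $ j"
proof -
  have "frechet_derivative F (at z) = (\<lambda>h. p * lin_form b h + q * cnj (lin_form b h))"
    using frechet_derivative_at[OF assms] by metis
  then show "wirt j F z = p * cnj (b $ j)" "wirt_bar j F z = q * b $ j"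
    by (simp_all add: wirt_def wirt_bar_def lin_form_axis algebra_simps)
qed

definition skoda_gen :: "real \<Rightarrow> complex^'n::finite \<Rightarrow> complex^'n \<Rightarrow> nat \<Rightarrow> complex^'n \<Rightarrow> complex" where
  "skoda_gen \<epsilon> b a p z = (if p = 0 then 1 else complex_of_real \<epsilon> * lin_form b (z - a))"

lemma holomorphic_skoda_gen: "holomorphic_on_cvec (skoda_gen \<epsilon> b a p) D"
proof -
  have "((skoda_gen \<epsilon> b a p) has_derivative (\<lambda>h. if p = 0 then 0 else complex_of_real \<epsilon> * lin_form b h)) (at z)" for z
    by (cases "p = 0") (auto simp: skoda_gen_def[abs_def] intro!: derivative_eq_intros has_derivative_lin_form)
  then show ?thesis unfolding holomorphic_on_cvec_def
    by (intro ballI exI conjI) (auto simp: lin_form_scale)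
qed

lemma norm2_skoda_gen:
  "norm2 2 (skoda_gen \<epsilon> b a) z = 1 + \<epsilon>\<^sup>2 * (cmod (lin_form b (z - a)))\<^sup>2"
  by (simp add: norm2_def skoda_gen_def numeral_2_eq_2 norm_mult power_mult_distrib)

lemma norm2_skoda_gen_complex:
  "complex_of_real (norm2 2 (skoda_gen \<epsilon> b a) z) = 1 + complex_of_real \<epsilon>^2 * (lin_form b (z - a) * cnj (lin_form b (z - a)))"
  by (simp add: norm2_skoda_gen complex_norm_square del: of_real_power) simp

lemma norm2_skoda_gen_ge_1: "norm2 2 (skoda_gen \<epsilon> b a) z \<ge> 1"
  by (simp add: norm2_skoda_gen)

text \<open>In the second component the quotient rule produces the numerator \<open>N - \<epsilon>\<^sup>2 |w|\<^sup>2\<close>, which is \<open>1\<close>.\<close>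

lemma beta_star_skoda_gen:
  fixes z a b :: "complex^'n::finite" and \<epsilon> :: real
  defines "N \<equiv> complex_of_real (norm2 2 (skoda_gen \<epsilon> b a) z)"
  shows "beta_star 2 (skoda_gen \<epsilon> b a) z j p =
     (if p = 0 then complex_of_real \<epsilon>^2 * lin_form b (z - a) * b $ j / N\<^sup>2
      else - complex_of_real \<epsilon> * b $ j / N\<^sup>2)"
proof -
  let ?w = "lin_form b (z - a)" and ?e = "complex_of_real \<epsilon>"
  have N0: "N \<noteq> 0" using norm2_skoda_gen_ge_1[of \<epsilon> b a z] by (simp add: N_def)
  have dN: "((\<lambda>z. complex_of_real (norm2 2 (skoda_gen \<epsilon> b a) z)) has_derivative
      (\<lambda>h. ?e^2 * (?w * cnj (lin_form b h) + lin_form b h * cnj ?w))) (at z)"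
    unfolding norm2_skoda_gen_complex
    by (auto intro!: derivative_eq_intros has_derivative_lin_form)
  show ?thesis
  proof (cases "p = 0")
    case True
    have "((\<lambda>z. 1 / complex_of_real (norm2 2 (skoda_gen \<epsilon> b a) z)) has_derivative
      (\<lambda>h. (- (?e^2) * cnj ?w / N\<^sup>2) * lin_form b h + (- (?e^2) * ?w / N\<^sup>2) * cnj (lin_form b h))) (at z)"
      by (rule has_derivative_eq_rhs[OF has_derivative_divide[OF has_derivative_const dN]])
        (use N0 in \<open>auto simp: N_def[symmetric] fun_eq_iff field_simps power2_eq_square\<close>)
    from wirt_lin_form(2)[OF this, of j] True show ?thesis
      by (simp add: beta_star_def skoda_gen_def)
  next
    case False
    have dw: "((\<lambda>z. ?e * cnj (lin_form b (z - a))) has_derivative (\<lambda>h. ?e * cnj (lin_form b h))) (at z)"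
      by (auto intro!: derivative_eq_intros has_derivative_lin_form)
    have NN: "N = 1 + ?e^2 * (?w * cnj ?w)" unfolding N_def by (rule norm2_skoda_gen_complex)
    have "((\<lambda>z. ?e * cnj (lin_form b (z - a)) / complex_of_real (norm2 2 (skoda_gen \<epsilon> b a) z)) has_derivative
      (\<lambda>h. (- (?e^3) * (cnj ?w)^2 / N\<^sup>2) * lin_form b h + (?e / N\<^sup>2) * cnj (lin_form b h))) (at z)"
    proof (rule has_derivative_eq_rhs[OF has_derivative_divide[OF dw dN]])
      have "(- (?e * cnj ?w) * (inverse N * (?e^2 * (?w * cnj (lin_form b h) + lin_form b h * cnj ?w)) * inverse N) + ?e * cnj (lin_form b h) / N)
        = (- (?e^3) * (cnj ?w)^2 / N\<^sup>2) * lin_form b h + (?e * (N - ?e^2 * (?w * cnj ?w)) / N\<^sup>2) * cnj (lin_form b h)" for h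
        using N0 by (simp add: divide_simps) (simp add: algebra_simps power2_eq_square power3_eq_cube)
      moreover have "N - ?e^2 * (?w * cnj ?w) = 1" by (simp add: NN)
      ultimately show "(\<lambda>h. - (?e * cnj ?w) * (inverse (complex_of_real (norm2 2 (skoda_gen \<epsilon> b a) z)) * (?e^2 * (?w * cnj (lin_form b h) + lin_form b h * cnj ?w)) * inverse (complex_of_real (norm2 2 (skoda_gen \<epsilon> b a) z))) + ?e * cnj (lin_form b h) / complex_of_real (norm2 2 (skoda_gen \<epsilon> b a) z))
        = (\<lambda>h. (- (?e^3) * (cnj ?w)^2 / N\<^sup>2) * lin_form b h + (?e / N\<^sup>2) * cnj (lin_form b h))"
        by (simp add: fun_eq_iff N_def)
    qed (use N0 in \<open>simp add: N_def\<close>)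
    from wirt_lin_form(2)[OF this, of j] False show ?thesis
      by (simp add: beta_star_def skoda_gen_def)
  qed
qed

lemma beta_skoda_gen:
  "p < 2 \<Longrightarrow> beta 2 (skoda_gen \<epsilon> b a) z j p
    = complex_of_real (norm2 2 (skoda_gen \<epsilon> b a) z) * cnj (beta_star 2 (skoda_gen \<epsilon> b a) z j p)"
proof -
  assume p: "p < 2"
  have nz: "\<exists>q<2. skoda_gen \<epsilon> b a q z \<noteq> 0" by (intro exI[of _ 0]) (simp add: skoda_gen_def)
  have "beta_star 2 (skoda_gen \<epsilon> b a) z j p
     = cnj (beta 2 (skoda_gen \<epsilon> b a) z j p) / complex_of_real (norm2 2 (skoda_gen \<epsilon> b a) z)"
    by (rule beta_star_eq[of 2 "skoda_gen \<epsilon> b a" UNIV z p j, OF _ UNIV_I nz p]) (simp add: holomorphic_skoda_gen)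
  then show ?thesis using norm2_skoda_gen_ge_1[of \<epsilon> b a z] by simp
qed

lemma sum_beta_star_skoda_gen:
  assumes "norm b = 1"
  shows "(\<Sum>j\<in>UNIV. \<Sum>p<2. (cmod (beta_star 2 (skoda_gen \<epsilon> b a) z j p))\<^sup>2)
    = \<epsilon>\<^sup>2 / (norm2 2 (skoda_gen \<epsilon> b a) z)^3"
proof -
  let ?N = "norm2 2 (skoda_gen \<epsilon> b a) z" and ?w = "cmod (lin_form b (z - a))"
  have N: "?N > 0" using norm2_skoda_gen_ge_1[of \<epsilon> b a z] by simp
  have *: "(\<Sum>p<2. (cmod (beta_star 2 (skoda_gen \<epsilon> b a) z j p))\<^sup>2) = (\<epsilon>\<^sup>2 / ?N^3) * (cmod (b $ j))\<^sup>2" for j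
  proof -
    have "(\<Sum>p<2. (cmod (beta_star 2 (skoda_gen \<epsilon> b a) z j p))\<^sup>2)
      = \<epsilon>\<^sup>2 * (cmod (b $ j))\<^sup>2 * (1 + \<epsilon>\<^sup>2 * ?w\<^sup>2) / ?N^4"
    proof -
      have c0: "cmod (beta_star 2 (skoda_gen \<epsilon> b a) z j 0) = \<epsilon>\<^sup>2 * ?w * cmod (b $ j) / ?N\<^sup>2"
        and c1: "cmod (beta_star 2 (skoda_gen \<epsilon> b a) z j 1) = \<bar>\<epsilon>\<bar> * cmod (b $ j) / ?N\<^sup>2"
        by (simp_all add: beta_star_skoda_gen norm_mult norm_divide norm_power)
      have "(\<Sum>p<2. (cmod (beta_star 2 (skoda_gen \<epsilon> b a) z j p))\<^sup>2)
         = (\<epsilon>\<^sup>2 * ?w * cmod (b $ j) / ?N\<^sup>2)\<^sup>2 + (\<bar>\<epsilon>\<bar> * cmod (b $ j) / ?N\<^sup>2)\<^sup>2"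
        unfolding c0[symmetric] c1[symmetric] by (simp add: lessThan_nat_numeral numeral_2_eq_2 lessThan_Suc)
      also have "\<dots> = ((\<epsilon>\<^sup>2 * ?w * cmod (b $ j))\<^sup>2 + (\<bar>\<epsilon>\<bar> * cmod (b $ j))\<^sup>2) / ?N^4"
        by (simp add: power_divide add_divide_distrib flip: power_mult)
      also have "(\<epsilon>\<^sup>2 * ?w * cmod (b $ j))\<^sup>2 + (\<bar>\<epsilon>\<bar> * cmod (b $ j))\<^sup>2
         = \<epsilon>\<^sup>2 * (cmod (b $ j))\<^sup>2 * (1 + \<epsilon>\<^sup>2 * ?w\<^sup>2)"
        by (simp add: power_mult_distrib) (simp add: power2_eq_square power4_eq_xxxx algebra_simps)
      finally show ?thesis .
    qed
    also have "\<dots> = \<epsilon>\<^sup>2 * (cmod (b $ j))\<^sup>2 * ?N / ?N^4" by (simp add: norm2_skoda_gen)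
    also have "\<dots> = (\<epsilon>\<^sup>2 / ?N^3) * (cmod (b $ j))\<^sup>2" using N by (simp add: power4_eq_xxxx power3_eq_cube)
    finally show ?thesis .
  qed
  show ?thesis unfolding * sum_distrib_left[symmetric] norm_square_eq_sum[symmetric] using assms by simp
qed

text \<open>By Cauchy-Schwarz the second fundamental form lowers the curvature \<open>s\<close> by at most
  \<open>|\<beta>|\<^sup>2/N = \<epsilon>\<^sup>2/N\<^sup>2 \<le> \<epsilon>\<^sup>2\<close>.\<close>

lemma nakano_positive_on_skoda_gen:
  fixes a b :: "complex^'n::finite"
  assumes b: "norm b = 1" and s: "\<epsilon>\<^sup>2 < s"
  shows "nakano_positive_on D 2 (skoda_gen \<epsilon> b a) (\<lambda>z. s * (norm (z - a))\<^sup>2)"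
  unfolding nakano_positive_on_def
proof (intro ballI allI impI)
  fix z and u :: "'n \<Rightarrow> nat \<Rightarrow> complex" assume "\<exists>j. \<exists>p<2. u j p \<noteq> 0"
  then obtain j0 p0 where jp: "p0 < 2" "u j0 p0 \<noteq> 0" by auto
  let ?N = "norm2 2 (skoda_gen \<epsilon> b a) z"
  define A where "A = (UNIV :: 'n set) \<times> {..<2::nat}"
  define U where "U = (\<Sum>x\<in>A. (cmod (u (fst x) (snd x)))\<^sup>2)"
  have N: "?N \<ge> 1" by (rule norm2_skoda_gen_ge_1)
  have U: "U > 0" unfolding U_def
    by (rule sum_pos2[of _ "(j0, p0)"]) (use jp in \<open>auto simp: A_def\<close>)
  have U': "(\<Sum>j\<in>UNIV. \<Sum>p<2. (cmod (u j p))\<^sup>2) = U"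
    by (simp add: U_def A_def sum.cartesian_product case_prod_unfold)
  have "Re (\<Sum>j\<in>UNIV. \<Sum>l\<in>UNIV. levi j l (\<lambda>z. s * (norm (z - a))\<^sup>2) z * (\<Sum>p<2. u j p * cnj (u l p)))
     = Re (\<Sum>j\<in>UNIV. complex_of_real s * (\<Sum>p<2. u j p * cnj (u j p)))"
    by (simp add: levi_norm_square if_distrib if_distribR cong: if_cong)
  also have "\<dots> = Re (complex_of_real s * complex_of_real U)"
    unfolding U'[symmetric] by (simp add: sum_distrib_left complex_norm_square del: of_real_power)
  finally have 1: "Re (\<Sum>j\<in>UNIV. \<Sum>l\<in>UNIV. levi j l (\<lambda>z. s * (norm (z - a))\<^sup>2) z * (\<Sum>p<2. u j p * cnj (u l p))) = s * U"
    by simp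
  let ?B = "\<lambda>x. beta 2 (skoda_gen \<epsilon> b a) z (fst x) (snd x)" and ?u = "\<lambda>x. u (fst x) (snd x)"
  have "beta_app 2 (skoda_gen \<epsilon> b a) z u = (\<Sum>x\<in>A. ?B x * ?u x)"
    by (simp add: beta_app_def A_def sum.cartesian_product case_prod_unfold)
  then have "cmod (beta_app 2 (skoda_gen \<epsilon> b a) z u) \<le> (\<Sum>x\<in>A. cmod (?B x) * cmod (?u x))"
    by (metis (mono_tags, lifting) norm_mult norm_sum sum.cong)
  then have "(cmod (beta_app 2 (skoda_gen \<epsilon> b a) z u))\<^sup>2 \<le> (\<Sum>x\<in>A. cmod (?B x) * cmod (?u x))\<^sup>2"
    by (intro power_mono) auto
  also have "\<dots> \<le> (\<Sum>x\<in>A. (cmod (?B x))\<^sup>2) * (\<Sum>x\<in>A. (cmod (?u x))\<^sup>2)"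
    by (rule Cauchy_Schwarz_ineq_sum)
  also have "(\<Sum>x\<in>A. (cmod (?B x))\<^sup>2) = ?N\<^sup>2 * (\<epsilon>\<^sup>2 / ?N^3)"
  proof -
    have "(\<Sum>x\<in>A. (cmod (?B x))\<^sup>2) = (\<Sum>x\<in>A. ?N\<^sup>2 * (cmod (beta_star 2 (skoda_gen \<epsilon> b a) z (fst x) (snd x)))\<^sup>2)"
      using N by (intro sum.cong refl) (auto simp: A_def beta_skoda_gen norm_mult power_mult_distrib)
    also have "\<dots> = ?N\<^sup>2 * (\<epsilon>\<^sup>2 / ?N^3)"
      unfolding sum_beta_star_skoda_gen[OF b, symmetric]
      by (simp add: A_def sum.cartesian_product case_prod_unfold flip: sum_distrib_left)
    finally show ?thesis .
  qed
  also have "(\<Sum>x\<in>A. (cmod (?u x))\<^sup>2) = U" by (simp add: U_def)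
  finally have "(cmod (beta_app 2 (skoda_gen \<epsilon> b a) z u))\<^sup>2 / ?N \<le> ?N\<^sup>2 * (\<epsilon>\<^sup>2 / ?N^3) * U / ?N"
    using N by (intro divide_right_mono) auto
  also have "\<dots> = (\<epsilon>\<^sup>2 / ?N\<^sup>2) * U" using N by (simp add: power2_eq_square power3_eq_cube)
  also have "\<dots> \<le> \<epsilon>\<^sup>2 * U"
    using N U by (intro mult_right_mono) (auto simp: divide_le_eq mult_left_le self_le_power mult_le_cancel_left1 one_le_power)
  also have "\<dots> < s * U" using s U by simp
  finally show "nakano_form 2 (skoda_gen \<epsilon> b a) (\<lambda>z. s * (norm (z - a))\<^sup>2) z u > 0"
    unfolding nakano_form_def 1 by simp
qed

text \<open>Since \<open>\<beta>(\<beta>\<^sup>*) = \<epsilon>\<^sup>2/N\<^sup>2\<close>, the form \<open>\<beta>\<^sup>*\<close> is an eigenvector of the curvature operator with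
  eigenvalue \<open>s - \<epsilon>\<^sup>2/N\<^sup>2\<close>, and the inverse acts on it by division.\<close>

lemma skoda_gen_integrand:
  fixes a b z :: "complex^'n::finite"
  assumes b: "norm b = 1" and s: "\<epsilon>\<^sup>2 < s"
  defines "g \<equiv> skoda_gen \<epsilon> b a" and "\<psi> \<equiv> (\<lambda>z. s * (norm (z - a))\<^sup>2)"
  defines "N \<equiv> norm2 2 g z"
  shows "Re (n1_inner 2 (the_inv_into (n1_forms 2) (curv_op 2 g \<psi> z) (beta_star_dz 2 g z)) (beta_star_dz 2 g z))
    = (\<epsilon>\<^sup>2 / N^3) / (s - \<epsilon>\<^sup>2 / N\<^sup>2)"
proof -
  have N: "N \<ge> 1" unfolding N_def g_def by (rule norm2_skoda_gen_ge_1)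
  define m where "m = \<epsilon>\<^sup>2 / N\<^sup>2"
  have "m \<le> \<epsilon>\<^sup>2"
    using N by (auto simp: m_def divide_le_eq mult_le_cancel_left1 one_le_power)
  then have sm: "s - m > 0" using s by simp
  define c where "c = complex_of_real (1 / (s - m))"
  have c: "c * complex_of_real (s - m) = 1"
    using sm by (simp add: c_def flip: of_real_mult del: of_real_diff)
  define x where "x = (\<lambda>j p. c * beta_star_dz 2 g z j p)"
  have S: "(\<Sum>j\<in>UNIV. \<Sum>p<2. (cmod (beta_star 2 g z j p))\<^sup>2) = \<epsilon>\<^sup>2 / N^3"
    unfolding g_def N_def by (rule sum_beta_star_skoda_gen[OF b])
  have "beta_app 2 g z (beta_star_dz 2 g z)
     = (\<Sum>j\<in>UNIV. \<Sum>p<2. (-1) ^ CARD('n) * complex_of_real N * complex_of_real ((cmod (beta_star 2 g z j p))\<^sup>2))"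
    unfolding beta_app_def beta_star_dz_def
    by (intro sum.cong refl) (simp add: g_def N_def beta_skoda_gen complex_norm_square del: of_real_power)
  also have "\<dots> = (-1) ^ CARD('n) * complex_of_real (N * (\<epsilon>\<^sup>2 / N^3))"
    unfolding S[symmetric] by (simp add: sum_distrib_left mult.assoc)
  also have "N * (\<epsilon>\<^sup>2 / N^3) = m" using N by (simp add: m_def power2_eq_square power3_eq_cube)
  finally have B: "beta_app 2 g z (beta_star_dz 2 g z) = (-1) ^ CARD('n) * complex_of_real m" .
  have Bx: "beta_app 2 g z x = c * beta_app 2 g z (beta_star_dz 2 g z)"
    unfolding beta_app_def x_def by (simp add: sum_distrib_left mult_ac)
  have "curv_op 2 g \<psi> z x = beta_star_dz 2 g z"
  proof (intro ext)
    fix l p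
    show "curv_op 2 g \<psi> z x l p = beta_star_dz 2 g z l p"
    proof (cases "p < 2")
      case True
      have "(\<Sum>j\<in>UNIV. levi j l \<psi> z * x j p) = complex_of_real s * x l p"
        by (simp add: \<psi>_def levi_norm_square if_distrib if_distribR cong: if_cong)
      then have "curv_op 2 g \<psi> z x l p = complex_of_real s * x l p - beta_star 2 g z l p * beta_app 2 g z x"
        using True by (simp add: curv_op_def)
      also have "\<dots> = c * ((-1) ^ CARD('n) * beta_star 2 g z l p) * complex_of_real (s - m)"
        using True unfolding Bx B by (simp add: x_def beta_star_dz_def algebra_simps)
      also have "\<dots> = (c * complex_of_real (s - m)) * ((-1) ^ CARD('n) * beta_star 2 g z l p)"
        by (simp only: mult_ac)
      also have "\<dots> = (-1) ^ CARD('n) * beta_star 2 g z l p" unfolding c by simp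
      finally show ?thesis using True by (simp add: beta_star_dz_def)
    qed (simp add: curv_op_def beta_star_dz_def)
  qed
  moreover have "x \<in> n1_forms 2" by (simp add: n1_forms_def x_def beta_star_dz_def)
  moreover have "inj_on (curv_op 2 g \<psi> z) (n1_forms 2)"
    unfolding g_def \<psi>_def
    by (rule curv_op_inj_on(1)[of 2 _ UNIV, OF _ _ _ nakano_positive_on_skoda_gen[OF b s]])
       (auto simp: holomorphic_skoda_gen skoda_gen_def intro: exI[of _ 0])
  ultimately have "the_inv_into (n1_forms 2) (curv_op 2 g \<psi> z) (beta_star_dz 2 g z) = x"
    by (intro the_inv_into_f_eq)
  moreover have "n1_inner 2 x (beta_star_dz 2 g z) = c * complex_of_real (\<epsilon>\<^sup>2 / N^3)"
  proof -
    have "(beta_star_dz 2 g z j p) * cnj (beta_star_dz 2 g z j p) = complex_of_real ((cmod (beta_star 2 g z j p))\<^sup>2)"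
      if "p < 2" for j p
    proof -
      have "(-1) ^ CARD('n) * ((-1) ^ CARD('n)) = (1::complex)"
        by (simp flip: power_add power_mult_distrib)
      then show ?thesis using that
        by (simp add: beta_star_dz_def complex_norm_square mult_ac del: of_real_power)
    qed
    then have "n1_inner 2 x (beta_star_dz 2 g z)
       = (\<Sum>j\<in>UNIV. \<Sum>p<2. c * complex_of_real ((cmod (beta_star 2 g z j p))\<^sup>2))"
      unfolding n1_inner_def x_def by (intro sum.cong refl) (simp add: mult.assoc del: of_real_power)
    then show ?thesis unfolding S[symmetric] by (simp add: sum_distrib_left)
  qed
  ultimately show ?thesis by (simp add: m_def c_def)
qed

section \<open>From division to approximation by holomorphic functions\<close>

lemma borel_measurable_ennreal_on_open:
  fixes D :: "'a::euclidean_space set" and g :: "'a \<Rightarrow> real"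
  assumes "open D" "continuous_on D g"
  shows "(\<lambda>z. ennreal (g z) * indicator D z) \<in> borel_measurable lborel"
proof -
  have "(\<lambda>z. indicator D z *\<^sub>R g z) \<in> borel_measurable borel"
    using assms by (intro borel_measurable_continuous_on_indicator) auto
  then have "(\<lambda>z. ennreal (indicator D z *\<^sub>R g z)) \<in> borel_measurable lborel" by simp
  moreover have "ennreal (indicator D z *\<^sub>R g z) = ennreal (g z) * indicator D z" for z
    by (simp add: indicator_def)
  ultimately show ?thesis by simp
qed

lemma holomorphic_on_cvec_continuous_on: "holomorphic_on_cvec f D \<Longrightarrow> continuous_on D f"
  unfolding holomorphic_on_cvec_def
  by (meson continuous_at_imp_continuous_on has_derivative_continuous)

text \<open>The orthogonal decomposition of \<open>h = (h0, h1)\<close> with respect to the kernel of \<open>g = (1, a)\<close>: the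
  first term is the norm of the minimal solution \<open>(g \<cdot> h) g\<^sup>*\<close>, the second that of the component in
  the kernel, which is spanned by \<open>(- a, 1)\<close>.\<close>

lemma kernel_splitting:
  fixes h0 h1 a :: complex
  defines "N \<equiv> 1 + (cmod a)\<^sup>2"
  shows "(cmod h0)\<^sup>2 + (cmod h1)\<^sup>2
    = (cmod (h0 + a * h1))\<^sup>2 / N + N * (cmod (h1 - cnj a * (h0 + a * h1) / complex_of_real N))\<^sup>2"
proof -
  have N: "N > 0" by (simp add: N_def add_pos_nonneg)
  have Nc: "complex_of_real N = 1 + a * cnj a" by (simp add: N_def complex_norm_square del: of_real_power)
  have "h1 - cnj a * (h0 + a * h1) / complex_of_real N = (h1 - cnj a * h0) / complex_of_real N"
    using N by (simp add: divide_simps) (simp add: Nc algebra_simps)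
  then have "N * (cmod (h1 - cnj a * (h0 + a * h1) / complex_of_real N))\<^sup>2 = (cmod (h1 - cnj a * h0))\<^sup>2 / N"
    using N by (simp add: norm_divide power_divide power2_eq_square)
  moreover have "(cmod (h0 + a * h1))\<^sup>2 + (cmod (h1 - cnj a * h0))\<^sup>2 = N * ((cmod h0)\<^sup>2 + (cmod h1)\<^sup>2)"
    unfolding N_def cmod_power2 by (simp add: power2_eq_square algebra_simps)
  ultimately show ?thesis using N by (simp flip: add_divide_distrib)
qed

lemma nn_integral_gaussian_finite:
  assumes fin: "(\<integral>\<^sup>+z\<in>D. ennreal ((cmod (f z))\<^sup>2 * exp (- \<phi> z)) \<partial>lborel) < \<infinity>" and s: "0 \<le> s"
  shows "(\<integral>\<^sup>+z\<in>D. ennreal ((cmod (f z))\<^sup>2 * exp (- \<phi> z - s * (norm (z - a))\<^sup>2)) \<partial>lborel) < \<infinity>"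
proof -
  have "(\<integral>\<^sup>+z\<in>D. ennreal ((cmod (f z))\<^sup>2 * exp (- \<phi> z - s * (norm (z - a))\<^sup>2)) \<partial>lborel)
     \<le> (\<integral>\<^sup>+z\<in>D. ennreal ((cmod (f z))\<^sup>2 * exp (- \<phi> z)) \<partial>lborel)"
    using s by (intro nn_integral_mono mult_right_mono ennreal_leI mult_left_mono) auto
  from this fin show ?thesis by (rule le_less_trans)
qed

text \<open>In the estimate for the solution \<open>h\<close> of the division problem the norm of the minimal solution
  equals the first part of the functional. Subtracting this finite quantity leaves an estimate for the
  kernel component, which is of order \<open>\<epsilon>\<close>; division by \<open>\<epsilon>\<^sup>2\<close> gives a bound that stays
  meaningful as \<open>\<epsilon>\<close> tends to \<open>0\<close>.\<close>

lemma divisible_imp_almost_holomorphic: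
  fixes D :: "(complex^'n::finite) set"
  assumes D: "open D" and \<phi>: "continuous_on D \<phi>" and f: "f \<in> A2 D \<phi>" and div: "L2_divisible D \<phi> f"
    and b: "norm b = 1" and \<epsilon>: "0 < \<epsilon>" "\<epsilon>\<^sup>2 < s"
  obtains H where "holomorphic_on_cvec H D"
    "(\<integral>\<^sup>+z\<in>D. ennreal ((cmod (H z - f z * (cnj (lin_form b (z - a)) / complex_of_real (1 + \<epsilon>\<^sup>2 * (cmod (lin_form b (z - a)))\<^sup>2))))\<^sup>2
        * exp (- \<phi> z - s * (norm (z - a))\<^sup>2)) \<partial>lborel)
     \<le> ennreal (1 / (s - \<epsilon>\<^sup>2)) * (\<integral>\<^sup>+z\<in>D. ennreal ((cmod (f z))\<^sup>2 * exp (- \<phi> z - s * (norm (z - a))\<^sup>2)) \<partial>lborel)"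
proof -
  define g where "g = skoda_gen \<epsilon> b a"
  define \<psi> where "\<psi> = (\<lambda>z :: complex^'n. s * (norm (z - a))\<^sup>2)"
  define N where "N z = norm2 2 g z" for z
  define w where "w z = lin_form b (z - a)" for z
  define E where "E z = exp (- \<phi> z - \<psi> z)" for z
  define F where "F z = (cmod (f z))\<^sup>2 * E z" for z
  define X where "X z = (\<epsilon>\<^sup>2 / (N z)^3) / (s - \<epsilon>\<^sup>2 / (N z)\<^sup>2) * F z" for z
  have s0: "s > 0" using \<epsilon> by (smt (verit) zero_le_power2)
  have Neq: "N z = 1 + \<epsilon>\<^sup>2 * (cmod (w z))\<^sup>2" for z
    by (simp add: N_def g_def w_def norm2_skoda_gen)
  have N1: "N z \<ge> 1" for z by (simp add: Neq)
  have holf: "holomorphic_on_cvec f D" using f by (simp add: A2_def)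
  have cf: "continuous_on D f" by (rule holomorphic_on_cvec_continuous_on[OF holf])
  have cw: "continuous_on D w"
    unfolding w_def[abs_def] by (rule continuous_on_lin_form)
  have cN: "continuous_on D N" unfolding Neq[abs_def] by (intro continuous_intros cw)
  have cE: "continuous_on D E" unfolding E_def[abs_def] \<psi>_def by (intro continuous_intros \<phi>)
  have cF: "continuous_on D F" unfolding F_def[abs_def] by (intro continuous_intros cf cE)
  have F0: "F z \<ge> 0" for z by (simp add: F_def E_def)
  have finF: "(\<integral>\<^sup>+z\<in>D. ennreal (F z) \<partial>lborel) < \<infinity>"
    unfolding F_def E_def \<psi>_def using nn_integral_gaussian_finite[of f \<phi> D s a] f s0 by (simp add: A2_def)
  have mN: "\<epsilon>\<^sup>2 / (N z)\<^sup>2 \<le> \<epsilon>\<^sup>2" for z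
    using N1[of z] by (auto simp: divide_le_eq mult_le_cancel_left1 one_le_power)
  have sN: "s - \<epsilon>\<^sup>2 / (N z)\<^sup>2 > 0" for z using mN[of z] \<epsilon> by simp
  have X0: "X z \<ge> 0" for z unfolding X_def using sN[of z] N1[of z] F0 by simp
  have XF: "X z \<le> \<epsilon>\<^sup>2 / (s - \<epsilon>\<^sup>2) * F z" for z
    unfolding X_def
  proof (intro mult_right_mono F0 frac_le)
    show "\<epsilon>\<^sup>2 / N z ^ 3 \<le> \<epsilon>\<^sup>2" using N1[of z] by (auto simp: divide_le_eq mult_le_cancel_left1 one_le_power)
  qed (use mN[of z] \<epsilon> in auto)
  have cX: "continuous_on D X" unfolding X_def[abs_def]
    using sN N1 by (intro continuous_intros cN cF) (auto simp: less_imp_neq[symmetric] dest: spec, (metis less_irrefl not_one_le_zero)+)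
  have cA: "continuous_on D (\<lambda>z. 1 / N z * F z)"
    using N1 by (intro continuous_intros cN cF) (metis not_one_le_zero)
  note meas = borel_measurable_ennreal_on_open[OF D]
  have I: "I_functional D \<phi> \<psi> 2 g f = (\<integral>\<^sup>+z\<in>D. ennreal (1 / N z * F z) \<partial>lborel) + (\<integral>\<^sup>+z\<in>D. ennreal (X z) \<partial>lborel)"
  proof -
    have "ennreal ((1 / norm2 2 g z
          + Re (n1_inner 2 (the_inv_into (n1_forms 2) (curv_op 2 g \<psi> z) (beta_star_dz 2 g z)) (beta_star_dz 2 g z)))
         * (cmod (f z))\<^sup>2 * exp (- \<phi> z - \<psi> z)) = ennreal (1 / N z * F z) + ennreal (X z)" for z
    proof -
      have "Re (n1_inner 2 (the_inv_into (n1_forms 2) (curv_op 2 g \<psi> z) (beta_star_dz 2 g z)) (beta_star_dz 2 g z))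
          = (\<epsilon>\<^sup>2 / (N z)^3) / (s - \<epsilon>\<^sup>2 / (N z)\<^sup>2)"
        unfolding g_def \<psi>_def N_def by (rule skoda_gen_integrand[OF b \<epsilon>(2)])
      then have "(1 / norm2 2 g z
          + Re (n1_inner 2 (the_inv_into (n1_forms 2) (curv_op 2 g \<psi> z) (beta_star_dz 2 g z)) (beta_star_dz 2 g z)))
         * (cmod (f z))\<^sup>2 * exp (- \<phi> z - \<psi> z) = 1 / N z * F z + X z"
        by (simp add: N_def[symmetric] X_def F_def E_def algebra_simps)
      then show ?thesis using F0[of z] X0[of z] N1[of z] by (simp add: ennreal_plus)
    qed
    then show ?thesis unfolding I_functional_def
      by (simp only: distrib_right nn_integral_add[OF meas[OF cA] meas[OF cX]])
  qed
  have A_fin: "(\<integral>\<^sup>+z\<in>D. ennreal (1 / N z * F z) \<partial>lborel) < \<infinity>"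
  proof (rule le_less_trans[OF _ finF], intro nn_integral_mono mult_right_mono ennreal_leI)
    show "1 / N z * F z \<le> F z" for z using N1[of z] F0[of z] by (simp add: divide_le_eq mult_le_cancel_left1)
  qed simp
  have X_le: "(\<integral>\<^sup>+z\<in>D. ennreal (X z) \<partial>lborel) \<le> ennreal (\<epsilon>\<^sup>2 / (s - \<epsilon>\<^sup>2)) * (\<integral>\<^sup>+z\<in>D. ennreal (F z) \<partial>lborel)"
  proof -
    have "(\<integral>\<^sup>+z\<in>D. ennreal (X z) \<partial>lborel) \<le> (\<integral>\<^sup>+z. ennreal (\<epsilon>\<^sup>2 / (s - \<epsilon>\<^sup>2)) * (ennreal (F z) * indicator D z) \<partial>lborel)"
    proof (rule nn_integral_mono)
      fix z
      have "ennreal (X z) \<le> ennreal (\<epsilon>\<^sup>2 / (s - \<epsilon>\<^sup>2)) * ennreal (F z)"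
        using XF[of z] F0[of z] \<epsilon> by (simp add: ennreal_mult'[symmetric] ennreal_leI)
      then show "ennreal (X z) * indicator D z \<le> ennreal (\<epsilon>\<^sup>2 / (s - \<epsilon>\<^sup>2)) * (ennreal (F z) * indicator D z)"
        by (simp add: indicator_def)
    qed
    also have "\<dots> = ennreal (\<epsilon>\<^sup>2 / (s - \<epsilon>\<^sup>2)) * (\<integral>\<^sup>+z\<in>D. ennreal (F z) \<partial>lborel)"
      by (rule nn_integral_cmult[OF meas[OF cF]])
    finally show ?thesis .
  qed
  have "I_functional D \<phi> \<psi> 2 g f < \<infinity>"
    unfolding I using A_fin le_less_trans[OF X_le] finF by (simp add: ennreal_mult_less_top)
  moreover have "smooth_on \<psi> D" "plurisubharmonic_on D \<psi>" "nakano_positive_on D 2 g \<psi>"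
    unfolding g_def \<psi>_def smooth_on_def
    using s0 D by (auto intro: Ck_on_norm_square plurisubharmonic_on_norm_square nakano_positive_on_skoda_gen[OF b \<epsilon>(2)])
  moreover have "\<forall>p<2. holomorphic_on_cvec (g p) D" "\<forall>z\<in>D. \<exists>p<2. g p z \<noteq> 0"
    by (auto simp: g_def holomorphic_skoda_gen) (auto simp: skoda_gen_def intro: exI[of _ 0])
  ultimately have "\<exists>h. (\<forall>p<2. holomorphic_on_cvec (h p) D) \<and> (\<forall>z\<in>D. f z = (\<Sum>p<2. g p z * h p z))
      \<and> weighted_norm2 D (\<lambda>z. \<phi> z + \<psi> z) 2 h \<le> I_functional D \<phi> \<psi> 2 g f"
    using div[unfolded L2_divisible_def] one_le_numeral by blast
  then obtain h where hol: "\<And>p. p < 2 \<Longrightarrow> holomorphic_on_cvec (h p) D"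
    and fh: "\<And>z. z \<in> D \<Longrightarrow> f z = (\<Sum>p<2. g p z * h p z)"
    and le: "weighted_norm2 D (\<lambda>z. \<phi> z + \<psi> z) 2 h \<le> I_functional D \<phi> \<psi> 2 g f"
    by blast
  have fh': "f z = h 0 z + complex_of_real \<epsilon> * w z * h 1 z" if "z \<in> D" for z
    using fh[OF that] by (simp add: numeral_2_eq_2 g_def skoda_gen_def w_def)
  define Y where "Y z = cmod (h 1 z / complex_of_real \<epsilon> - f z * (cnj (w z) / complex_of_real (N z)))" for z
  have c1: "continuous_on D (h 1)" using hol[of 1] by (simp add: holomorphic_on_cvec_continuous_on)
  have N0: "N z \<noteq> 0" for z using N1[of z] by simp
  have cY: "continuous_on D (\<lambda>z. \<epsilon>\<^sup>2 * (N z * ((Y z)\<^sup>2 * E z)))" "continuous_on D (\<lambda>z. (Y z)\<^sup>2 * E z)"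
    unfolding Y_def using \<epsilon> N0 by (auto intro!: continuous_intros cf cw cN cE c1[unfolded One_nat_def])
  have split: "norm2 2 h z * exp (- (\<phi> z + \<psi> z)) = 1 / N z * F z + \<epsilon>\<^sup>2 * (N z * ((Y z)\<^sup>2 * E z))" if "z \<in> D" for z
  proof -
    define e where "e = complex_of_real \<epsilon> * w z"
    have Ne: "N z = 1 + (cmod e)\<^sup>2" by (simp add: Neq e_def norm_mult power_mult_distrib)
    have "h 1 z - cnj e * f z / complex_of_real (N z)
       = complex_of_real \<epsilon> * (h 1 z / complex_of_real \<epsilon> - f z * (cnj (w z) / complex_of_real (N z)))"
      using \<epsilon> by (simp add: e_def algebra_simps)
    then have Y: "cmod (h 1 z - cnj e * f z / complex_of_real (N z)) = \<epsilon> * Y z"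
      using \<epsilon> by (simp add: norm_mult Y_def)
    have "norm2 2 h z = (cmod (h 0 z))\<^sup>2 + (cmod (h 1 z))\<^sup>2" by (simp add: norm2_def numeral_2_eq_2)
    also have "\<dots> = (cmod (f z))\<^sup>2 / N z + N z * (cmod (h 1 z - cnj e * f z / complex_of_real (N z)))\<^sup>2"
      using kernel_splitting[of "h 0 z" "h 1 z" e] fh'[OF that] by (simp add: Ne e_def)
    also have "\<dots> = (cmod (f z))\<^sup>2 / N z + N z * (\<epsilon> * Y z)\<^sup>2" unfolding Y ..
    finally show ?thesis
      by (simp add: F_def E_def power_mult_distrib algebra_simps)
  qed
  have "weighted_norm2 D (\<lambda>z. \<phi> z + \<psi> z) 2 h
      = (\<integral>\<^sup>+z. ennreal (1 / N z * F z) * indicator D z + ennreal (\<epsilon>\<^sup>2 * (N z * ((Y z)\<^sup>2 * E z))) * indicator D z \<partial>lborel)"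
    unfolding weighted_norm2_def
  proof (rule nn_integral_cong)
    fix z show "ennreal (norm2 2 h z * exp (- (\<phi> z + \<psi> z))) * indicator D z
       = ennreal (1 / N z * F z) * indicator D z + ennreal (\<epsilon>\<^sup>2 * (N z * ((Y z)\<^sup>2 * E z))) * indicator D z"
    proof (cases "z \<in> D")
      case True
      show ?thesis unfolding split[OF True] using True F0[of z] N1[of z]
        by (simp add: E_def flip: ennreal_plus)
    qed simp
  qed
  also have "\<dots> = (\<integral>\<^sup>+z\<in>D. ennreal (1 / N z * F z) \<partial>lborel) + (\<integral>\<^sup>+z\<in>D. ennreal (\<epsilon>\<^sup>2 * (N z * ((Y z)\<^sup>2 * E z))) \<partial>lborel)"
    by (rule nn_integral_add[OF meas[OF cA] meas[OF cY(1)]])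
  finally have "(\<integral>\<^sup>+z\<in>D. ennreal (\<epsilon>\<^sup>2 * (N z * ((Y z)\<^sup>2 * E z))) \<partial>lborel) \<le> (\<integral>\<^sup>+z\<in>D. ennreal (X z) \<partial>lborel)"
    using le A_fin unfolding I by (auto simp: ennreal_add_left_cancel_le)
  also note X_le
  finally have 1: "(\<integral>\<^sup>+z\<in>D. ennreal (\<epsilon>\<^sup>2 * (N z * ((Y z)\<^sup>2 * E z))) \<partial>lborel)
      \<le> ennreal (\<epsilon>\<^sup>2 / (s - \<epsilon>\<^sup>2)) * (\<integral>\<^sup>+z\<in>D. ennreal (F z) \<partial>lborel)" .
  have "(\<integral>\<^sup>+z\<in>D. ennreal ((Y z)\<^sup>2 * E z) \<partial>lborel)
      \<le> (\<integral>\<^sup>+z. ennreal (1 / \<epsilon>\<^sup>2) * (ennreal (\<epsilon>\<^sup>2 * (N z * ((Y z)\<^sup>2 * E z))) * indicator D z) \<partial>lborel)"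
  proof (rule nn_integral_mono)
    fix z
    have "(Y z)\<^sup>2 * E z \<le> 1 / \<epsilon>\<^sup>2 * (\<epsilon>\<^sup>2 * (N z * ((Y z)\<^sup>2 * E z)))"
      using mult_right_mono[OF N1[of z], of "(Y z)\<^sup>2 * E z"] \<epsilon> by (simp add: E_def)
    then have "ennreal ((Y z)\<^sup>2 * E z) \<le> ennreal (1 / \<epsilon>\<^sup>2) * ennreal (\<epsilon>\<^sup>2 * (N z * ((Y z)\<^sup>2 * E z)))"
      using N1[of z] by (simp add: ennreal_mult'[symmetric] ennreal_leI E_def)
    then show "ennreal ((Y z)\<^sup>2 * E z) * indicator D z
        \<le> ennreal (1 / \<epsilon>\<^sup>2) * (ennreal (\<epsilon>\<^sup>2 * (N z * ((Y z)\<^sup>2 * E z))) * indicator D z)"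
      by (simp add: indicator_def)
  qed
  also have "\<dots> = ennreal (1 / \<epsilon>\<^sup>2) * (\<integral>\<^sup>+z\<in>D. ennreal (\<epsilon>\<^sup>2 * (N z * ((Y z)\<^sup>2 * E z))) \<partial>lborel)"
    by (rule nn_integral_cmult[OF meas[OF cY(1)]])
  also have "\<dots> \<le> ennreal (1 / \<epsilon>\<^sup>2) * (ennreal (\<epsilon>\<^sup>2 / (s - \<epsilon>\<^sup>2)) * (\<integral>\<^sup>+z\<in>D. ennreal (F z) \<partial>lborel))"
    by (intro mult_left_mono 1) simp
  also have "\<dots> = ennreal (1 / \<epsilon>\<^sup>2 * (\<epsilon>\<^sup>2 / (s - \<epsilon>\<^sup>2))) * (\<integral>\<^sup>+z\<in>D. ennreal (F z) \<partial>lborel)"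
    using \<epsilon> by (subst ennreal_mult) (auto simp: mult.assoc)
  also have "1 / \<epsilon>\<^sup>2 * (\<epsilon>\<^sup>2 / (s - \<epsilon>\<^sup>2)) = 1 / (s - \<epsilon>\<^sup>2)" using \<epsilon> by simp
  finally have "(\<integral>\<^sup>+z\<in>D. ennreal ((Y z)\<^sup>2 * E z) \<partial>lborel) \<le> ennreal (1 / (s - \<epsilon>\<^sup>2)) * (\<integral>\<^sup>+z\<in>D. ennreal (F z) \<partial>lborel)" .
  moreover have "holomorphic_on_cvec (\<lambda>z. h 1 z / complex_of_real \<epsilon>) D"
    unfolding holomorphic_on_cvec_def
  proof
    fix z assume "z \<in> D"
    then obtain L where L: "(h 1 has_derivative L) (at z)" "\<And>c v. L (c *s v) = c * L v"
      using hol[of 1] unfolding holomorphic_on_cvec_def by auto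
    show "\<exists>L. ((\<lambda>z. h 1 z / complex_of_real \<epsilon>) has_derivative L) (at z) \<and> (\<forall>c v. L (c *s v) = c * L v)"
    proof (intro exI conjI allI)
      show "((\<lambda>z. h 1 z / complex_of_real \<epsilon>) has_derivative (\<lambda>v. L v / complex_of_real \<epsilon>)) (at z)"
        using bounded_linear.has_derivative[OF bounded_linear_divide L(1)] .
    qed (simp add: L(2))
  qed
  ultimately show thesis
    by (intro that[of "\<lambda>z. h 1 z / complex_of_real \<epsilon>"]) (simp_all add: Y_def E_def F_def \<psi>_def w_def Neq)
qed

section \<open>The dual estimate\<close>

text \<open>Powers of the positive part are the building blocks of a twice differentiable cut-off function.\<close>

lemma has_real_derivative_pos_part_power:
  "((\<lambda>x::real. max 0 x ^ (k + 2)) has_real_derivative real (k + 2) * max 0 x ^ (k + 1)) (at x)"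
proof -
  consider "x > 0" | "x < 0" | "x = 0" by linarith
  then show ?thesis
  proof cases
    case 1
    have "((\<lambda>x. x ^ (k + 2)) has_real_derivative real (k + 2) * x ^ (k + 1)) (at x)"
      using DERIV_pow[of "k + 2" x] by simp
    then have "((\<lambda>x. max 0 x ^ (k + 2)) has_real_derivative real (k + 2) * x ^ (k + 1)) (at x)"
      by (rule has_field_derivative_transform_within_open[of _ _ _ "{0<..}"]) (use 1 in auto)
    then show ?thesis using 1 by simp
  next
    case 2
    have "((\<lambda>x. 0) has_real_derivative 0) (at x)" by simp
    then have "((\<lambda>x. max 0 x ^ (k + 2)) has_real_derivative 0) (at x)"
      by (rule has_field_derivative_transform_within_open[of _ _ _ "{..<0}"]) (use 2 in auto)
    then show ?thesis using 2 by simp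
  next
    case 3
    have "((\<lambda>h::real. \<bar>h\<bar> ^ (k + 1)) \<longlongrightarrow> \<bar>0\<bar> ^ (k + 1)) (at 0)" by (intro tendsto_intros)
    then have "((\<lambda>h::real. \<bar>h\<bar> ^ (k + 1)) \<longlongrightarrow> 0) (at 0)" by simp
    then have "((\<lambda>h::real. max 0 h ^ (k + 2) / h) \<longlongrightarrow> 0) (at 0)"
      by (rule Lim_null_comparison[rotated]) (auto simp: eventually_at_filter max_def mult_nonpos_nonneg intro!: always_eventually)
    then show ?thesis using 3 by (simp add: has_field_derivative_iff)
  qed
qed

text \<open>With \<open>y\<close> the positive part of \<open>t/\<sigma> - 1\<close>, the function \<open>max 0 (1 - y\<^sup>3)\<^sup>3\<close> is \<open>1\<close> up to \<open>\<sigma>\<close>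
  and \<open>0\<close> from \<open>2 \<sigma>\<close> on. It is composed with \<open>|z - a|\<^sup>2\<close>, which is a smooth function.\<close>

lemma cutoff_exists:
  assumes \<sigma>: "0 < (\<sigma> :: real)"
  obtains \<kappa> \<kappa>' \<kappa>'' :: "real \<Rightarrow> real"
  where "\<And>t. (\<kappa> has_real_derivative \<kappa>' t) (at t)" "\<And>t. (\<kappa>' has_real_derivative \<kappa>'' t) (at t)"
    "continuous_on UNIV \<kappa>''" "\<And>t. 0 \<le> \<kappa> t" "\<And>t. \<kappa> t \<le> 1"
    "\<And>t. t \<le> \<sigma> \<Longrightarrow> \<kappa> t = 1" "\<And>t. t \<le> \<sigma> \<Longrightarrow> \<kappa>' t = 0" "\<And>t. t \<le> \<sigma> \<Longrightarrow> \<kappa>'' t = 0"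
    "\<And>t. 2 * \<sigma> \<le> t \<Longrightarrow> \<kappa> t = 0"
proof -
  have P3: "((\<lambda>x. max 0 (g x) ^ 3) has_real_derivative 3 * max 0 (g x) ^ 2 * g') (at x)"
    if "(g has_real_derivative g') (at x)" for g :: "real \<Rightarrow> real" and g' x
    using DERIV_chain2[OF has_real_derivative_pos_part_power[of 1] that] by (simp add: numeral_eq_Suc)
  have P2: "((\<lambda>x. max 0 (g x) ^ 2) has_real_derivative 2 * max 0 (g x) * g') (at x)"
    if "(g has_real_derivative g') (at x)" for g :: "real \<Rightarrow> real" and g' x
    using DERIV_chain2[OF has_real_derivative_pos_part_power[of 0] that] by (simp add: numeral_eq_Suc)
  define y where "y t = max 0 (t / \<sigma> - 1)" for t
  define v where "v t = max 0 (1 - y t ^ 3)" for t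
  have d0: "((\<lambda>t. t / \<sigma> - 1) has_real_derivative 1 / \<sigma>) (at t)" for t
    using \<sigma> by (auto intro!: derivative_eq_intros)
  have y3: "((\<lambda>t. y t ^ 3) has_real_derivative 3 * y t ^ 2 / \<sigma>) (at t)"
    and y2: "((\<lambda>t. y t ^ 2) has_real_derivative 2 * y t / \<sigma>) (at t)" for t
    unfolding y_def using P3[OF d0] P2[OF d0] by simp_all
  have d1: "((\<lambda>t. 1 - y t ^ 3) has_real_derivative - (3 * y t ^ 2 / \<sigma>)) (at t)" for t
    by (rule DERIV_cong[OF DERIV_diff[OF DERIV_const y3]]) simp
  have v3: "((\<lambda>t. v t ^ 3) has_real_derivative 3 * v t ^ 2 * - (3 * y t ^ 2 / \<sigma>)) (at t)"
    and v2: "((\<lambda>t. v t ^ 2) has_real_derivative 2 * v t * - (3 * y t ^ 2 / \<sigma>)) (at t)" for t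
    unfolding v_def by (rule P3[OF d1] P2[OF d1])+
  have y0: "y t \<ge> 0" for t by (simp add: y_def)
  show thesis
  proof (rule that[of "\<lambda>t. v t ^ 3" "\<lambda>t. 3 * v t ^ 2 * - (3 * y t ^ 2 / \<sigma>)"
        "\<lambda>t. 3 * (2 * v t * - (3 * y t ^ 2 / \<sigma>)) * - (3 * y t ^ 2 / \<sigma>) + 3 * v t ^ 2 * - (3 * (2 * y t / \<sigma>) / \<sigma>)"])
    show "((\<lambda>t. 3 * v t ^ 2 * - (3 * y t ^ 2 / \<sigma>)) has_real_derivative
       3 * (2 * v t * - (3 * y t ^ 2 / \<sigma>)) * - (3 * y t ^ 2 / \<sigma>) + 3 * v t ^ 2 * - (3 * (2 * y t / \<sigma>) / \<sigma>)) (at t)" for t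
      by (rule DERIV_cong[OF DERIV_mult[OF DERIV_cmult[OF v2] DERIV_minus[OF DERIV_cdivide[OF DERIV_cmult[OF y2]]]]]) simp
    show "continuous_on UNIV (\<lambda>t. 3 * (2 * v t * - (3 * y t ^ 2 / \<sigma>)) * - (3 * y t ^ 2 / \<sigma>) + 3 * v t ^ 2 * - (3 * (2 * y t / \<sigma>) / \<sigma>))"
      unfolding v_def y_def by (intro continuous_intros; use \<sigma> in simp)
    show "v t ^ 3 \<le> 1" for t using y0[of t] by (intro power_le_one) (auto simp: v_def)
    have yz: "y t = 0" if "t \<le> \<sigma>" for t using that \<sigma> by (simp add: y_def)
    show "v t ^ 3 = 1" "3 * v t ^ 2 * - (3 * y t ^ 2 / \<sigma>) = 0"
      "3 * (2 * v t * - (3 * y t ^ 2 / \<sigma>)) * - (3 * y t ^ 2 / \<sigma>) + 3 * v t ^ 2 * - (3 * (2 * y t / \<sigma>) / \<sigma>) = 0"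
      if "t \<le> \<sigma>" for t using yz[OF that] by (simp_all add: v_def)
    show "v t ^ 3 = 0" if "2 * \<sigma> \<le> t" for t
    proof -
      have "1 \<le> t / \<sigma> - 1" using that \<sigma> by (simp add: pos_le_divide_eq le_diff_eq)
      then have "1 \<le> y t ^ 3" by (intro one_le_power) (simp add: y_def)
      then show ?thesis by (simp add: v_def)
    qed
  qed (use v3 in \<open>auto simp: v_def\<close>)
qed

lemma has_wirt_norm_square:
  "has_wirt b (\<lambda>x. complex_of_real ((norm (x - a))\<^sup>2)) (cnj (lin_form b (x - a))) (lin_form b (x - a)) x"
proof -
  have d: "dir_deriv v (\<lambda>x. (norm (x - a))\<^sup>2) x = 2 * inner (x - a) v" for v
    using frechet_norm_square[of 1 a x] by (simp add: dir_deriv_def)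
  have 1: "inner (x - a) b = Re (lin_form b (x - a))" "inner (x - a) (\<i> *s b) = Im (lin_form b (x - a))"
    by (simp_all add: inner_vec_def inner_complex_def lin_form_def algebra_simps sum_subtractf sum.distrib)
  have "(\<lambda>x. (norm (x - a))\<^sup>2) differentiable (at x)"
    using has_derivative_norm_square[of 1 a x] by (auto simp: differentiable_def)
  from has_wirt_of_real[OF this, of b]
  have "has_wirt b (\<lambda>x. complex_of_real ((norm (x - a))\<^sup>2))
     (complex_of_real (Re (lin_form b (x - a))) - \<i> * complex_of_real (Im (lin_form b (x - a))))
     (cnj (complex_of_real (Re (lin_form b (x - a))) - \<i> * complex_of_real (Im (lin_form b (x - a))))) x"
    unfolding d 1 by (simp add: diff_divide_distrib)
  moreover have "complex_of_real (Re z) - \<i> * complex_of_real (Im z) = cnj z" for z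
    by (simp add: complex_eq_iff)
  ultimately show ?thesis by simp
qed

lemma has_wirt_lin_form:
  assumes "norm b = 1" shows "has_wirt b (\<lambda>x. lin_form b (x - a)) 1 0 x"
proof -
  have "has_wirt b (\<lambda>x. lin_form b (x - a)) (lin_form b b) 0 x"
    by (rule has_wirt_of_has_derivative[OF has_derivative_lin_form lin_form_scale])
  then show ?thesis using assms by (simp add: lin_form_self)
qed

lemma has_wirt_eq_rhs: "has_wirt b F p q x \<Longrightarrow> p = p' \<Longrightarrow> q = q' \<Longrightarrow> has_wirt b F p' q' x"
  by simp

lemma Re_set_integral:
  assumes "set_integrable M C f"
  shows "(LINT x:C|M. Re (f x)) = Re (LINT x:C|M. f x)"
  using integral_Re[OF assms[unfolded set_integrable_def]] by (simp add: set_lebesgue_integral_def)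

text \<open>Let \<open>G\<close> be the conjugate of \<open>\<kappa> f E\<close>. Then \<open>\<partial>bar\<^sub>b G = - cnj T E\<close> defines the test function \<open>T\<close>.
  Integrating \<open>\<partial>bar\<^sub>b\<close> of \<open>(H - f cnj w/N) G\<close> evaluates the pairing with \<open>T\<close>, because
  \<open>\<partial>bar\<^sub>b (cnj w/N) = 1/N\<^sup>2\<close>, and integrating \<open>\<partial>bar\<^sub>b\<close> of \<open>T G\<close> evaluates the norm of \<open>T\<close>. The term
  \<open>err\<close> collects what contains a derivative of \<open>\<kappa>\<close>. Taking \<open>f\<close> itself as a factor of the test
  function makes the estimate asymptotically sharp and avoids dividing by \<open>f\<close>.\<close>

lemma dual_estimate:
  fixes D C :: "(complex^'n::finite) set" and \<phi> :: "complex^'n \<Rightarrow> real" and \<epsilon> :: real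
  assumes D: "open D" and C: "compact C" "C \<subseteq> D" and b: "norm b = 1" and s: "0 < s"
    and f: "holomorphic_on_cvec f D" and H: "holomorphic_on_cvec H D"
    and d\<phi>: "\<And>x. x \<in> D \<Longrightarrow> has_wirt b (\<lambda>x. complex_of_real (\<phi> x)) (p x) (cnj (p x)) x"
    and dp: "\<And>x. x \<in> D \<Longrightarrow> has_wirt b p (p' x) (q x) x"
    and c\<phi>: "continuous_on D \<phi>" "continuous_on D p" "continuous_on D p'" "continuous_on D q"
    and \<kappa>: "\<And>t. (\<kappa> has_real_derivative \<kappa>' t) (at t)" "\<And>t. (\<kappa>' has_real_derivative \<kappa>'' t) (at t)"
      "continuous_on UNIV \<kappa>''"
    and supp: "\<And>x. x \<in> D - C \<Longrightarrow> \<kappa> ((norm (x - a))\<^sup>2) = 0"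
  defines "w \<equiv> \<lambda>z. lin_form b (z - a)"
  defines "\<rho> \<equiv> \<lambda>z. (norm (z - a))\<^sup>2"
  defines "E \<equiv> \<lambda>z. exp (- \<phi> z - s * \<rho> z)"
  defines "N \<equiv> \<lambda>z. 1 + \<epsilon>\<^sup>2 * (cmod (w z))\<^sup>2"
  defines "err \<equiv> \<lambda>z. complex_of_real (\<kappa> (\<rho> z)) * cnj (f z) *
     (f z * (complex_of_real (\<kappa>' (\<rho> z)) * (w z * (p z + complex_of_real s * cnj (w z)) - 1) - complex_of_real (\<kappa>'' (\<rho> z)) * (w z * cnj (w z)))
      - complex_of_real (\<kappa>' (\<rho> z)) * w z * slice_deriv b 1 f z)"
  shows "2 * (LINT z:C|lborel. \<kappa> (\<rho> z) * (cmod (f z))\<^sup>2 * E z / (N z)\<^sup>2)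
     \<le> s * (LINT z:C|lborel. (cmod (H z - f z * (cnj (w z) / complex_of_real (N z))))\<^sup>2 * E z)
       + (LINT z:C|lborel. ((\<kappa> (\<rho> z))\<^sup>2 * (cmod (f z))\<^sup>2 * (s + Re (q z)) + Re (err z)) * E z) / s"
proof -
  have N0: "N z \<noteq> 0" for z unfolding N_def by (smt (verit) mult_nonneg_nonneg zero_le_power2)
  define f1 where "f1 = slice_deriv b 1 f"
  define f2 where "f2 = slice_deriv b (Suc 1) f"
  define K where "K z = complex_of_real (\<kappa> (\<rho> z))" for z
  define K1 where "K1 z = complex_of_real (\<kappa>' (\<rho> z))" for z
  define K2 where "K2 z = complex_of_real (\<kappa>'' (\<rho> z))" for z
  define e where "e z = complex_of_real (E z)" for z
  define n where "n z = complex_of_real (1 / N z)" for z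
  define S where "S = complex_of_real s"
  define u where "u z = p z + S * cnj (w z)" for z
  have cw: "continuous_on D w" unfolding w_def by (rule continuous_on_lin_form)
  have cf: "continuous_on D f" by (rule holomorphic_on_cvec_continuous_on[OF f])
  have cH: "continuous_on D H" by (rule holomorphic_on_cvec_continuous_on[OF H])
  have cf1: "continuous_on D f1" "continuous_on D f2"
    unfolding f1_def f2_def by (rule continuous_on_slice_deriv[OF f D])+
  have c\<rho>: "continuous_on D \<rho>" unfolding \<rho>_def by (intro continuous_intros)
  have cE: "continuous_on D E" unfolding E_def by (intro continuous_intros c\<phi> c\<rho>)
  have ce: "continuous_on D e" unfolding e_def by (intro continuous_intros cE)
  have "continuous_on UNIV \<kappa>" "continuous_on UNIV \<kappa>'"
    using \<kappa>(1,2) by (meson DERIV_isCont continuous_at_imp_continuous_on)+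
  then have c\<kappa>: "continuous_on D (\<lambda>z. \<kappa> (\<rho> z))" "continuous_on D (\<lambda>z. \<kappa>' (\<rho> z))" "continuous_on D (\<lambda>z. \<kappa>'' (\<rho> z))"
    using \<kappa>(3) continuous_on_compose2[OF _ c\<rho>] by blast+
  then have cK: "continuous_on D K" "continuous_on D K1" "continuous_on D K2"
    unfolding K_def K1_def K2_def by (intro continuous_intros; simp)+
  have cN: "continuous_on D N" unfolding N_def by (intro continuous_intros cw)
  have cn: "continuous_on D n" unfolding n_def using N0 by (intro continuous_intros cN) auto
  have cu: "continuous_on D u" unfolding u_def by (intro continuous_intros c\<phi> cw)
  have ww: "has_wirt b w 1 0 x" for x unfolding w_def by (rule has_wirt_lin_form[OF b])
  have wcw: "has_wirt b (\<lambda>x. cnj (w x)) 0 1 x" for x using has_wirt_cnj[OF ww] by simp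
  have wf: "has_wirt b f (f1 x) 0 x" and wf1: "has_wirt b f1 (f2 x) 0 x" and wH: "has_wirt b H (slice_deriv b 1 H x) 0 x"
    if "x \<in> D" for x
    using has_wirt_slice_deriv[OF f D that, of b 0] has_wirt_slice_deriv[OF f D that, of b 1]
      has_wirt_slice_deriv[OF H D that, of b 0]
    by (simp_all add: f1_def f2_def slice_deriv_0[abs_def])
  have wcf: "has_wirt b (\<lambda>x. cnj (f x)) 0 (cnj (f1 x)) x" if "x \<in> D" for x
    using has_wirt_cnj[OF wf[OF that]] by simp
  have w\<rho>: "has_wirt b (\<lambda>x. complex_of_real (\<rho> x)) (cnj (w x)) (w x) x" for x
    unfolding \<rho>_def w_def by (rule has_wirt_norm_square)
  have wK: "has_wirt b K (K1 x * cnj (w x)) (K1 x * w x) x" for x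
    unfolding K_def K1_def using has_wirt_of_real_compose[OF w\<rho> \<kappa>(1)] .
  have wK1: "has_wirt b K1 (K2 x * cnj (w x)) (K2 x * w x) x" for x
    unfolding K1_def K2_def using has_wirt_of_real_compose[OF w\<rho> \<kappa>(2)] .
  have we: "has_wirt b e (- e x * u x) (- e x * cnj (u x)) x" if x: "x \<in> D" for x
  proof -
    have "has_wirt b (\<lambda>x. complex_of_real (\<phi> x) + S * complex_of_real (\<rho> x))
       (p x + (0 * complex_of_real (\<rho> x) + S * cnj (w x))) (cnj (p x) + (0 * complex_of_real (\<rho> x) + S * w x)) x"
      by (intro has_wirt_add has_wirt_mult has_wirt_const d\<phi> w\<rho> x)
    then have "has_wirt b (\<lambda>x. complex_of_real (\<phi> x + s * \<rho> x)) (u x) (cnj (u x)) x"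
      by (simp add: u_def S_def)
    moreover have "((\<lambda>t. exp (- t)) has_real_derivative - exp (- (\<phi> x + s * \<rho> x))) (at (\<phi> x + s * \<rho> x))"
      by (auto intro!: derivative_eq_intros)
    ultimately have "has_wirt b (\<lambda>x. complex_of_real (exp (- (\<phi> x + s * \<rho> x))))
        (complex_of_real (- exp (- (\<phi> x + s * \<rho> x))) * u x) (complex_of_real (- exp (- (\<phi> x + s * \<rho> x))) * cnj (u x)) x"
      by (rule has_wirt_of_real_compose)
    then show ?thesis by (simp add: e_def[abs_def] E_def)
  qed
  define n' where "n' x = complex_of_real (- \<epsilon>\<^sup>2 / (N x)\<^sup>2)" for x
  have cn': "continuous_on D n'" unfolding n'_def using N0 by (intro continuous_intros cN) auto
  have wn: "has_wirt b n (n' x * cnj (w x)) (n' x * w x) x" for x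
  proof -
    have "has_wirt b (\<lambda>x. w x * cnj (w x)) (1 * cnj (w x) + w x * 0) (0 * cnj (w x) + w x * 1) x"
      by (intro has_wirt_mult ww wcw)
    then have "has_wirt b (\<lambda>x. complex_of_real ((cmod (w x))\<^sup>2)) (cnj (w x)) (w x) x"
      by (simp add: complex_norm_square del: of_real_power)
    moreover have "((\<lambda>t. 1 / (1 + \<epsilon>\<^sup>2 * t)) has_real_derivative - \<epsilon>\<^sup>2 / (N x)\<^sup>2) (at ((cmod (w x))\<^sup>2))"
      using N0[of x] unfolding N_def by (auto intro!: derivative_eq_intros simp: power2_eq_square)
    ultimately have "has_wirt b (\<lambda>x. complex_of_real (1 / (1 + \<epsilon>\<^sup>2 * (cmod (w x))\<^sup>2)))
       (complex_of_real (- \<epsilon>\<^sup>2 / (N x)\<^sup>2) * cnj (w x)) (complex_of_real (- \<epsilon>\<^sup>2 / (N x)\<^sup>2) * w x) x"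
      by (rule has_wirt_of_real_compose)
    then show ?thesis by (simp only: n_def[abs_def] n'_def N_def)
  qed
  \<comment> \<open>This is \<open>\<partial>bar\<^sub>b (cnj w/N) = 1/N\<^sup>2\<close>, with \<open>n = 1/N\<close>.\<close>
  have n_id: "n x + cnj (w x) * (n' x * w x) = n x * n x" for x
  proof -
    have "1 / N x - \<epsilon>\<^sup>2 * (cmod (w x))\<^sup>2 / (N x)\<^sup>2 = (N x - \<epsilon>\<^sup>2 * (cmod (w x))\<^sup>2) / (N x)\<^sup>2"
      using N0[of x] by (simp add: diff_divide_distrib power2_eq_square)
    also have "\<dots> = 1 / N x * (1 / N x)" by (simp add: N_def power2_eq_square)
    finally have "complex_of_real (1 / N x - \<epsilon>\<^sup>2 * (cmod (w x))\<^sup>2 / (N x)\<^sup>2) = n x * n x"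
      unfolding n_def by (simp flip: of_real_mult)
    moreover have "cnj (w x) * (n' x * w x) = complex_of_real (- (\<epsilon>\<^sup>2 * (cmod (w x))\<^sup>2 / (N x)\<^sup>2))"
      unfolding n'_def by (simp add: complex_norm_square mult_ac del: of_real_power)
    ultimately show ?thesis by (simp add: n_def)
  qed
  define G where "G z = K z * cnj (f z) * e z" for z
  define T where "T z = f z * (K z * u z - K1 z * cnj (w z)) - K z * f1 z" for z
  define pT where "pT z = f1 z * (K z * u z - K1 z * cnj (w z)) + f z * (K1 z * cnj (w z) * u z + K z * p' z - K2 z * cnj (w z) * cnj (w z)) - (K1 z * cnj (w z) * f1 z + K z * f2 z)" for z
  define qT where "qT z = f z * (K1 z * w z * u z + K z * (q z + S) - (K2 z * w z * cnj (w z) + K1 z)) - K1 z * w z * f1 z" for z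
  have wG: "has_wirt b G (K1 x * cnj (w x) * cnj (f x) * e x - K x * cnj (f x) * e x * u x) (- (cnj (T x) * e x)) x" if x: "x \<in> D" for x
    unfolding G_def
    by (rule has_wirt_eq_rhs[OF has_wirt_mult[OF has_wirt_mult[OF wK wcf[OF x]] we[OF x]]])
       (simp_all add: T_def K_def K1_def algebra_simps)
  have wu: "has_wirt b u (p' x) (q x + S) x" if x: "x \<in> D" for x
    unfolding u_def
    by (rule has_wirt_eq_rhs[OF has_wirt_add[OF dp[OF x] has_wirt_mult[OF has_wirt_const wcw]]]) simp_all
  have wT: "has_wirt b T (pT x) (qT x) x" if x: "x \<in> D" for x
    unfolding T_def
    by (rule has_wirt_eq_rhs[OF has_wirt_diff[OF has_wirt_mult[OF wf[OF x] has_wirt_diff[OF has_wirt_mult[OF wK wu[OF x]] has_wirt_mult[OF wK1 wcw]]] has_wirt_mult[OF wK wf1[OF x]]]])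
       (simp_all add: pT_def qT_def algebra_simps)
  define v where "v z = H z - f z * (cnj (w z) * n z)" for z
  define pv where "pv z = slice_deriv b 1 H z - (f1 z * (cnj (w z) * n z) + f z * (cnj (w z) * (n' z * cnj (w z))))" for z
  have wv: "has_wirt b v (pv x) (- (f x * (n x * n x))) x" if x: "x \<in> D" for x
    unfolding v_def
    by (rule has_wirt_eq_rhs[OF has_wirt_diff[OF wH[OF x] has_wirt_mult[OF wf[OF x] has_wirt_mult[OF wcw wn]]]])
       (simp_all add: pv_def n_id[symmetric] algebra_simps)
  have cG: "continuous_on D G" unfolding G_def by (intro continuous_intros cK cf ce)
  have cT: "continuous_on D T" "continuous_on D pT" "continuous_on D qT"
    unfolding T_def pT_def qT_def by (intro continuous_intros cK cf cf1 cu cw c\<phi>)+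
  have cv: "continuous_on D v" "continuous_on D pv"
    unfolding v_def pv_def by (intro continuous_intros cH cf cf1 cn cn' cw continuous_on_slice_deriv[OF H D])+
  have G0: "G x = 0" if "x \<in> D - C" for x using supp[OF that] by (simp add: G_def K_def \<rho>_def)
  note CD = continuous_on_subset[OF _ C(2)]
  note intC = set_integrable_compact[OF C(1) CD]
  have I1: "(LINT x:C|lborel. - (f x * (n x * n x)) * G x + v x * - (cnj (T x) * e x)) = 0"
    by (rule integral_wirt_bar_eq_0[OF D C has_wirt_mult[OF wv wG]])
       (auto intro!: continuous_intros cv cG cf cn cT ce cK cw cu G0)
  have I2: "(LINT x:C|lborel. qT x * G x + T x * - (cnj (T x) * e x)) = 0"
    by (rule integral_wirt_bar_eq_0[OF D C has_wirt_mult[OF wT wG]])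
       (auto intro!: continuous_intros cv cG cf cn cT ce cK cw cu G0)
  have J: "(LINT z:C|lborel. \<kappa> (\<rho> z) * (cmod (f z))\<^sup>2 * E z / (N z)\<^sup>2) + (LINT z:C|lborel. Re (v z * cnj (T z)) * E z) = 0"
  proof -
    have "(LINT x:C|lborel. Re (- (f x * (n x * n x)) * G x + v x * - (cnj (T x) * e x))) = 0"
      by (rule trans[OF Re_set_integral], rule intC, intro continuous_intros cv cG cf cn cT ce, subst I1, simp)
    moreover have "Re (- (f x * (n x * n x)) * G x + v x * - (cnj (T x) * e x))
       = - (\<kappa> (\<rho> x) * (cmod (f x))\<^sup>2 * E x / (N x)\<^sup>2 + Re (v x * cnj (T x)) * E x)" for x
    proof -
      have "f x * (n x * n x) * G x = complex_of_real (\<kappa> (\<rho> x) * (cmod (f x))\<^sup>2 * E x / (N x)\<^sup>2)"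
        by (simp add: n_def G_def K_def e_def complex_norm_square power2_eq_square[of "complex_of_real (N x)"] del: of_real_power) (simp add: power2_eq_square)
      moreover have "v x * (cnj (T x) * e x) = (v x * cnj (T x)) * complex_of_real (E x)"
        by (simp add: e_def)
      ultimately show ?thesis
        by (simp only: mult_minus_left mult_minus_right) simp
    qed
    ultimately have "(LINT x:C|lborel. - (\<kappa> (\<rho> x) * (cmod (f x))\<^sup>2 * E x / (N x)\<^sup>2 + Re (v x * cnj (T x)) * E x)) = 0"
      by simp
    moreover have "(LINT x:C|lborel. \<kappa> (\<rho> x) * (cmod (f x))\<^sup>2 * E x / (N x)\<^sup>2 + Re (v x * cnj (T x)) * E x)
       = (LINT z:C|lborel. \<kappa> (\<rho> z) * (cmod (f z))\<^sup>2 * E z / (N z)\<^sup>2) + (LINT z:C|lborel. Re (v z * cnj (T z)) * E z)"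
      by (rule set_integral_add) (auto intro!: intC continuous_intros cv cf cT cE cN c\<kappa> simp: N0)
    moreover have neg: "(LINT x:C|lborel. - g x) = - (LINT x:C|lborel. g x)" for g :: "complex^'n \<Rightarrow> real"
      by (simp add: set_lebesgue_integral_def)
    ultimately show ?thesis unfolding neg by linarith
  qed
  have W: "(LINT z:C|lborel. (cmod (T z))\<^sup>2 * E z)
     = (LINT z:C|lborel. ((\<kappa> (\<rho> z))\<^sup>2 * (cmod (f z))\<^sup>2 * (s + Re (q z)) + Re (err z)) * E z)"
  proof -
    have "(LINT x:C|lborel. Re (qT x * G x + T x * - (cnj (T x) * e x))) = 0"
      by (rule trans[OF Re_set_integral], rule intC, intro continuous_intros cv cG cf cn cT ce, subst I2, simp)
    moreover have "Re (qT x * G x + T x * - (cnj (T x) * e x))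
        = ((\<kappa> (\<rho> x))\<^sup>2 * (cmod (f x))\<^sup>2 * (s + Re (q x)) + Re (err x)) * E x - (cmod (T x))\<^sup>2 * E x" for x
    proof -
      have "T x * (cnj (T x) * e x) = complex_of_real ((cmod (T x))\<^sup>2 * E x)"
        by (simp add: e_def complex_norm_square mult_ac del: of_real_power)
      moreover have "qT x * G x = (complex_of_real ((\<kappa> (\<rho> x))\<^sup>2 * (cmod (f x))\<^sup>2) * (S + q x) + err x) * complex_of_real (E x)"
      proof -
        have ff: "complex_of_real ((\<kappa> (\<rho> x))\<^sup>2 * (cmod (f x))\<^sup>2) = K x * K x * (f x * cnj (f x))"
          by (simp add: K_def complex_norm_square power2_eq_square[of "complex_of_real (\<kappa> (\<rho> x))"] del: of_real_power) (simp add: power2_eq_square)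
        show ?thesis unfolding ff
          by (simp add: qT_def G_def err_def u_def K_def K1_def K2_def e_def f1_def S_def algebra_simps)
      qed
      ultimately show ?thesis by (simp add: S_def)
    qed
    ultimately have "(LINT x:C|lborel. ((\<kappa> (\<rho> x))\<^sup>2 * (cmod (f x))\<^sup>2 * (s + Re (q x)) + Re (err x)) * E x - (cmod (T x))\<^sup>2 * E x) = 0"
      by simp
    moreover have "(LINT x:C|lborel. ((\<kappa> (\<rho> x))\<^sup>2 * (cmod (f x))\<^sup>2 * (s + Re (q x)) + Re (err x)) * E x - (cmod (T x))\<^sup>2 * E x)
      = (LINT x:C|lborel. ((\<kappa> (\<rho> x))\<^sup>2 * (cmod (f x))\<^sup>2 * (s + Re (q x)) + Re (err x)) * E x) - (LINT x:C|lborel. (cmod (T x))\<^sup>2 * E x)"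
      unfolding err_def
      by (rule set_integral_diff)
         (auto intro!: intC continuous_intros cf cf1[unfolded f1_def One_nat_def] cw cT cE c\<kappa> c\<phi>)
    ultimately show ?thesis by simp
  qed
  have "2 * (LINT z:C|lborel. \<kappa> (\<rho> z) * (cmod (f z))\<^sup>2 * E z / (N z)\<^sup>2) = (LINT z:C|lborel. - 2 * (Re (v z * cnj (T z)) * E z))"
    using J by (subst set_integral_mult_right) linarith
  \<comment> \<open>The weight \<open>s\<close> in \<open>2|v T| \<le> s|v|\<^sup>2 + |T|\<^sup>2/s\<close> balances the two terms: the bounds available for
    \<open>\<parallel>T\<parallel>\<^sup>2\<close> and \<open>\<parallel>v\<parallel>\<^sup>2\<close> are about \<open>s J\<close> and \<open>J/s\<close>.\<close>
  also have "\<dots> \<le> (LINT z:C|lborel. s * ((cmod (v z))\<^sup>2 * E z) + (cmod (T z))\<^sup>2 * E z / s)"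
  proof (rule set_integral_mono)
    fix x
    have "0 \<le> (cmod (complex_of_real s * v x + T x))\<^sup>2" by simp
    also have "\<dots> = s\<^sup>2 * (cmod (v x))\<^sup>2 + 2 * s * Re (v x * cnj (T x)) + (cmod (T x))\<^sup>2"
      unfolding cmod_power2 by (simp add: power2_eq_square algebra_simps)
    finally have "0 \<le> (s\<^sup>2 * (cmod (v x))\<^sup>2 + 2 * s * Re (v x * cnj (T x)) + (cmod (T x))\<^sup>2) / s"
      using s by simp
    also have "\<dots> = s * (cmod (v x))\<^sup>2 + 2 * Re (v x * cnj (T x)) + (cmod (T x))\<^sup>2 / s"
      using s by (simp add: add_divide_distrib power2_eq_square)
    finally have "0 \<le> (s * (cmod (v x))\<^sup>2 + 2 * Re (v x * cnj (T x)) + (cmod (T x))\<^sup>2 / s) * E x"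
      by (simp add: E_def)
    then show "- 2 * (Re (v x * cnj (T x)) * E x) \<le> s * ((cmod (v x))\<^sup>2 * E x) + (cmod (T x))\<^sup>2 * E x / s"
      by (simp add: algebra_simps)
  qed (use s in \<open>auto intro!: intC continuous_intros cv cT cE\<close>)
  also have "\<dots> = (LINT z:C|lborel. s * ((cmod (v z))\<^sup>2 * E z)) + (LINT z:C|lborel. (cmod (T z))\<^sup>2 * E z / s)"
    by (rule set_integral_add) (use s in \<open>auto intro!: intC continuous_intros cv cT cE\<close>)
  also have "\<dots> = s * (LINT z:C|lborel. (cmod (v z))\<^sup>2 * E z) + (LINT z:C|lborel. (cmod (T z))\<^sup>2 * E z) / s"
    by simp
  finally show ?thesis unfolding W by (simp add: v_def n_def)
qed

section \<open>Positivity of the Levi form\<close>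

lemma set_nn_integral_eq_set_integral_nonneg:
  fixes g :: "'a \<Rightarrow> real"
  assumes "set_integrable M D g" "\<And>z. 0 \<le> g z"
  shows "(\<integral>\<^sup>+z\<in>D. ennreal (g z) \<partial>M) = ennreal (LINT z:D|M. g z)"
proof -
  have "ennreal (g z) * indicator D z = ennreal (indicator D z *\<^sub>R g z)" for z
    by (simp add: indicator_def)
  then show ?thesis
    using nn_integral_eq_integral[OF assms(1)[unfolded set_integrable_def]] assms(2)
    by (simp add: set_lebesgue_integral_def)
qed

lemma set_integrable_open_nonneg:
  fixes D :: "'a::euclidean_space set" and g :: "'a \<Rightarrow> real"
  assumes "open D" "continuous_on D g" "\<And>z. 0 \<le> g z" "(\<integral>\<^sup>+z\<in>D. ennreal (g z) \<partial>lborel) < \<infinity>"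
  shows "set_integrable lborel D g"
  unfolding set_integrable_def
proof (rule integrableI_nonneg)
  have "(\<lambda>z. indicator D z *\<^sub>R g z) \<in> borel_measurable borel"
    using assms by (intro borel_measurable_continuous_on_indicator) auto
  then show "(\<lambda>z. indicator D z *\<^sub>R g z) \<in> borel_measurable lborel" by simp
  have "ennreal (indicator D z *\<^sub>R g z) = ennreal (g z) * indicator D z" for z
    by (simp add: indicator_def)
  then show "(\<integral>\<^sup>+z. ennreal (indicator D z *\<^sub>R g z) \<partial>lborel) < \<infinity>" using assms(4) by simp
qed (use assms(3) in auto)

text \<open>The function \<open>H\<close> of the preceding estimates depends on \<open>\<epsilon>\<close>, but after inserting its norm bound
  only \<open>\<epsilon>\<close> itself is left, so that one can let \<open>\<epsilon>\<close> tend to \<open>0\<close> without a compactness argument.\<close>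

lemma divisible_dual_estimate:
  fixes D C :: "(complex^'n::finite) set" and \<phi> :: "complex^'n \<Rightarrow> real"
  assumes D: "open D" and C: "compact C" "C \<subseteq> D" and b: "norm b = 1" and s: "0 < s"
    and f: "f \<in> A2 D \<phi>" and div: "L2_divisible D \<phi> f"
    and d\<phi>: "\<And>x. x \<in> D \<Longrightarrow> has_wirt b (\<lambda>x. complex_of_real (\<phi> x)) (p x) (cnj (p x)) x"
    and dp: "\<And>x. x \<in> D \<Longrightarrow> has_wirt b p (p' x) (q x) x"
    and c\<phi>: "continuous_on D \<phi>" "continuous_on D p" "continuous_on D p'" "continuous_on D q"
    and \<kappa>: "\<And>t. (\<kappa> has_real_derivative \<kappa>' t) (at t)" "\<And>t. (\<kappa>' has_real_derivative \<kappa>'' t) (at t)"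
      "continuous_on UNIV \<kappa>''" and \<kappa>0: "\<And>t. 0 \<le> \<kappa> t"
    and supp: "\<And>x. x \<in> D - C \<Longrightarrow> \<kappa> ((norm (x - a))\<^sup>2) = 0"
  defines "w \<equiv> \<lambda>z. lin_form b (z - a)"
  defines "\<rho> \<equiv> \<lambda>z. (norm (z - a))\<^sup>2"
  defines "E \<equiv> \<lambda>z. exp (- \<phi> z - s * \<rho> z)"
  defines "err \<equiv> \<lambda>z. complex_of_real (\<kappa> (\<rho> z)) * cnj (f z) *
     (f z * (complex_of_real (\<kappa>' (\<rho> z)) * (w z * (p z + complex_of_real s * cnj (w z)) - 1) - complex_of_real (\<kappa>'' (\<rho> z)) * (w z * cnj (w z)))
      - complex_of_real (\<kappa>' (\<rho> z)) * w z * slice_deriv b 1 f z)"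
  shows "2 * (LINT z:C|lborel. \<kappa> (\<rho> z) * (cmod (f z))\<^sup>2 * E z)
     \<le> (LINT z:D|lborel. (cmod (f z))\<^sup>2 * E z)
       + (LINT z:C|lborel. ((\<kappa> (\<rho> z))\<^sup>2 * (cmod (f z))\<^sup>2 * (s + Re (q z)) + Re (err z)) * E z) / s"
proof -
  have holf: "holomorphic_on_cvec f D" using f by (simp add: A2_def)
  have cf: "continuous_on D f" by (rule holomorphic_on_cvec_continuous_on[OF holf])
  have cw: "continuous_on D w" unfolding w_def by (rule continuous_on_lin_form)
  have c\<rho>: "continuous_on D \<rho>" unfolding \<rho>_def by (intro continuous_intros)
  have cE: "continuous_on D E" unfolding E_def by (intro continuous_intros c\<phi> c\<rho>)
  have "continuous_on UNIV \<kappa>"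
    using \<kappa>(1) by (meson DERIV_isCont continuous_at_imp_continuous_on)
  then have c\<kappa>: "continuous_on D (\<lambda>z. \<kappa> (\<rho> z))" using continuous_on_compose2[OF _ c\<rho>] by blast
  note intC = set_integrable_compact[OF C(1) continuous_on_subset[OF _ C(2)]]
  define J where "J = (LINT z:C|lborel. \<kappa> (\<rho> z) * (cmod (f z))\<^sup>2 * E z)"
  define tot where "tot = (LINT z:D|lborel. (cmod (f z))\<^sup>2 * E z)"
  define W where "W = (LINT z:C|lborel. ((\<kappa> (\<rho> z))\<^sup>2 * (cmod (f z))\<^sup>2 * (s + Re (q z)) + Re (err z)) * E z)"
  have intD: "set_integrable lborel D (\<lambda>z. (cmod (f z))\<^sup>2 * E z)"
  proof (rule set_integrable_open_nonneg[OF D])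
    show "(\<integral>\<^sup>+z\<in>D. ennreal ((cmod (f z))\<^sup>2 * E z) \<partial>lborel) < \<infinity>"
      unfolding E_def \<rho>_def using f s by (intro nn_integral_gaussian_finite) (auto simp: A2_def)
  qed (intro continuous_intros cf cE, simp add: E_def)
  have tot: "(\<integral>\<^sup>+z\<in>D. ennreal ((cmod (f z))\<^sup>2 * E z) \<partial>lborel) = ennreal tot" "0 \<le> tot"
    unfolding tot_def
    by (rule set_nn_integral_eq_set_integral_nonneg[OF intD]) (auto simp: E_def set_lebesgue_integral_def intro!: Bochner_Integration.integral_nonneg)
  have "bounded (w ` C)"
    by (intro compact_imp_bounded compact_continuous_image continuous_on_subset[OF cw C(2)] C(1))
  then obtain B where B: "\<And>z. z \<in> C \<Longrightarrow> cmod (w z) \<le> B" by (auto simp: bounded_iff)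
  have main: "2 * J / (1 + \<epsilon>\<^sup>2 * B\<^sup>2)\<^sup>2 \<le> s * (tot / (s - \<epsilon>\<^sup>2)) + W / s" if \<epsilon>: "0 < \<epsilon>" "\<epsilon>\<^sup>2 < s" for \<epsilon>
  proof -
    define N where "N z = 1 + \<epsilon>\<^sup>2 * (cmod (w z))\<^sup>2" for z
    have N1: "1 \<le> N z" for z by (simp add: N_def)
    then have N0: "N z \<noteq> 0" for z by (metis not_one_le_zero)
    have cN: "continuous_on D N" unfolding N_def by (intro continuous_intros cw)
    obtain H where H: "holomorphic_on_cvec H D"
      and le: "(\<integral>\<^sup>+z\<in>D. ennreal ((cmod (H z - f z * (cnj (w z) / complex_of_real (N z))))\<^sup>2 * E z) \<partial>lborel)
        \<le> ennreal (1 / (s - \<epsilon>\<^sup>2)) * (\<integral>\<^sup>+z\<in>D. ennreal ((cmod (f z))\<^sup>2 * E z) \<partial>lborel)"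
      using divisible_imp_almost_holomorphic[OF D c\<phi>(1) f div b \<epsilon>, of a]
      unfolding w_def N_def E_def \<rho>_def by blast
    have cH: "continuous_on D H" by (rule holomorphic_on_cvec_continuous_on[OF H])
    let ?v = "\<lambda>z. (cmod (H z - f z * (cnj (w z) / complex_of_real (N z))))\<^sup>2 * E z"
    have iv: "set_integrable lborel C ?v"
      by (intro intC continuous_intros cH cf cw cN cE) (auto simp: N0)
    have "ennreal (LINT z:C|lborel. ?v z) = (\<integral>\<^sup>+z\<in>C. ennreal (?v z) \<partial>lborel)"
      by (rule set_nn_integral_eq_set_integral_nonneg[OF iv, symmetric]) (simp add: E_def)
    also have "\<dots> \<le> (\<integral>\<^sup>+z\<in>D. ennreal (?v z) \<partial>lborel)" by (rule nn_set_integral_set_mono[OF C(2)])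
    also have "\<dots> \<le> ennreal (1 / (s - \<epsilon>\<^sup>2)) * ennreal tot" using le unfolding tot .
    also have "\<dots> = ennreal (tot / (s - \<epsilon>\<^sup>2))" using tot \<epsilon> by (simp flip: ennreal_mult)
    finally have V: "(LINT z:C|lborel. ?v z) \<le> tot / (s - \<epsilon>\<^sup>2)"
      using tot \<epsilon> by (simp add: ennreal_le_iff)
    have "J / (1 + \<epsilon>\<^sup>2 * B\<^sup>2)\<^sup>2 = (LINT z:C|lborel. \<kappa> (\<rho> z) * (cmod (f z))\<^sup>2 * E z / (1 + \<epsilon>\<^sup>2 * B\<^sup>2)\<^sup>2)"
      unfolding J_def by simp
    also have "\<dots> \<le> (LINT z:C|lborel. \<kappa> (\<rho> z) * (cmod (f z))\<^sup>2 * E z / (N z)\<^sup>2)"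
    proof (rule set_integral_mono)
      show "set_integrable lborel C (\<lambda>z. \<kappa> (\<rho> z) * (cmod (f z))\<^sup>2 * E z / (1 + \<epsilon>\<^sup>2 * B\<^sup>2)\<^sup>2)"
        by (rule set_integrable_divide) (intro intC continuous_intros cf cE c\<kappa>)
      show "set_integrable lborel C (\<lambda>z. \<kappa> (\<rho> z) * (cmod (f z))\<^sup>2 * E z / (N z)\<^sup>2)"
        by (intro intC continuous_intros cf cE c\<kappa> cN) (auto simp: N0)
      fix z assume z: "z \<in> C"
      have "N z \<le> 1 + \<epsilon>\<^sup>2 * B\<^sup>2" unfolding N_def using B[OF z] by (intro add_left_mono mult_left_mono power_mono) auto
      then have "(N z)\<^sup>2 \<le> (1 + \<epsilon>\<^sup>2 * B\<^sup>2)\<^sup>2" using N1[of z] by (intro power_mono) auto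
      then show "\<kappa> (\<rho> z) * (cmod (f z))\<^sup>2 * E z / (1 + \<epsilon>\<^sup>2 * B\<^sup>2)\<^sup>2 \<le> \<kappa> (\<rho> z) * (cmod (f z))\<^sup>2 * E z / (N z)\<^sup>2"
        using N1[of z] \<kappa>0 by (intro divide_left_mono) (auto simp: E_def intro!: mult_pos_pos zero_less_power)
    qed
    finally have "2 * (J / (1 + \<epsilon>\<^sup>2 * B\<^sup>2)\<^sup>2) \<le> 2 * (LINT z:C|lborel. \<kappa> (\<rho> z) * (cmod (f z))\<^sup>2 * E z / (N z)\<^sup>2)" by simp
    also have "\<dots> \<le> s * (LINT z:C|lborel. ?v z) + W / s"
      unfolding W_def err_def E_def N_def w_def \<rho>_def
      by (rule dual_estimate[OF D C b s holf H d\<phi> dp c\<phi> \<kappa> supp])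
    also have "\<dots> \<le> s * (tot / (s - \<epsilon>\<^sup>2)) + W / s" using V s by (intro add_right_mono mult_left_mono) auto
    finally show ?thesis by simp
  qed
  have "2 * J / (1 + 0\<^sup>2 * B\<^sup>2)\<^sup>2 \<le> s * (tot / (s - 0\<^sup>2)) + W / s"
  proof (rule tendsto_le)
    show "((\<lambda>\<epsilon>. 2 * J / (1 + \<epsilon>\<^sup>2 * B\<^sup>2)\<^sup>2) \<longlongrightarrow> 2 * J / (1 + 0\<^sup>2 * B\<^sup>2)\<^sup>2) (at_right 0)"
      "((\<lambda>\<epsilon>. s * (tot / (s - \<epsilon>\<^sup>2)) + W / s) \<longlongrightarrow> s * (tot / (s - 0\<^sup>2)) + W / s) (at_right 0)"
      using s by (auto intro!: tendsto_eq_intros)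
    have "\<forall>\<^sub>F \<epsilon> in at_right 0. \<epsilon> \<in> {0<..<sqrt s}"
      using s by (intro eventually_at_right_real) auto
    then show "\<forall>\<^sub>F \<epsilon> in at_right 0. 2 * J / (1 + \<epsilon>\<^sup>2 * B\<^sup>2)\<^sup>2 \<le> s * (tot / (s - \<epsilon>\<^sup>2)) + W / s"
    proof (rule eventually_mono)
      fix \<epsilon> assume "\<epsilon> \<in> {0<..<sqrt s}"
      then have "0 < \<epsilon>" "\<epsilon>\<^sup>2 < s" using s by (auto simp: real_less_rsqrt power_strict_mono dest: power_strict_mono[of \<epsilon> "sqrt s" 2])
      then show "2 * J / (1 + \<epsilon>\<^sup>2 * B\<^sup>2)\<^sup>2 \<le> s * (tot / (s - \<epsilon>\<^sup>2)) + W / s" by (rule main)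
    qed
  qed simp
  then have "2 * J \<le> tot + W / s" using s by simp
  then show ?thesis unfolding J_def tot_def W_def .
qed

text \<open>On \<open>|z - a|\<^sup>2 \<ge> \<sigma>\<close>, where \<open>\<kappa>\<close> may fail to be \<open>1\<close>, the weight \<open>E\<close> carries a factor of at most
  \<open>e\<^sup>-\<^sup>s\<^sup>\<sigma>\<close>, whereas \<open>J\<close> is bounded below by a multiple of \<open>e\<^sup>-\<^sup>s\<^sup>\<sigma>\<^sup>/\<^sup>2\<close>, the contribution of the ball
  of half the radius. This gap absorbs all errors, including those of size \<open>s\<close>.\<close>

lemma line_laplacian_nonneg_at_nonzero:
  fixes D :: "(complex^'n::finite) set"
  assumes D: "open D" and C2: "Ck_on 2 \<phi> D" and f: "f \<in> A2 D \<phi>" and div: "L2_divisible D \<phi> f"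
    and a: "a \<in> D" "f a \<noteq> 0" and b: "norm b = 1"
  shows "0 \<le> line_laplacian b \<phi> a"
proof (rule ccontr)
  assume neg: "\<not> ?thesis"
  obtain p p' q where W: "\<And>x. x \<in> D \<Longrightarrow> has_wirt b (\<lambda>x. complex_of_real (\<phi> x)) (p x) (cnj (p x)) x"
    "\<And>x. x \<in> D \<Longrightarrow> has_wirt b p (p' x) (q x) x"
    and q: "\<And>x. Re (q x) = line_laplacian b \<phi> x / 4"
    and cpq: "continuous_on D p" "continuous_on D p'" "continuous_on D q"
    using Ck_on_2_wirt[OF C2, of b] by blast
  have c\<phi>: "continuous_on D \<phi>" by (rule Ck_on_2D(5)[OF C2])
  have holf: "holomorphic_on_cvec f D" using f by (simp add: A2_def)
  have cf: "continuous_on D f" by (rule holomorphic_on_cvec_continuous_on[OF holf])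
  \<comment> \<open>Half the absolute value of \<open>Re (q a)\<close>, so that \<open>Re q \<le> - c\<close> persists near \<open>a\<close>.\<close>
  define c where "c = - Re (q a) / 2"
  have c: "0 < c" using neg by (simp add: c_def q)
  define m where "m z = (cmod (f z))\<^sup>2 * exp (- \<phi> z)" for z
  have cm: "continuous_on D m" unfolding m_def by (intro continuous_intros cf c\<phi>)
  have m0: "0 \<le> m z" for z by (simp add: m_def)
  define \<eta> where "\<eta> = m a / 2"
  have \<eta>: "0 < \<eta>" using a by (simp add: \<eta>_def m_def)
  have "open (D \<inter> (\<lambda>z. Re (q z)) -` {..<- c})" "open (D \<inter> m -` {\<eta><..})"
    by (intro continuous_open_preimage[OF _ D] continuous_intros cpq cm; simp)+
  moreover have "D \<inter> (\<lambda>z. Re (q z)) -` {..<- c} = {z\<in>D. Re (q z) < - c}" "D \<inter> m -` {\<eta><..} = {z\<in>D. \<eta> < m z}"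
    by auto
  ultimately have "open {z\<in>D. Re (q z) < - c}" "open {z\<in>D. \<eta> < m z}" by simp_all
  then have "open ({z\<in>D. Re (q z) < - c} \<inter> {z\<in>D. \<eta> < m z})" by (rule open_Int)
  moreover define S where "S = {z\<in>D. Re (q z) < - c} \<inter> {z\<in>D. \<eta> < m z}"
  moreover have "a \<in> S" using a(1) c \<eta> by (simp add: S_def c_def \<eta>_def)
  ultimately have "\<exists>r>0. cball a r \<subseteq> S" by (simp only: open_contains_cball)
  then obtain r where r: "0 < r" "cball a r \<subseteq> {z\<in>D. Re (q z) < - c} \<inter> {z\<in>D. \<eta> < m z}"
    unfolding S_def by blast
  define C where "C = cball a r"
  have C: "compact C" "C \<subseteq> D" using r by (auto simp: C_def)
  have qC: "Re (q z) \<le> - c" and mC: "\<eta> \<le> m z" if "z \<in> C" for z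
    using r that by (auto simp: C_def)
  define \<sigma> where "\<sigma> = r\<^sup>2 / 2"
  have \<sigma>: "0 < \<sigma>" using r by (simp add: \<sigma>_def)
  obtain \<kappa> \<kappa>' \<kappa>'' :: "real \<Rightarrow> real"
    where \<kappa>: "\<And>t. (\<kappa> has_real_derivative \<kappa>' t) (at t)" "\<And>t. (\<kappa>' has_real_derivative \<kappa>'' t) (at t)"
      "continuous_on UNIV \<kappa>''"
    and \<kappa>01: "\<And>t. 0 \<le> \<kappa> t" "\<And>t. \<kappa> t \<le> 1"
    and \<kappa>1: "\<And>t. t \<le> \<sigma> \<Longrightarrow> \<kappa> t = 1" "\<And>t. t \<le> \<sigma> \<Longrightarrow> \<kappa>' t = 0" "\<And>t. t \<le> \<sigma> \<Longrightarrow> \<kappa>'' t = 0"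
    and \<kappa>0: "\<And>t. 2 * \<sigma> \<le> t \<Longrightarrow> \<kappa> t = 0"
    using cutoff_exists[OF \<sigma>] by blast
  define \<rho> where "\<rho> = (\<lambda>z. (norm (z - a))\<^sup>2)"
  define w where "w = (\<lambda>z. lin_form b (z - a))"
  have supp: "\<kappa> (\<rho> x) = 0" if "x \<notin> C" for x
  proof -
    have "r < norm (x - a)" using that by (simp add: C_def dist_norm norm_minus_commute)
    then have "r\<^sup>2 \<le> (norm (x - a))\<^sup>2" using r by (intro power_mono) auto
    then show ?thesis by (intro \<kappa>0) (simp add: \<sigma>_def \<rho>_def)
  qed
  have cw: "continuous_on D w" unfolding w_def by (rule continuous_on_lin_form)
  have c\<rho>: "continuous_on D \<rho>" unfolding \<rho>_def by (intro continuous_intros)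
  have "continuous_on UNIV \<kappa>" "continuous_on UNIV \<kappa>'"
    using \<kappa>(1,2) by (meson DERIV_isCont continuous_at_imp_continuous_on)+
  then have c\<kappa>: "continuous_on D (\<lambda>z. \<kappa> (\<rho> z))" "continuous_on D (\<lambda>z. \<kappa>' (\<rho> z))" "continuous_on D (\<lambda>z. \<kappa>'' (\<rho> z))"
    using \<kappa>(3) continuous_on_compose2[OF _ c\<rho>] by blast+
  have cf1: "continuous_on D (slice_deriv b 1 f)" by (rule continuous_on_slice_deriv[OF holf D])
  define X where "X z = complex_of_real (\<kappa> (\<rho> z)) * cnj (f z) *
     (f z * (complex_of_real (\<kappa>' (\<rho> z)) * (w z * p z - 1) - complex_of_real (\<kappa>'' (\<rho> z)) * (w z * cnj (w z)))
      - complex_of_real (\<kappa>' (\<rho> z)) * w z * slice_deriv b 1 f z)" for z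
  define Y where "Y z = complex_of_real (\<kappa> (\<rho> z)) * cnj (f z) * (f z * (complex_of_real (\<kappa>' (\<rho> z)) * (w z * cnj (w z))))" for z
  have cXY: "continuous_on D X" "continuous_on D Y"
    unfolding X_def Y_def by (intro continuous_intros cf cf1 cw cpq c\<kappa>)+
  have bd: "\<exists>B\<ge>0. \<forall>z\<in>C. cmod (Z z) * exp (- \<phi> z) \<le> B" if "continuous_on D Z" for Z
  proof -
    have "continuous_on C (\<lambda>z. cmod (Z z) * exp (- \<phi> z))"
      by (rule continuous_on_subset[OF _ C(2)]) (intro continuous_intros that c\<phi>)
    then have "bounded ((\<lambda>z. cmod (Z z) * exp (- \<phi> z)) ` C)"
      by (intro compact_imp_bounded compact_continuous_image C(1))
    then obtain B where "\<And>z. z \<in> C \<Longrightarrow> \<bar>cmod (Z z) * exp (- \<phi> z)\<bar> \<le> B" by (auto simp: bounded_iff)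
    then show ?thesis by (intro exI[of _ "max 0 B"]) (auto simp: le_max_iff_disj abs_le_iff)
  qed
  obtain B0 where B0: "0 \<le> B0" "\<And>z. z \<in> C \<Longrightarrow> cmod (X z) * exp (- \<phi> z) \<le> B0" using bd[OF cXY(1)] by blast
  obtain B1 where B1: "0 \<le> B1" "\<And>z. z \<in> C \<Longrightarrow> cmod (Y z) * exp (- \<phi> z) \<le> B1" using bd[OF cXY(2)] by blast
  define V where "V = measure lborel C"
  have V0: "0 \<le> V" by (simp add: V_def)
  have finC: "emeasure lborel C < \<infinity>" using C(1) emeasure_compact_finite by blast
  have Cm: "C \<in> sets lborel" by (simp add: C_def)
  have constC: "set_integrable lborel C (\<lambda>z. k)" "(LINT z:C|lborel. k) = V * k" for k :: real
    using finC Cm by (simp_all add: set_integrable_def set_lebesgue_integral_def V_def)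
  note intC = set_integrable_compact[OF C(1) continuous_on_subset[OF _ C(2)]]
  have fin_m: "(\<integral>\<^sup>+z\<in>D. ennreal (m z) \<partial>lborel) < \<infinity>" using f by (simp add: A2_def m_def)
  have intm: "set_integrable lborel D m" by (rule set_integrable_open_nonneg[OF D cm m0 fin_m])
  define A where "A = (LINT z:D|lborel. m z)"
  define C' where "C' = cball a (r / 2)"
  define \<delta> where "\<delta> = measure lborel C' * \<eta>"
  have \<delta>: "0 < \<delta>" using \<eta> r content_cball_pos[of "r / 2" a] by (simp add: \<delta>_def C'_def)
  have key: "c * \<delta> \<le> exp (- s * (\<sigma> / 2)) * (s * (A + B1 * V) + B0 * V)" if s: "0 < s" "c \<le> s" for s
  proof -
    define E where "E = (\<lambda>z. exp (- \<phi> z - s * \<rho> z))"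
    have cE: "continuous_on D E" unfolding E_def by (intro continuous_intros c\<phi> c\<rho>)
    have E0: "0 < E z" for z by (simp add: E_def)
    have mE: "(cmod (f z))\<^sup>2 * E z = m z * exp (- s * \<rho> z)" for z
      by (simp add: m_def E_def exp_diff exp_minus field_simps)
    define J where "J = (LINT z:C|lborel. \<kappa> (\<rho> z) * (cmod (f z))\<^sup>2 * E z)"
    have iJ: "set_integrable lborel C (\<lambda>z. \<kappa> (\<rho> z) * (cmod (f z))\<^sup>2 * E z)"
      by (intro intC continuous_intros c\<kappa> cf cE)
    define err where "err = (\<lambda>z. complex_of_real (\<kappa> (\<rho> z)) * cnj (f z) *
     (f z * (complex_of_real (\<kappa>' (\<rho> z)) * (w z * (p z + complex_of_real s * cnj (w z)) - 1) - complex_of_real (\<kappa>'' (\<rho> z)) * (w z * cnj (w z)))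
      - complex_of_real (\<kappa>' (\<rho> z)) * w z * slice_deriv b 1 f z))"
    have err: "err z = X z + complex_of_real s * Y z" for z
      by (simp add: err_def X_def Y_def algebra_simps)
    have main: "2 * J \<le> (LINT z:D|lborel. (cmod (f z))\<^sup>2 * E z)
       + (LINT z:C|lborel. ((\<kappa> (\<rho> z))\<^sup>2 * (cmod (f z))\<^sup>2 * (s + Re (q z)) + Re (err z)) * E z) / s"
      unfolding J_def E_def \<rho>_def w_def err_def
      by (rule divisible_dual_estimate[OF D C b s(1) f div W c\<phi> cpq \<kappa> \<kappa>01(1)])
         (use supp in \<open>auto simp: \<rho>_def\<close>)
    have far: "exp (- s * \<rho> z) \<le> exp (- s * \<sigma>)" if "\<sigma> \<le> \<rho> z" for z using that s by simp
    have tot: "(LINT z:D|lborel. (cmod (f z))\<^sup>2 * E z) \<le> J + exp (- s * \<sigma>) * A"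
    proof -
      have iD: "set_integrable lborel D (\<lambda>z. (cmod (f z))\<^sup>2 * E z)"
      proof (rule set_integrable_open_nonneg[OF D])
        show "(\<integral>\<^sup>+z\<in>D. ennreal ((cmod (f z))\<^sup>2 * E z) \<partial>lborel) < \<infinity>"
          unfolding E_def \<rho>_def using f s by (intro nn_integral_gaussian_finite) (auto simp: A2_def)
      qed (intro continuous_intros cf cE, simp add: E_def)
      have "(LINT z:D|lborel. (cmod (f z))\<^sup>2 * E z)
         \<le> (LINT z|lborel. indicator C z *\<^sub>R (\<kappa> (\<rho> z) * (cmod (f z))\<^sup>2 * E z) + exp (- s * \<sigma>) * (indicator D z *\<^sub>R m z))"
        unfolding set_lebesgue_integral_def
      proof (rule integral_mono)
        show "integrable lborel (\<lambda>z. indicator D z *\<^sub>R ((cmod (f z))\<^sup>2 * E z))"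
          using iD by (simp add: set_integrable_def)
        show "integrable lborel (\<lambda>z. indicator C z *\<^sub>R (\<kappa> (\<rho> z) * (cmod (f z))\<^sup>2 * E z) + exp (- s * \<sigma>) * (indicator D z *\<^sub>R m z))"
          using iJ intm unfolding set_integrable_def by (intro Bochner_Integration.integrable_add integrable_mult_right)
        fix z
        show "indicator D z *\<^sub>R ((cmod (f z))\<^sup>2 * E z)
          \<le> indicator C z *\<^sub>R (\<kappa> (\<rho> z) * (cmod (f z))\<^sup>2 * E z) + exp (- s * \<sigma>) * (indicator D z *\<^sub>R m z)"
        proof (cases "z \<in> D")
          case True
          show ?thesis
          proof (cases "\<rho> z \<le> \<sigma>")
            case le: True
            then have "z \<in> C" using supp[of z] \<kappa>1(1)[of "\<rho> z"] by auto
            then show ?thesis using True le \<kappa>1(1)[of "\<rho> z"] m0[of z] by simp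
          next
            case False
            then have "(cmod (f z))\<^sup>2 * E z \<le> exp (- s * \<sigma>) * m z"
              unfolding mE using mult_right_mono[OF far[of z] m0[of z]] by (simp add: mult.commute)
            moreover have "0 \<le> indicator C z *\<^sub>R (\<kappa> (\<rho> z) * (cmod (f z))\<^sup>2 * E z)"
              using \<kappa>01(1)[of "\<rho> z"] E0[of z] by (simp add: less_imp_le)
            ultimately show ?thesis using True by simp
          qed
        next
          case False
          then have "z \<notin> C" using C(2) by auto
          then show ?thesis using False by simp
        qed
      qed
      also have "\<dots> = J + exp (- s * \<sigma>) * A"
        unfolding J_def A_def set_lebesgue_integral_def
        using iJ intm unfolding set_integrable_def by simp
      finally show ?thesis .
    qed
    have "(LINT z:C|lborel. ((\<kappa> (\<rho> z))\<^sup>2 * (cmod (f z))\<^sup>2 * (s + Re (q z)) + Re (err z)) * E z)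
      \<le> (LINT z:C|lborel. (s - c) * (\<kappa> (\<rho> z) * (cmod (f z))\<^sup>2 * E z) + exp (- s * \<sigma>) * (B0 + s * B1))"
    proof (rule set_integral_mono)
      show "set_integrable lborel C (\<lambda>z. ((\<kappa> (\<rho> z))\<^sup>2 * (cmod (f z))\<^sup>2 * (s + Re (q z)) + Re (err z)) * E z)"
        unfolding err by (intro intC continuous_intros c\<kappa> cf cE cpq cXY)
      show "set_integrable lborel C (\<lambda>z. (s - c) * (\<kappa> (\<rho> z) * (cmod (f z))\<^sup>2 * E z) + exp (- s * \<sigma>) * (B0 + s * B1))"
        by (intro intC continuous_intros c\<kappa> cf cE)
      fix z assume z: "z \<in> C"
      have "(\<kappa> (\<rho> z))\<^sup>2 \<le> \<kappa> (\<rho> z)" using \<kappa>01[of "\<rho> z"] by (simp add: power2_eq_square mult_left_le)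
      then have "(\<kappa> (\<rho> z))\<^sup>2 * (s + Re (q z)) \<le> \<kappa> (\<rho> z) * (s - c)"
      proof -
        have "(\<kappa> (\<rho> z))\<^sup>2 * (s + Re (q z)) \<le> (\<kappa> (\<rho> z))\<^sup>2 * (s - c)"
          using qC[OF z] by (intro mult_left_mono) auto
        also have "\<dots> \<le> \<kappa> (\<rho> z) * (s - c)" using \<open>(\<kappa> (\<rho> z))\<^sup>2 \<le> \<kappa> (\<rho> z)\<close> s by (intro mult_right_mono) auto
        finally show ?thesis .
      qed
      then have 1: "((\<kappa> (\<rho> z))\<^sup>2 * (s + Re (q z))) * ((cmod (f z))\<^sup>2 * E z) \<le> (\<kappa> (\<rho> z) * (s - c)) * ((cmod (f z))\<^sup>2 * E z)"
        using E0[of z] by (intro mult_right_mono) (auto simp: less_imp_le)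
      have 2: "Re (err z) * E z \<le> exp (- s * \<sigma>) * (B0 + s * B1)"
      proof (cases "\<rho> z \<le> \<sigma>")
        case True
        then have "err z = 0" unfolding err_def using \<kappa>1(2,3)[OF True] by simp
        then show ?thesis using B0 B1 s by simp
      next
        case False
        have "Re (err z) \<le> cmod (err z)" by (rule complex_Re_le_cmod)
        also have "\<dots> \<le> cmod (X z) + s * cmod (Y z)" unfolding err
          using norm_triangle_ineq[of "X z" "complex_of_real s * Y z"] s by (simp add: norm_mult)
        finally have "Re (err z) * E z \<le> (cmod (X z) + s * cmod (Y z)) * E z"
          using E0[of z] by (intro mult_right_mono) auto
        also have "\<dots> = exp (- s * \<rho> z) * (cmod (X z) * exp (- \<phi> z) + s * (cmod (Y z) * exp (- \<phi> z)))"
          by (simp add: E_def exp_diff exp_minus field_simps)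
        also have "\<dots> \<le> exp (- s * \<sigma>) * (B0 + s * B1)"
          using far[of z] False B0 B1 s z by (intro mult_mono add_mono mult_left_mono) auto
        finally show ?thesis .
      qed
      show "((\<kappa> (\<rho> z))\<^sup>2 * (cmod (f z))\<^sup>2 * (s + Re (q z)) + Re (err z)) * E z
        \<le> (s - c) * (\<kappa> (\<rho> z) * (cmod (f z))\<^sup>2 * E z) + exp (- s * \<sigma>) * (B0 + s * B1)"
        using add_mono[OF 1 2] by (simp add: algebra_simps)
    qed
    also have "\<dots> = (s - c) * J + V * (exp (- s * \<sigma>) * (B0 + s * B1))"
      unfolding J_def by (subst set_integral_add) (use iJ constC in auto)
    finally have Wle: "(LINT z:C|lborel. ((\<kappa> (\<rho> z))\<^sup>2 * (cmod (f z))\<^sup>2 * (s + Re (q z)) + Re (err z)) * E z)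
      \<le> (s - c) * J + V * (exp (- s * \<sigma>) * (B0 + s * B1))" .
    let ?Z = "(s - c) * J + V * (exp (- s * \<sigma>) * (B0 + s * B1))"
    have "2 * J \<le> J + exp (- s * \<sigma>) * A + ?Z / s"
      using main tot divide_right_mono[OF Wle, of s] s by linarith
    then have "2 * J * s \<le> (J + exp (- s * \<sigma>) * A + ?Z / s) * s"
      by (rule mult_right_mono) (use s in simp)
    also have "\<dots> = (J + exp (- s * \<sigma>) * A) * s + ?Z / s * s" by (rule distrib_right)
    also have "?Z / s * s = ?Z" using s by (metis less_irrefl nonzero_eq_divide_eq)
    \<comment> \<open>Here the two copies of \<open>J\<close> on the right nearly cancel the left-hand side; what is left over is
      \<open>c J/s\<close>, multiplied by \<open>s\<close>.\<close>
    finally have cJ: "c * J \<le> exp (- s * \<sigma>) * (s * (A + B1 * V) + B0 * V)"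
      by (simp add: algebra_simps)
    have "exp (- s * (\<sigma> / 2)) * \<delta> \<le> J"
    proof -
      have C'C: "C' \<subseteq> C" using r by (auto simp: C_def C'_def)
      have C': "C' \<in> sets lborel" "emeasure lborel C' < \<infinity>"
        using emeasure_compact_finite[of C'] by (auto simp: C'_def)
      have "exp (- s * (\<sigma> / 2)) * \<delta> = (LINT z|lborel. indicator C' z *\<^sub>R (\<eta> * exp (- s * (\<sigma> / 2))))"
        using C' by (simp add: \<delta>_def)
      also have "\<dots> \<le> J" unfolding J_def set_lebesgue_integral_def
      proof (rule integral_mono)
        show "integrable lborel (\<lambda>z. indicator C' z *\<^sub>R (\<eta> * exp (- s * (\<sigma> / 2))))"
          using C' by (intro integrable_scaleR_left integrable_real_indicator)
        show "integrable lborel (\<lambda>z. indicator C z *\<^sub>R (\<kappa> (\<rho> z) * (cmod (f z))\<^sup>2 * E z))"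
          using iJ by (simp add: set_integrable_def)
        fix z
        show "indicator C' z *\<^sub>R (\<eta> * exp (- s * (\<sigma> / 2))) \<le> indicator C z *\<^sub>R (\<kappa> (\<rho> z) * (cmod (f z))\<^sup>2 * E z)"
        proof (cases "z \<in> C'")
          case True
          then have zC: "z \<in> C" using C'C by auto
          have "norm (z - a) \<le> r / 2" using True by (simp add: C'_def dist_norm norm_minus_commute)
          then have "\<rho> z \<le> (r / 2)\<^sup>2" unfolding \<rho>_def by (intro power_mono) auto
          then have \<rho>z: "\<rho> z \<le> \<sigma> / 2" by (simp add: \<sigma>_def power_divide)
          then have "\<kappa> (\<rho> z) = 1" using \<sigma> by (intro \<kappa>1) auto
          moreover have "\<eta> * exp (- s * (\<sigma> / 2)) \<le> m z * exp (- s * \<rho> z)"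
            using mC[OF zC] \<rho>z s \<eta> by (intro mult_mono) auto
          ultimately show ?thesis using True zC by (simp add: mE)
        next
          case False
          then show ?thesis using \<kappa>01(1)[of "\<rho> z"] E0[of z] by (simp add: less_imp_le)
        qed
      qed
      finally show ?thesis .
    qed
    then have "c * (exp (- s * (\<sigma> / 2)) * \<delta>) \<le> c * J" using c by simp
    also note cJ
    also have "exp (- s * \<sigma>) = exp (- s * (\<sigma> / 2)) * exp (- s * (\<sigma> / 2))" by (simp flip: exp_add)
    finally have "exp (- s * (\<sigma> / 2)) * (c * \<delta>) \<le> exp (- s * (\<sigma> / 2)) * (exp (- s * (\<sigma> / 2)) * (s * (A + B1 * V) + B0 * V))"
      by (simp only: mult_ac)
    then show ?thesis by (simp only: mult_le_cancel_left_pos exp_gt_zero)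
  qed
  have "((\<lambda>s. exp (- s * (\<sigma> / 2)) * (s * (A + B1 * V) + B0 * V)) \<longlongrightarrow> 0) at_top"
    using \<sigma> by real_asymp
  moreover have "\<forall>\<^sub>F s in at_top. c * \<delta> \<le> exp (- s * (\<sigma> / 2)) * (s * (A + B1 * V) + B0 * V)"
    using eventually_ge_at_top[of c] by (rule eventually_mono) (use key c in force)
  ultimately have "c * \<delta> \<le> 0" by (intro tendsto_lowerbound[of _ 0 at_top]) auto
  then show False using c \<delta> by (simp add: mult_le_0_iff)
qed

theorem theorem1p4:
  fixes D :: "(complex^'n::finite) set" and \<phi> :: "complex^'n \<Rightarrow> real"
  assumes "open D" and "connected D" and "bounded D"
    and "Ck_on 2 \<phi> D"
    and "\<exists>f\<in>A2 D \<phi>. (\<exists>z\<in>D. f z \<noteq> 0) \<and> L2_divisible D \<phi> f"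
  shows "plurisubharmonic_on D \<phi>"
proof (rule plurisubharmonic_on_of_line_laplacian_nonneg[OF assms(1,4)])
  fix b x :: "complex^'n" assume b: "norm b = 1" and x: "x \<in> D"
  from assms(5) obtain f z where f: "f \<in> A2 D \<phi>" "L2_divisible D \<phi> f" and z: "z \<in> D" "f z \<noteq> 0" by blast
  have holf: "holomorphic_on_cvec f D" using f by (simp add: A2_def)
  have cont: "continuous_on D (line_laplacian b \<phi>)"
    unfolding line_laplacian_def by (intro continuous_intros Ck_on_2D(3)[OF assms(4)])
  show "0 \<le> line_laplacian b \<phi> x"
  proof (rule ccontr)
    assume neg: "\<not> ?thesis"
    obtain e where e: "0 < e" "\<And>y. y \<in> D \<Longrightarrow> dist y x < e \<Longrightarrow> dist (line_laplacian b \<phi> y) (line_laplacian b \<phi> x) < - line_laplacian b \<phi> x"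
      using cont x neg unfolding continuous_on_iff by (metis neg_0_less_iff_less not_le)
    obtain y where y: "y \<in> D" "dist x y < e" "f y \<noteq> 0"
      using holomorphic_identity_cvec[OF holf assms(1,2) z x e(1)] by blast
    have "0 \<le> line_laplacian b \<phi> y"
      by (rule line_laplacian_nonneg_at_nonzero[OF assms(1,4) f y(1,3) b])
    with e(2)[OF y(1)] y(2) show False by (simp add: dist_commute dist_real_def)
  qed
qed

end
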